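(* Fix an integer $\Delta\ge 2$. For every $\eta\in(0,1)$ there are constants $c_1,c_2>0$ (depending only on $\eta$ and $\Delta$) such that for every integer $q\ge 2$ and every real $\lambda>1$: (i) if $q>c_1\lambda^{\Delta-1+\eta}$, then the Glauber dynamics $\mathcal{M}_{\mathrm{GD}}(G,\lambda,q)$ mixes rapidly on the class of connected graphs $G$ of maximum degree $\Delta$; (ii) if $\Delta\ge 3$ and $q<c_2\lambda^{\Delta-1-\frac{1}{\Delta-1}-\eta}$, then the Glauber dynamics mixes slowly for almost all $\Delta$-regular graphs, i.e. there is a constant $b>0$ such that, for $G$ drawn uniformly from $\mathcal{G}_{n,\Delta}$, asymptotically almost surely (as $n\to\infty$) $\tau(\mathcal{M}_{\mathrm{GD}}(G,\lambda,q))\ge 2^{bn}$.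
   Context: Potts model: for a graph $G=(V,E)$ with $n=|V|$, a positive integer $q$, $[q]=\{1,\dots,q\}$ and $\lambda>1$, a configuration is any $\sigma\in\Omega=[q]^V$ (not necessarily proper); $\mu(\sigma)$ is the number of monochromatic edges (edges whose endpoints get the same colour). The Gibbs distribution is $\pi(\sigma)=\lambda^{\mu(\sigma)}/Z$ with partition function $Z=Z(G,\lambda,q)=\sum_{\sigma\in\Omega}\lambda^{\mu(\sigma)}$. The Glauber dynamics $\mathcal{M}_{\mathrm{GD}}(G,\lambda,q)$ is the Markov chain on $\Omega$ which, from state $X_t$, chooses a vertex $v$ uniformly at random, chooses a colour $c\in[q]$ with probability proportional to $\lambda^{n(X_t,v,c)}$ (where $n(X,v,c)$ is the number of neighbours of $v$ coloured $c$ in $X$), and sets $X_{t+1}$ equal to $X_t$ except that $v$ receives colour $c$. For a Markov chain $\mathcal{M}$ with transition matrix $P$ and stationary distribution $\pi$, $\tau_x(\mathcal{M},\varepsilon)=\min\{t:\|P^t(x,\cdot)-\pi\|_{TV}\le\varepsilon\}$, $\tau(\mathcal{M},\varepsilon)=\max_x\tau_x(\mathcal{M},\varepsilon)$, and $\tau(\mathcal{M})=\tau(\mathcal{M},1/(2e))$, where $\|\phi-\phi'\|_{TV}=\frac12\sum_x|\phi(x)-\phi'(x)|$. "Mixes rapidly on a class of graphs" means: for every fixed $\varepsilon>0$ there is a polynomial $p$ (possibly depending on $\varepsilon,\Delta,\lambda,q$) with $\tau(\mathcal{M}_{\mathrm{GD}}(G,\lambda,q),\varepsilon)\le p(n)$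 for every $n$-vertex graph $G$ in the class. $\mathcal{G}_{n,\Delta}$ denotes the uniform probability space of $\Delta$-regular simple graphs on vertex set $\{1,\dots,n\}$ ($n$ even if $\Delta$ odd); an event holds asymptotically almost surely (a.a.s.) if its probability tends to $1$ as $n\to\infty$. *)

theory Defs
  imports "HOL-Analysis.Analysis" "HOL-Computational_Algebra.Polynomial"
begin

definition simple_graph :: "nat set \<Rightarrow> nat set set \<Rightarrow> bool" where
  "simple_graph V E \<longleftrightarrow> finite V \<and>
     (\<forall>e\<in>E. \<exists>u v. e = {u, v} \<and> u \<noteq> v \<and> u \<in> V \<and> v \<in> V)"

definition nbrs :: "nat set set \<Rightarrow> nat \<Rightarrow> nat set" where
  "nbrs E v = {u. {u, v} \<in> E}"

definition degree :: "nat set set \<Rightarrow> nat \<Rightarrow> nat" where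
  "degree E v = card (nbrs E v)"

definition max_degree_eq :: "nat set \<Rightarrow> nat set set \<Rightarrow> nat \<Rightarrow> bool" where
  "max_degree_eq V E \<Delta> \<longleftrightarrow> (\<forall>v\<in>V. degree E v \<le> \<Delta>) \<and> (\<exists>v\<in>V. degree E v = \<Delta>)"

definition regular :: "nat set \<Rightarrow> nat set set \<Rightarrow> nat \<Rightarrow> bool" where
  "regular V E \<Delta> \<longleftrightarrow> (\<forall>v\<in>V. degree E v = \<Delta>)"

definition connected_graph :: "nat set \<Rightarrow> nat set set \<Rightarrow> bool" where
  "connected_graph V E \<longleftrightarrow> V \<noteq> {} \<and>
     (\<forall>u\<in>V. \<forall>v\<in>V. (\<lambda>x y. {x, y} \<in> E)\<^sup>*\<^sup>* u v)"

definition configs :: "nat set \<Rightarrow> nat \<Rightarrow> (nat \<Rightarrow> nat) set" where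
  "configs V q = (V \<rightarrow>\<^sub>E {1..q})"

definition mono_edges :: "nat set set \<Rightarrow> (nat \<Rightarrow> nat) \<Rightarrow> nat" where
  "mono_edges E \<sigma> = card {e\<in>E. \<exists>u v. e = {u, v} \<and> \<sigma> u = \<sigma> v}"

definition partition_fn :: "nat set \<Rightarrow> nat set set \<Rightarrow> real \<Rightarrow> nat \<Rightarrow> real" where
  "partition_fn V E lam q = (\<Sum>\<sigma>\<in>configs V q. lam ^ mono_edges E \<sigma>)"

definition gibbs :: "nat set \<Rightarrow> nat set set \<Rightarrow> real \<Rightarrow> nat \<Rightarrow> (nat \<Rightarrow> nat) \<Rightarrow> real" where
  "gibbs V E lam q \<sigma> = lam ^ mono_edges E \<sigma> / partition_fn V E lam q"

definition ncol :: "nat set set \<Rightarrow> (nat \<Rightarrow> nat) \<Rightarrow> nat \<Rightarrow> nat \<Rightarrow> nat" where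
  "ncol E \<sigma> v c = card {u \<in> nbrs E v. \<sigma> u = c}"

definition glauber :: "nat set \<Rightarrow> nat set set \<Rightarrow> real \<Rightarrow> nat \<Rightarrow>
    (nat \<Rightarrow> nat) \<Rightarrow> (nat \<Rightarrow> nat) \<Rightarrow> real" where
  "glauber V E lam q \<sigma> \<tau> =
     (1 / real (card V)) * (\<Sum>v\<in>V. \<Sum>c\<in>{1..q}.
        (if \<tau> = \<sigma>(v := c)
         then lam ^ ncol E \<sigma> v c / (\<Sum>c'\<in>{1..q}. lam ^ ncol E \<sigma> v c')
         else 0))"

primrec glauber_pow :: "nat set \<Rightarrow> nat set set \<Rightarrow> real \<Rightarrow> nat \<Rightarrow> nat \<Rightarrow>
    (nat \<Rightarrow> nat) \<Rightarrow> (nat \<Rightarrow> nat) \<Rightarrow> real" where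
  "glauber_pow V E lam q 0 \<sigma> \<tau> = (if \<sigma> = \<tau> then 1 else 0)"
| "glauber_pow V E lam q (Suc t) \<sigma> \<tau> =
     (\<Sum>\<rho>\<in>configs V q. glauber_pow V E lam q t \<sigma> \<rho> * glauber V E lam q \<rho> \<tau>)"

definition tv_dist :: "nat set \<Rightarrow> nat set set \<Rightarrow> real \<Rightarrow> nat \<Rightarrow> nat \<Rightarrow> (nat \<Rightarrow> nat) \<Rightarrow> real" where
  "tv_dist V E lam q t \<sigma> =
     (1/2) * (\<Sum>\<tau>\<in>configs V q. \<bar>glauber_pow V E lam q t \<sigma> \<tau> - gibbs V E lam q \<tau>\<bar>)"

definition mix_time_from :: "nat set \<Rightarrow> nat set set \<Rightarrow> real \<Rightarrow> nat \<Rightarrow> real \<Rightarrow> (nat \<Rightarrow> nat) \<Rightarrow> nat" where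
  "mix_time_from V E lam q \<epsilon> \<sigma> = (LEAST t. tv_dist V E lam q t \<sigma> \<le> \<epsilon>)"

definition mix_time_eps :: "nat set \<Rightarrow> nat set set \<Rightarrow> real \<Rightarrow> nat \<Rightarrow> real \<Rightarrow> nat" where
  "mix_time_eps V E lam q \<epsilon> = Max ((mix_time_from V E lam q \<epsilon>) ` configs V q)"

definition mix_time :: "nat set \<Rightarrow> nat set set \<Rightarrow> real \<Rightarrow> nat \<Rightarrow> nat" where
  "mix_time V E lam q = mix_time_eps V E lam q (1 / (2 * exp 1))"

definition mixes_rapidly_on :: "(nat set \<Rightarrow> nat set set \<Rightarrow> bool) \<Rightarrow> real \<Rightarrow> nat \<Rightarrow> bool" where
  "mixes_rapidly_on C lam q \<longleftrightarrow>
     (\<forall>\<epsilon>>0. \<exists>p :: real poly. \<forall>V E. C V E \<longrightarrow>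
        real (mix_time_eps V E lam q \<epsilon>) \<le> poly p (real (card V)))"

definition reg_graphs :: "nat \<Rightarrow> nat \<Rightarrow> nat set set set" where
  "reg_graphs n \<Delta> = {E. simple_graph {1..n} E \<and> regular {1..n} E \<Delta>}"

definition prob_reg :: "nat \<Rightarrow> nat \<Rightarrow> (nat set set \<Rightarrow> bool) \<Rightarrow> real" where
  "prob_reg n \<Delta> P = real (card {E \<in> reg_graphs n \<Delta>. P E}) / real (card (reg_graphs n \<Delta>))"

definition aas_reg :: "nat \<Rightarrow> (nat \<Rightarrow> nat set set \<Rightarrow> bool) \<Rightarrow> bool" where
  "aas_reg \<Delta> P \<longleftrightarrow>
     ((\<lambda>n. prob_reg n \<Delta> (P n)) \<longlongrightarrow> 1) (inf sequentially (principal {n. even (n * \<Delta>)}))"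

end

theory Submission
  imports Defs
begin

text \<open>
  Rapid mixing. Consider the block dynamics whose blocks are connected sets of \<open>k \<ge> 1/\<eta>\<close> vertices.
  Whatever the boundary condition, a fixed vertex of a block receives a fixed colour with
  probability \<open>O(1/c1)\<close>: summing the vertices out in the reverse of an order that grows the block
  from a root, every vertex except the root sees at most \<open>\<Delta> - 1\<close> coloured neighbours, and the root
  can be chosen to have a neighbour of another colour unless all edges touching the block are
  monochromatic, in which case the weight is at most \<open>lam^((\<Delta>-1)k+1) \<le> q^k/c1\<close>.
  So the block dynamics contracts Lipschitz constants; reversibility turns this into a spectral gap,
  and comparing Dirichlet forms gives a gap of order \<open>1/n^2\<close> for the Glauber dynamics.

  Slow mixing. The configurations in which exactly \<open>u\<close> vertices, a small fraction of all, are not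
  coloured 1 form a bottleneck. If \<open>U\<close> is the set of these vertices, inducing \<open>e(U)\<close> edges of which
  \<open>m\<close> are monochromatic, the weight is \<open>lam^(|E| - \<Delta>u + e(U) + m)\<close>. In almost every \<open>\<Delta>\<close>-regular
  graph all these induced subgraphs have cyclomatic number at most a small multiple of \<open>u\<close>, as if
  they were forests, so for each \<open>U\<close> the total weight is about \<open>lam^|E| ((q + \<Delta> lam) lam^(1-\<Delta>))^u\<close>.
  The sparsity is a first moment bound: by switchings, a random regular graph contains a given set
  \<open>F\<close> of edges with probability at most \<open>(\<Delta>^2/n)^|F|\<close>.
\<close>

section \<open>Averaging over the classes of a partition\<close>

text \<open>With one-vertex blocks the argument would stop at \<open>q\<close> of order
  \<open>lam ^ \<Delta>\<close>: a vertex whose \<Delta> neighbours agree copies their colour with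
  odds \<open>lam ^ \<Delta>\<close> against \<open>q\<close>. In a block of \<open>k\<close>
  vertices the same unanimity costs \<open>lam ^ ((\<Delta> - 1) * k + 1)\<close> against
  \<open>q ^ k\<close>, that is, exponent \<Delta> - 1 + 1/k per vertex; this is the origin of
  \<open>k \<ge> 1/\<eta>\<close>. The contraction estimate concerns a chain other than Glauber, and
  Dirichlet forms are what can be compared between the two, hence the detour through a spectral gap.
  For slow mixing, \<open>c2\<close> must be fixed before \<open>lam\<close>, and \<open>lam\<close>
  is unbounded. A loss of order \<open>lam ^ (4 * J)\<close> caused by cycles therefore cannot be
  hidden in \<open>c2\<close>; it is paid from the slack \<eta> in the exponent, which forces
  \<open>J\<close> to be at most a small multiple of \<eta> times \<open>u\<close>. The loss
  \<open>2 ^ n\<close> from choosing the defect set is free of \<open>lam\<close> and is absorbed by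
  \<open>c2\<close>. The constants are chosen in the order \<open>L\<close> (from \<eta>),
  \<open>R\<close> (sparsity of sets of density 1/R), \<open>s\<close> (beating
  \<open>2 ^ n\<close>), \<open>c2\<close>.\<close>

locale weighted_space =
  fixes \<Omega> :: "'s set" and w :: "'s \<Rightarrow> real"
  assumes finite_space: "finite \<Omega>"
    and weight_pos: "\<sigma> \<in> \<Omega> \<Longrightarrow> 0 < w \<sigma>"
begin

definition ip :: "('s \<Rightarrow> real) \<Rightarrow> ('s \<Rightarrow> real) \<Rightarrow> real" where
  "ip f g = (\<Sum>\<sigma>\<in>\<Omega>. w \<sigma> * f \<sigma> * g \<sigma>)"

text \<open>A partition is encoded by the map from a state to its own class, so that resampling
  within a class is a function of the current state.\<close>

definition partitions :: "('s \<Rightarrow> 's set) \<Rightarrow> bool" where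
  "partitions C \<longleftrightarrow> (\<forall>\<sigma>\<in>\<Omega>. \<sigma> \<in> C \<sigma> \<and> C \<sigma> \<subseteq> \<Omega> \<and> (\<forall>\<tau>\<in>C \<sigma>. C \<tau> = C \<sigma>))"

definition mass :: "('s \<Rightarrow> 's set) \<Rightarrow> 's \<Rightarrow> real" where
  "mass C \<sigma> = (\<Sum>\<tau>\<in>C \<sigma>. w \<tau>)"

text \<open>Conditional expectation given the class, for the measure proportional to
  \<open>w\<close>: one heat-bath update.\<close>

definition avg :: "('s \<Rightarrow> 's set) \<Rightarrow> ('s \<Rightarrow> real) \<Rightarrow> 's \<Rightarrow> real" where
  "avg C f \<sigma> = (\<Sum>\<tau>\<in>C \<sigma>. w \<tau> * f \<tau>) / mass C \<sigma>"

text \<open>Since \<open>avg C\<close> is an orthogonal projection, this is the squared norm of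
  \<open>f - avg C f\<close>, the total conditional variance.\<close>

definition dirichlet :: "('s \<Rightarrow> 's set) \<Rightarrow> ('s \<Rightarrow> real) \<Rightarrow> real" where
  "dirichlet C f = ip f f - ip f (avg C f)"

lemma partitionsD:
  assumes "partitions C" "\<sigma> \<in> \<Omega>"
  shows "\<sigma> \<in> C \<sigma>" "C \<sigma> \<subseteq> \<Omega>" "\<And>\<tau>. \<tau> \<in> C \<sigma> \<Longrightarrow> C \<tau> = C \<sigma>" "finite (C \<sigma>)"
    "\<And>\<tau>. \<tau> \<in> C \<sigma> \<Longrightarrow> \<tau> \<in> \<Omega>"
  using assms finite_subset[OF _ finite_space] unfolding partitions_def by blast+

lemma mass_pos: "partitions C \<Longrightarrow> \<sigma> \<in> \<Omega> \<Longrightarrow> 0 < mass C \<sigma>"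
  unfolding mass_def
  by (intro sum_pos) (use partitionsD(1,4,5)[of C \<sigma>] weight_pos in auto)

lemma mass_cong: "partitions C \<Longrightarrow> \<sigma> \<in> \<Omega> \<Longrightarrow> \<tau> \<in> C \<sigma> \<Longrightarrow> mass C \<tau> = mass C \<sigma>"
  unfolding mass_def using partitionsD(3) by metis

lemma avg_cong: "partitions C \<Longrightarrow> \<sigma> \<in> \<Omega> \<Longrightarrow> \<tau> \<in> C \<sigma> \<Longrightarrow> avg C f \<tau> = avg C f \<sigma>"
  unfolding avg_def mass_def using partitionsD(3) by metis

text \<open>Lying in the same class is a symmetric relation, so the double sum may be transposed.
  Reversibility rests on this.\<close>

lemma sum_classes_swap:
  assumes "partitions C"
  shows "(\<Sum>\<sigma>\<in>\<Omega>. \<Sum>\<tau>\<in>C \<sigma>. h \<sigma> \<tau>) = (\<Sum>\<sigma>\<in>\<Omega>. \<Sum>\<tau>\<in>C \<sigma>. h \<tau> (\<sigma>::'s) :: real)"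
proof -
  have eq: "C \<sigma> = {\<tau>\<in>\<Omega>. \<tau> \<in> C \<sigma>}" if "\<sigma> \<in> \<Omega>" for \<sigma>
    using partitionsD[OF assms that] by blast
  have sym: "\<tau> \<in> C \<sigma> \<longleftrightarrow> \<sigma> \<in> C \<tau>" if "\<sigma> \<in> \<Omega>" "\<tau> \<in> \<Omega>" for \<sigma> \<tau>
    using partitionsD(1,3)[OF assms] that by metis
  have "(\<Sum>\<sigma>\<in>\<Omega>. \<Sum>\<tau>\<in>C \<sigma>. h \<sigma> \<tau>) = (\<Sum>\<sigma>\<in>\<Omega>. \<Sum>\<tau> | \<tau> \<in> \<Omega> \<and> \<tau> \<in> C \<sigma>. h \<sigma> \<tau>)"
    using eq by (intro sum.cong) auto
  also have "\<dots> = (\<Sum>\<tau>\<in>\<Omega>. \<Sum>\<sigma> | \<sigma> \<in> \<Omega> \<and> \<tau> \<in> C \<sigma>. h \<sigma> \<tau>)"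
    by (rule sum.swap_restrict) (rule finite_space)+
  also have "\<dots> = (\<Sum>\<tau>\<in>\<Omega>. \<Sum>\<sigma>\<in>C \<tau>. h \<sigma> \<tau>)"
    using eq sym by (intro sum.cong refl) blast
  finally show ?thesis .
qed

text \<open>Detailed balance: the kernel \<open>w \<sigma> * w \<tau> / mass C \<sigma>\<close> is
  symmetric because \<open>mass\<close> is constant on a class.\<close>

lemma ip_avg_sym:
  assumes "partitions C"
  shows "ip (avg C f) g = ip f (avg C g)"
proof -
  have "ip (avg C f) g = (\<Sum>\<sigma>\<in>\<Omega>. \<Sum>\<tau>\<in>C \<sigma>. w \<sigma> * w \<tau> * f \<tau> * g \<sigma> / mass C \<sigma>)"
    unfolding ip_def avg_def
    by (intro sum.cong) (auto simp: sum_distrib_left sum_distrib_right sum_divide_distrib field_simps)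
  also have "\<dots> = (\<Sum>\<sigma>\<in>\<Omega>. \<Sum>\<tau>\<in>C \<sigma>. w \<tau> * w \<sigma> * f \<sigma> * g \<tau> / mass C \<tau>)"
    by (rule sum_classes_swap[OF assms])
  also have "\<dots> = (\<Sum>\<sigma>\<in>\<Omega>. \<Sum>\<tau>\<in>C \<sigma>. w \<tau> * w \<sigma> * f \<sigma> * g \<tau> / mass C \<sigma>)"
    by (intro sum.cong refl) (metis mass_cong[OF assms])
  also have "\<dots> = ip f (avg C g)"
    unfolding ip_def avg_def
    by (intro sum.cong) (auto simp: sum_distrib_left sum_distrib_right sum_divide_distrib field_simps)
  finally show ?thesis .
qed

lemma avg_idem:
  assumes "partitions C" "\<sigma> \<in> \<Omega>"
  shows "avg C (avg C f) \<sigma> = avg C f \<sigma>"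
proof -
  have "avg C (avg C f) \<sigma> = (\<Sum>\<tau>\<in>C \<sigma>. w \<tau> * avg C f \<sigma>) / mass C \<sigma>"
    unfolding avg_def[of C "avg C f"] using avg_cong[OF assms, of _ f] by (metis (no_types, lifting) sum.cong)
  also have "\<dots> = mass C \<sigma> * avg C f \<sigma> / mass C \<sigma>"
    unfolding mass_def by (simp add: sum_distrib_right)
  finally show ?thesis using mass_pos[OF assms] by simp
qed

lemma ip_cong: "(\<And>\<sigma>. \<sigma> \<in> \<Omega> \<Longrightarrow> f \<sigma> = f' \<sigma>) \<Longrightarrow> (\<And>\<sigma>. \<sigma> \<in> \<Omega> \<Longrightarrow> g \<sigma> = g' \<sigma>) \<Longrightarrow> ip f g = ip f' g'"
  unfolding ip_def by (intro sum.cong) auto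

lemma avg_fun_cong:
  "partitions C \<Longrightarrow> \<sigma> \<in> \<Omega> \<Longrightarrow> (\<And>\<tau>. \<tau> \<in> \<Omega> \<Longrightarrow> f \<tau> = g \<tau>) \<Longrightarrow> avg C f \<sigma> = avg C g \<sigma>"
  unfolding avg_def
  by (rule arg_cong[where f = "\<lambda>x. x / _"], rule sum.cong[OF refl]) (simp add: partitionsD(5)[of C \<sigma>])

lemma ip_avg_avg: "partitions C \<Longrightarrow> ip (avg C f) (avg C f) = ip f (avg C f)"
  using ip_avg_sym[of C f "avg C f"] ip_cong[of f f "avg C (avg C f)" "avg C f"] avg_idem by simp

lemma avg_const: "partitions C \<Longrightarrow> \<sigma> \<in> \<Omega> \<Longrightarrow> avg C (\<lambda>_. a) \<sigma> = a"
  using mass_pos[of C \<sigma>] unfolding avg_def mass_def by (simp flip: sum_distrib_right)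

text \<open>Expand the square: each of the two pure squares sums to \<open>ip f f\<close>, the mixed
  term to \<open>ip f (avg C f)\<close>.\<close>

lemma dirichlet_eq:
  assumes "partitions C"
  shows "dirichlet C f = (\<Sum>\<sigma>\<in>\<Omega>. \<Sum>\<tau>\<in>C \<sigma>. w \<sigma> * w \<tau> / mass C \<sigma> * (f \<sigma> - f \<tau>)\<^sup>2) / 2"
proof -
  have sq: "(\<Sum>\<sigma>\<in>\<Omega>. \<Sum>\<tau>\<in>C \<sigma>. w \<sigma> * w \<tau> / mass C \<sigma> * (f \<sigma>)\<^sup>2) = ip f f"
  proof -
    have "(\<Sum>\<tau>\<in>C \<sigma>. w \<sigma> * w \<tau> / mass C \<sigma> * (f \<sigma>)\<^sup>2) = w \<sigma> * f \<sigma> * f \<sigma>" if "\<sigma> \<in> \<Omega>" for \<sigma>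
    proof -
      have "(\<Sum>\<tau>\<in>C \<sigma>. w \<sigma> * w \<tau> / mass C \<sigma> * (f \<sigma>)\<^sup>2) = (\<Sum>\<tau>\<in>C \<sigma>. w \<tau>) * (w \<sigma> * (f \<sigma>)\<^sup>2 / mass C \<sigma>)"
        unfolding sum_distrib_right by (intro sum.cong) auto
      then show ?thesis using mass_pos[OF assms that] by (simp add: mass_def[symmetric] power2_eq_square)
    qed
    then show ?thesis unfolding ip_def by (intro sum.cong) auto
  qed
  have sq': "(\<Sum>\<sigma>\<in>\<Omega>. \<Sum>\<tau>\<in>C \<sigma>. w \<sigma> * w \<tau> / mass C \<sigma> * (f \<tau>)\<^sup>2) = ip f f"
  proof -
    have "(\<Sum>\<sigma>\<in>\<Omega>. \<Sum>\<tau>\<in>C \<sigma>. w \<sigma> * w \<tau> / mass C \<sigma> * (f \<tau>)\<^sup>2)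
        = (\<Sum>\<sigma>\<in>\<Omega>. \<Sum>\<tau>\<in>C \<sigma>. w \<tau> * w \<sigma> / mass C \<tau> * (f \<sigma>)\<^sup>2)"
      by (rule sum_classes_swap[OF assms])
    also have "\<dots> = (\<Sum>\<sigma>\<in>\<Omega>. \<Sum>\<tau>\<in>C \<sigma>. w \<sigma> * w \<tau> / mass C \<sigma> * (f \<sigma>)\<^sup>2)"
      by (intro sum.cong refl) (metis mass_cong[OF assms] mult.commute)
    finally show ?thesis using sq by simp
  qed
  have cross: "(\<Sum>\<sigma>\<in>\<Omega>. \<Sum>\<tau>\<in>C \<sigma>. w \<sigma> * w \<tau> / mass C \<sigma> * (f \<sigma> * f \<tau>)) = ip f (avg C f)"
    unfolding ip_def avg_def
    by (intro sum.cong) (auto simp: sum_distrib_left sum_distrib_right sum_divide_distrib field_simps)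
  have "(\<Sum>\<sigma>\<in>\<Omega>. \<Sum>\<tau>\<in>C \<sigma>. w \<sigma> * w \<tau> / mass C \<sigma> * (f \<sigma> - f \<tau>)\<^sup>2)
     = (\<Sum>\<sigma>\<in>\<Omega>. \<Sum>\<tau>\<in>C \<sigma>. w \<sigma> * w \<tau> / mass C \<sigma> * (f \<sigma>)\<^sup>2)
     + (\<Sum>\<sigma>\<in>\<Omega>. \<Sum>\<tau>\<in>C \<sigma>. w \<sigma> * w \<tau> / mass C \<sigma> * (f \<tau>)\<^sup>2)
     - 2 * (\<Sum>\<sigma>\<in>\<Omega>. \<Sum>\<tau>\<in>C \<sigma>. w \<sigma> * w \<tau> / mass C \<sigma> * (f \<sigma> * f \<tau>))"
    unfolding sum_distrib_left sum.distrib[symmetric] sum_subtractf[symmetric]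
    by (intro sum.cong refl) (auto simp: algebra_simps power2_eq_square diff_divide_distrib add_divide_distrib)
  then show ?thesis unfolding dirichlet_def sq sq' cross by simp
qed

lemma dirichlet_nonneg: "partitions C \<Longrightarrow> 0 \<le> dirichlet C f"
  unfolding dirichlet_eq
  by (intro divide_nonneg_pos sum_nonneg mult_nonneg_nonneg)
     (auto simp: less_imp_le weight_pos mass_pos dest: partitionsD(5))

lemma ip_nonneg: "0 \<le> ip f f"
  unfolding ip_def by (intro sum_nonneg) (simp add: less_imp_le weight_pos mult.assoc)

lemma ip_cauchy_schwarz: "(ip f g)\<^sup>2 \<le> ip f f * ip g g"
proof -
  have a: "ip f g = (\<Sum>\<sigma>\<in>\<Omega>. (sqrt (w \<sigma>) * f \<sigma>) * (sqrt (w \<sigma>) * g \<sigma>))" for f g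
    unfolding ip_def
    by (intro sum.cong refl) (use weight_pos in \<open>simp add: less_imp_le algebra_simps flip: power2_eq_square\<close>)
  show ?thesis
    unfolding a[of f g] a[of f f] a[of g g]
    using Cauchy_Schwarz_ineq_sum[of "\<lambda>\<sigma>. sqrt (w \<sigma>) * f \<sigma>" "\<lambda>\<sigma>. sqrt (w \<sigma>) * g \<sigma>" \<Omega>]
    by (simp add: power2_eq_square)
qed

text \<open>The transition operator of the chain that picks an index uniformly and resamples within
  the class for that index. Block dynamics and Glauber dynamics are both instances.\<close>

definition mix_avg :: "'i set \<Rightarrow> ('i \<Rightarrow> 's \<Rightarrow> 's set) \<Rightarrow> ('s \<Rightarrow> real) \<Rightarrow> 's \<Rightarrow> real" where
  "mix_avg I C f \<sigma> = (\<Sum>i\<in>I. avg (C i) f \<sigma>) / real (card I)"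

lemma ip_mix_avg_right: "ip f (mix_avg I C g) = (\<Sum>i\<in>I. ip f (avg (C i) g)) / real (card I)"
  unfolding ip_def mix_avg_def
  by (simp add: sum_divide_distrib sum_distrib_left) (rule sum.swap)

lemma ip_mix_avg_left: "ip (mix_avg I C f) g = (\<Sum>i\<in>I. ip (avg (C i) f) g) / real (card I)"
  unfolding ip_def mix_avg_def
  by (simp add: sum_divide_distrib sum_distrib_left sum_distrib_right) (rule sum.swap)

lemma ip_mix_avg_sym:
  "(\<And>i. i \<in> I \<Longrightarrow> partitions (C i)) \<Longrightarrow> ip (mix_avg I C f) g = ip f (mix_avg I C g)"
  unfolding ip_mix_avg_left ip_mix_avg_right by (simp add: ip_avg_sym)

lemma sum_dirichlet:
  "finite I \<Longrightarrow> I \<noteq> {} \<Longrightarrow> (\<Sum>i\<in>I. dirichlet (C i) f) = real (card I) * (ip f f - ip f (mix_avg I C f))"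
  unfolding dirichlet_def ip_mix_avg_right by (simp add: sum_subtractf right_diff_distrib)

lemma mix_avg_const:
  "(\<And>i. i \<in> I \<Longrightarrow> partitions (C i)) \<Longrightarrow> finite I \<Longrightarrow> I \<noteq> {} \<Longrightarrow> \<sigma> \<in> \<Omega> \<Longrightarrow> mix_avg I C (\<lambda>_. a) \<sigma> = a"
  unfolding mix_avg_def by (simp add: avg_const)

lemma mix_avg_cong:
  "(\<And>i. i \<in> I \<Longrightarrow> partitions (C i)) \<Longrightarrow> \<sigma> \<in> \<Omega> \<Longrightarrow> (\<And>\<tau>. \<tau> \<in> \<Omega> \<Longrightarrow> f \<tau> = g \<tau>)
    \<Longrightarrow> mix_avg I C f \<sigma> = mix_avg I C g \<sigma>"
  unfolding mix_avg_def
  by (rule arg_cong[where f = "\<lambda>x. x / _"], rule sum.cong[OF refl], rule avg_fun_cong) auto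

lemma sum_weight_mix_avg:
  assumes "\<And>i. i \<in> I \<Longrightarrow> partitions (C i)" "finite I" "I \<noteq> {}"
  shows "(\<Sum>\<sigma>\<in>\<Omega>. w \<sigma> * mix_avg I C f \<sigma>) = (\<Sum>\<sigma>\<in>\<Omega>. w \<sigma> * f \<sigma>)"
proof -
  have "(\<Sum>\<sigma>\<in>\<Omega>. w \<sigma> * mix_avg I C f \<sigma>) = ip (mix_avg I C f) (\<lambda>_. 1)"
    by (simp add: ip_def)
  also have "\<dots> = ip f (mix_avg I C (\<lambda>_. 1))" by (rule ip_mix_avg_sym) (rule assms(1))
  also have "\<dots> = ip f (\<lambda>_. 1)" by (rule ip_cong) (simp_all add: mix_avg_const assms)
  finally show ?thesis by (simp add: ip_def)
qed

text \<open>Each average is an orthogonal projection, so by Jensen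
  the norm of \<open>mix_avg f\<close> is controlled by the Dirichlet form itself.\<close>

lemma ip_mix_avg_contract:
  assumes part: "\<And>i. i \<in> I \<Longrightarrow> partitions (C i)" and I: "finite I" "I \<noteq> {}"
    and gap: "(\<Sum>i\<in>I. dirichlet (C i) f) \<ge> real (card I) * (\<gamma> * ip f f)"
  shows "ip (mix_avg I C f) (mix_avg I C f) \<le> (1 - \<gamma>) * ip f f"
proof -
  let ?n = "real (card I)"
  have n: "?n > 0" using I by (simp add: card_gt_0_iff)
  have "(mix_avg I C f \<sigma>)\<^sup>2 \<le> (\<Sum>i\<in>I. (avg (C i) f \<sigma>)\<^sup>2) / ?n" for \<sigma>
  proof -
    have "(\<Sum>i\<in>I. avg (C i) f \<sigma>)\<^sup>2 \<le> ?n * (\<Sum>i\<in>I. (avg (C i) f \<sigma>)\<^sup>2)"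
      using Cauchy_Schwarz_ineq_sum[of "\<lambda>_. 1" "\<lambda>i. avg (C i) f \<sigma>" I] by simp
    then show ?thesis using n
      unfolding mix_avg_def power_divide by (simp add: field_simps power2_eq_square)
  qed
  then have "ip (mix_avg I C f) (mix_avg I C f)
      \<le> (\<Sum>\<sigma>\<in>\<Omega>. w \<sigma> * ((\<Sum>i\<in>I. (avg (C i) f \<sigma>)\<^sup>2) / ?n))"
    unfolding ip_def mult.assoc power2_eq_square[symmetric]
    by (intro sum_mono mult_left_mono) (auto simp: weight_pos less_imp_le)
  also have "\<dots> = (\<Sum>i\<in>I. ip (avg (C i) f) (avg (C i) f)) / ?n"
    unfolding ip_def
    by (simp add: sum_divide_distrib sum_distrib_left power2_eq_square mult.assoc) (rule sum.swap)
  also have "\<dots> = ip f (mix_avg I C f)"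
    unfolding ip_mix_avg_right using part by (simp add: ip_avg_avg)
  also have "\<dots> \<le> (1 - \<gamma>) * ip f f"
  proof -
    have "?n * (\<gamma> * ip f f) \<le> ?n * (ip f f - ip f (mix_avg I C f))"
      using gap sum_dirichlet[OF I] by simp
    then show ?thesis using n by (simp add: left_diff_distrib)
  qed
  finally show ?thesis .
qed

text \<open>Mean zero is carried through the induction because the gap is assumed only for such
  functions; averaging preserves the mean.\<close>

lemma ip_mix_avg_pow_contract:
  assumes part: "\<And>i. i \<in> I \<Longrightarrow> partitions (C i)" and I: "finite I" "I \<noteq> {}"
    and gap: "\<And>f. (\<Sum>\<sigma>\<in>\<Omega>. w \<sigma> * f \<sigma>) = 0 \<Longrightarrow>
        (\<Sum>i\<in>I. dirichlet (C i) f) \<ge> real (card I) * (\<gamma> * ip f f)"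
    and \<gamma>: "\<gamma> \<le> 1" and f: "(\<Sum>\<sigma>\<in>\<Omega>. w \<sigma> * f \<sigma>) = 0"
  shows "(\<Sum>\<sigma>\<in>\<Omega>. w \<sigma> * (mix_avg I C ^^ t) f \<sigma>) = 0 \<and>
    ip ((mix_avg I C ^^ t) f) ((mix_avg I C ^^ t) f) \<le> (1 - \<gamma>) ^ t * ip f f"
proof (induction t)
  case 0
  then show ?case using f by simp
next
  case (Suc t)
  let ?g = "(mix_avg I C ^^ t) f"
  have "ip (mix_avg I C ?g) (mix_avg I C ?g) \<le> (1 - \<gamma>) * ip ?g ?g"
    by (rule ip_mix_avg_contract) (use assms Suc in auto)
  also have "\<dots> \<le> (1 - \<gamma>) * ((1 - \<gamma>) ^ t * ip f f)"
    using Suc \<gamma> by (intro mult_left_mono) auto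
  finally show ?case using Suc sum_weight_mix_avg[of I C ?g] part I by (simp add: mult.assoc)
qed

end

section \<open>From contraction of a seminorm to a spectral gap\<close>

lemma log_convex_ratio_le:
  fixes a :: "nat \<Rightarrow> real"
  assumes nonneg: "\<And>t. 0 \<le> a t" and lc: "\<And>t. (a (Suc t))\<^sup>2 \<le> a t * a (Suc (Suc t))"
    and bound: "\<And>t. a t \<le> K * r ^ t" and r: "0 < r"
  shows "a 1 \<le> r * a 0"
proof (rule ccontr)
  assume "\<not> a 1 \<le> r * a 0"
  then have gt: "r * a 0 < a 1" by simp
  have "a 1 > 0" using gt nonneg[of 0] r by (smt (verit) mult_nonneg_nonneg)
  have "a 0 \<noteq> 0" using lc[of 0] \<open>a 1 > 0\<close> by auto
  then have a0: "a 0 > 0" using nonneg[of 0] by simp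
  define s where "s = a 1 / a 0"
  have s: "s > r" using gt a0 unfolding s_def by (simp add: field_simps)
  \<comment> \<open>Log-convexity makes successive ratios nondecreasing, so a first ratio
    \<open>s > r\<close> persists and forces growth like \<open>s ^ t\<close>, which outruns
    \<open>K * r ^ t\<close>.\<close>
  have step: "a t > 0 \<and> a (Suc t) \<ge> s * a t" for t
  proof (induction t)
    case 0
    then show ?case using a0 unfolding s_def by simp
  next
    case (Suc t)
    have pos: "a (Suc t) > 0" using Suc s r by (smt (verit) mult_pos_pos)
    have "s * a t * a (Suc t) \<le> a (Suc t) * a (Suc t)"
      using Suc pos by (intro mult_right_mono) auto
    also have "\<dots> \<le> a t * a (Suc (Suc t))" using lc[of t] by (simp add: power2_eq_square)
    finally have "a t * (s * a (Suc t)) \<le> a t * a (Suc (Suc t))" by (simp add: algebra_simps)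
    then show ?case using Suc pos by simp
  qed
  have low: "a 0 * s ^ t \<le> a t" for t
  proof (induction t)
    case (Suc t)
    have "a 0 * s ^ Suc t = s * (a 0 * s ^ t)" by simp
    also have "\<dots> \<le> s * a t" using Suc s r by (intro mult_left_mono) auto
    finally show ?case using step[of t] by linarith
  qed simp
  have "1 < s / r" using s r by simp
  then obtain t where t: "K / a 0 < (s / r) ^ t" using real_arch_pow by blast
  have "a 0 * s ^ t \<le> K * r ^ t" using low[of t] bound[of t] by linarith
  then have "(s / r) ^ t \<le> K / a 0" using a0 r by (simp add: power_divide field_simps)
  with t show False by simp
qed

context weighted_space
begin

text \<open>A contraction of any seminorm \<open>N\<close> dominating the sup norm forces the same contraction
  rate in \<open>L\<^sup>2\<close>: the squared norms of the iterates form a log-convex sequence.\<close>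

lemma sum_dirichlet_ge_of_contraction:
  assumes part: "\<And>i. i \<in> I \<Longrightarrow> partitions (C i)" and I: "finite I" "I \<noteq> {}"
    and contract: "\<And>f x. N f x \<Longrightarrow> N (mix_avg I C f) ((1 - \<kappa>) * x)"
    and sup: "\<And>f x \<sigma>. N f x \<Longrightarrow> (\<Sum>\<sigma>\<in>\<Omega>. w \<sigma> * f \<sigma>) = 0 \<Longrightarrow> \<sigma> \<in> \<Omega> \<Longrightarrow> \<bar>f \<sigma>\<bar> \<le> S * x"
    and N: "N f x" and f: "(\<Sum>\<sigma>\<in>\<Omega>. w \<sigma> * f \<sigma>) = 0" and \<kappa>: "0 \<le> \<kappa>" "\<kappa> < 1"
  shows "(\<Sum>i\<in>I. dirichlet (C i) f) \<ge> real (card I) * (\<kappa> * ip f f)"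
proof -
  let ?P = "mix_avg I C"
  define a where "a t = ip ((?P ^^ t) f) ((?P ^^ t) f)" for t
  have Nt: "N ((?P ^^ t) f) ((1 - \<kappa>) ^ t * x) \<and> (\<Sum>\<sigma>\<in>\<Omega>. w \<sigma> * (?P ^^ t) f \<sigma>) = 0" for t
  proof (induction t)
    case 0
    then show ?case using N f by simp
  next
    case (Suc t)
    then show ?case using contract[of "(?P ^^ t) f" "(1 - \<kappa>) ^ t * x"]
        sum_weight_mix_avg[of I C "(?P ^^ t) f"] part I by (simp add: mult.assoc)
  qed
  \<comment> \<open>The size of the sup bound, \<open>S * x\<close>, enters only the constant in
    front of the geometric bound. A poor \<open>S\<close> therefore does not spoil the rate.\<close>
  have "a 1 \<le> (1 - \<kappa>)\<^sup>2 * a 0"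
  proof (rule log_convex_ratio_le)
    show "0 \<le> a t" for t unfolding a_def by (rule ip_nonneg)
    show "0 < (1 - \<kappa>)\<^sup>2" using \<kappa> by simp
    show "(a (Suc t))\<^sup>2 \<le> a t * a (Suc (Suc t))" for t
    proof -
      \<comment> \<open>Self-adjointness moves one application of \<open>?P\<close> across the
        product; Cauchy-Schwarz then gives log-convexity.\<close>
      have "a (Suc t) = ip ((?P ^^ t) f) ((?P ^^ Suc (Suc t)) f)"
        unfolding a_def by (simp add: ip_mix_avg_sym part)
      then show ?thesis using ip_cauchy_schwarz unfolding a_def by simp
    qed
    show "a t \<le> ((\<Sum>\<sigma>\<in>\<Omega>. w \<sigma>) * (S * x)\<^sup>2) * ((1 - \<kappa>)\<^sup>2) ^ t" for t
    proof -
      have b: "((?P ^^ t) f \<sigma>)\<^sup>2 \<le> (S * ((1 - \<kappa>) ^ t * x))\<^sup>2" if "\<sigma> \<in> \<Omega>" for \<sigma>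
        using sup[OF _ _ that, of "(?P ^^ t) f" "(1 - \<kappa>) ^ t * x"] Nt[of t]
        by (metis abs_le_square_iff abs_ge_self order_trans)
      have "a t \<le> (\<Sum>\<sigma>\<in>\<Omega>. w \<sigma> * (S * ((1 - \<kappa>) ^ t * x))\<^sup>2)"
        unfolding a_def ip_def mult.assoc power2_eq_square[symmetric]
        by (intro sum_mono mult_left_mono b) (auto simp: weight_pos less_imp_le)
      also have "\<dots> = ((\<Sum>\<sigma>\<in>\<Omega>. w \<sigma>) * (S * x)\<^sup>2) * ((1 - \<kappa>)\<^sup>2) ^ t"
        by (simp add: power_mult_distrib mult_ac flip: sum_distrib_right power_mult)
      finally show ?thesis .
    qed
  qed
  then have "ip (?P f) (?P f) \<le> (1 - \<kappa>)\<^sup>2 * ip f f" unfolding a_def by simp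
  \<comment> \<open>The extra factor \<open>ip f f\<close> makes the right side a perfect square, so
    Cauchy-Schwarz turns the bound on the norm of \<open>?P f\<close> into one on
    \<open>ip f (?P f)\<close>.\<close>
  then have "ip f f * ip (?P f) (?P f) \<le> ip f f * ((1 - \<kappa>)\<^sup>2 * ip f f)"
    by (intro mult_left_mono ip_nonneg)
  then have "(ip f (?P f))\<^sup>2 \<le> ((1 - \<kappa>) * ip f f)\<^sup>2"
    using ip_cauchy_schwarz[of f "?P f"] by (simp add: power2_eq_square mult_ac)
  then have "ip f (?P f) \<le> (1 - \<kappa>) * ip f f"
    by (rule power2_le_imp_le) (use ip_nonneg \<kappa> in auto)
  then show ?thesis
    unfolding sum_dirichlet[OF I] by (intro mult_left_mono) (auto simp: algebra_simps)
qed

end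

section \<open>Monochromatic edges\<close>

definition mono_edge :: "(nat \<Rightarrow> nat) \<Rightarrow> nat set \<Rightarrow> bool" where
  "mono_edge \<sigma> e \<longleftrightarrow> (\<exists>u v. e = {u, v} \<and> \<sigma> u = \<sigma> v)"

lemma mono_edge_iff [simp]: "mono_edge \<sigma> {x, y} \<longleftrightarrow> \<sigma> x = \<sigma> y"
  unfolding mono_edge_def by (auto simp: doubleton_eq_iff)

lemma mono_edges_eq: "mono_edges E \<sigma> = card {e\<in>E. mono_edge \<sigma> e}"
  unfolding mono_edges_def mono_edge_def ..

lemma mem_nbrs_iff: "u \<in> nbrs E v \<longleftrightarrow> {u, v} \<in> E"
  unfolding nbrs_def by simp

lemma mem_nbrs_commute: "u \<in> nbrs E v \<longleftrightarrow> v \<in> nbrs E u"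
  by (simp add: mem_nbrs_iff insert_commute)

locale fin_graph =
  fixes V :: "nat set" and E :: "nat set set"
  assumes simple: "simple_graph V E"
begin

lemma finite_V: "finite V"
  using simple unfolding simple_graph_def by simp

lemma edgeE:
  assumes "e \<in> E"
  obtains u v where "e = {u, v}" "u \<noteq> v" "u \<in> V" "v \<in> V"
  using assms simple unfolding simple_graph_def by blast

lemma edges_subset: "E \<subseteq> Pow V"
  by (auto elim!: edgeE)

lemma finite_E: "finite E"
  using edges_subset finite_V finite_subset by blast

lemma nbrs_subset: "nbrs E v \<subseteq> V"
  by (auto simp: mem_nbrs_iff elim!: edgeE simp: doubleton_eq_iff)

lemma finite_nbrs: "finite (nbrs E v)"
  using nbrs_subset finite_V finite_subset by blast

lemma not_self_nbr: "v \<notin> nbrs E v"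
  by (auto simp: mem_nbrs_iff elim!: edgeE simp: doubleton_eq_iff)

lemma card_edges_at: "card {e\<in>E. x \<in> e \<and> P e} = card {y\<in>nbrs E x. P {x, y}}"
proof -
  have "\<exists>y. e = {x, y}" if "e \<in> E" "x \<in> e" for e
    by (rule edgeE[OF that(1)]) (use that in auto)
  then have "{e\<in>E. x \<in> e \<and> P e} = (\<lambda>y. {x, y}) ` {y\<in>nbrs E x. P {x, y}}"
    by (fastforce simp: mem_nbrs_iff insert_commute)
  moreover have "inj_on (\<lambda>y. {x, y}) {y\<in>nbrs E x. P {x, y}}"
    by (auto simp: inj_on_def doubleton_eq_iff)
  ultimately show ?thesis by (simp add: card_image)
qed

text \<open>When \<open>A\<close> is resampled under a fixed boundary, only edges meeting
  \<open>A\<close> can change status; this is the part of the exponent that varies within a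
  class.\<close>

definition touch_mono :: "nat set \<Rightarrow> (nat \<Rightarrow> nat) \<Rightarrow> nat" where
  "touch_mono A \<sigma> = card {e\<in>E. e \<inter> A \<noteq> {} \<and> mono_edge \<sigma> e}"

definition off_mono :: "nat set \<Rightarrow> (nat \<Rightarrow> nat) \<Rightarrow> nat" where
  "off_mono A \<sigma> = card {e\<in>E. e \<inter> A = {} \<and> mono_edge \<sigma> e}"

lemma mono_edges_split: "mono_edges E \<sigma> = touch_mono A \<sigma> + off_mono A \<sigma>"
proof -
  have "{e\<in>E. mono_edge \<sigma> e} = {e\<in>E. e \<inter> A \<noteq> {} \<and> mono_edge \<sigma> e} \<union> {e\<in>E. e \<inter> A = {} \<and> mono_edge \<sigma> e}"
    by blast
  then show ?thesis unfolding mono_edges_eq touch_mono_def off_mono_def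
    by (simp, subst card_Un_disjoint) (auto simp: finite_E)
qed

lemma off_mono_cong:
  assumes "\<And>v. v \<notin> A \<Longrightarrow> \<sigma> v = \<tau> v"
  shows "off_mono A \<sigma> = off_mono A \<tau>"
proof -
  have "mono_edge \<sigma> e \<longleftrightarrow> mono_edge \<tau> e" if "e \<in> E" "e \<inter> A = {}" for e
    by (rule edgeE[OF that(1)]) (use that assms in auto)
  then show ?thesis unfolding off_mono_def by (metis (mono_tags, lifting))
qed

text \<open>Edges from \<open>x\<close> into \<open>A\<close> are already counted, so only those to
  neighbours outside \<open>A\<close> are new. This is what charges at most \<Delta> - 1 edges to a
  vertex attached to \<open>A\<close>.\<close>

lemma card_touch_insert:
  assumes "x \<notin> A"
  shows "card {e\<in>E. e \<inter> insert x A \<noteq> {} \<and> P e}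
    = card {e\<in>E. e \<inter> A \<noteq> {} \<and> P e} + card {y\<in>nbrs E x - A. P {x, y}}"
proof -
  have "{e\<in>E. e \<inter> insert x A \<noteq> {} \<and> P e}
    = {e\<in>E. e \<inter> A \<noteq> {} \<and> P e} \<union> {e\<in>E. x \<in> e \<and> (e \<inter> A = {} \<and> P e)}" by blast
  then have "card {e\<in>E. e \<inter> insert x A \<noteq> {} \<and> P e}
    = card {e\<in>E. e \<inter> A \<noteq> {} \<and> P e} + card {e\<in>E. x \<in> e \<and> (e \<inter> A = {} \<and> P e)}"
    by (simp, subst card_Un_disjoint) (auto simp: finite_E)
  also have "card {e\<in>E. x \<in> e \<and> (e \<inter> A = {} \<and> P e)} = card {y\<in>nbrs E x. {x, y} \<inter> A = {} \<and> P {x, y}}"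
    by (rule card_edges_at)
  also have "{y\<in>nbrs E x. {x, y} \<inter> A = {} \<and> P {x, y}} = {y\<in>nbrs E x - A. P {x, y}}"
    using assms by auto
  finally show ?thesis .
qed

lemma touch_mono_insert:
  "x \<notin> A \<Longrightarrow> touch_mono (insert x A) \<sigma> = touch_mono A \<sigma> + card {y\<in>nbrs E x - A. \<sigma> y = \<sigma> x}"
  unfolding touch_mono_def card_touch_insert by (auto simp: eq_commute)

lemma touch_mono_singleton: "touch_mono {x} \<sigma> = ncol E \<sigma> x (\<sigma> x)"
  using touch_mono_insert[of x "{}" \<sigma>] unfolding ncol_def by (simp add: touch_mono_def)

end

section \<open>Heat-bath blocks and the Glauber dynamics\<close>

locale potts = fin_graph +
  fixes lam :: real and q \<Delta> :: nat
  assumes V_nonempty: "V \<noteq> {}" and lam_ge: "1 \<le> lam" and q_pos: "1 \<le> q"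
    and degree_le: "v \<in> V \<Longrightarrow> degree E v \<le> \<Delta>"
begin

abbreviation confs :: "(nat \<Rightarrow> nat) set" where "confs \<equiv> configs V q"

definition wt :: "(nat \<Rightarrow> nat) \<Rightarrow> real" where "wt \<sigma> = lam ^ mono_edges E \<sigma>"

lemma finite_confs: "finite confs"
  unfolding configs_def by (intro finite_PiE) (auto simp: finite_V)

lemma wt_ge_1: "1 \<le> wt \<sigma>"
  unfolding wt_def using lam_ge by (simp add: one_le_power)

sublocale weighted_space confs wt
  by unfold_locales (use finite_confs wt_ge_1 in \<open>auto intro: less_le_trans[OF zero_less_one]\<close>)

text \<open>The state space of a block \<open>B\<close>: \<sigma> acts as boundary condition, and
  its values on \<open>B\<close> are forgotten.\<close>

definition cls :: "nat set \<Rightarrow> (nat \<Rightarrow> nat) \<Rightarrow> (nat \<Rightarrow> nat) set" where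
  "cls B \<sigma> = {\<tau>\<in>confs. \<forall>v. v \<notin> B \<longrightarrow> \<tau> v = \<sigma> v}"

lemma partitions_cls: "partitions (cls B)"
  unfolding partitions_def cls_def by auto

lemma confs_upd: "\<sigma> \<in> confs \<Longrightarrow> v \<in> V \<Longrightarrow> c \<in> {1..q} \<Longrightarrow> \<sigma>(v := c) \<in> confs"
  unfolding configs_def by (auto simp: PiE_iff extensional_def)

lemma confs_mem: "\<sigma> \<in> confs \<Longrightarrow> v \<in> V \<Longrightarrow> \<sigma> v \<in> {1..q}"
  unfolding configs_def by auto

lemma confs_ext: "\<sigma> \<in> confs \<Longrightarrow> v \<notin> V \<Longrightarrow> \<sigma> v = undefined"
  unfolding configs_def by (auto simp: PiE_iff extensional_def)

text \<open>The colour of \<open>x\<close> is chosen first and then belongs to the boundary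
  condition for \<open>A\<close>. Block sums are evaluated vertex by vertex through this
  recursion.\<close>

lemma sum_cls_insert:
  fixes h :: "(nat \<Rightarrow> nat) \<Rightarrow> 'b :: comm_monoid_add"
  assumes "\<sigma> \<in> confs" "x \<in> V" "x \<notin> A"
  shows "(\<Sum>\<tau>\<in>cls (insert x A) \<sigma>. h \<tau>) = (\<Sum>c\<in>{1..q}. \<Sum>\<tau>\<in>cls A (\<sigma>(x := c)). h \<tau>)"
proof -
  have "cls (insert x A) \<sigma> = (\<Union>c\<in>{1..q}. cls A (\<sigma>(x := c)))"
    using assms confs_mem[of _ x] unfolding cls_def by (auto split: if_splits)
  moreover have "\<tau> x = c" if "\<tau> \<in> cls A (\<sigma>(x := c))" for \<tau> c
    using that assms unfolding cls_def by auto
  then have "cls A (\<sigma>(x := c)) \<inter> cls A (\<sigma>(x := c')) = {}" if "c \<noteq> c'" for c c'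
    using that by blast
  ultimately show ?thesis
    by (simp, subst sum.UNION_disjoint) (auto simp: cls_def finite_confs)
qed

lemma cls_empty: "\<sigma> \<in> confs \<Longrightarrow> cls {} \<sigma> = {\<sigma>}"
  unfolding cls_def by auto

lemma sum_cls_single:
  fixes h :: "(nat \<Rightarrow> nat) \<Rightarrow> 'b :: comm_monoid_add"
  assumes "\<sigma> \<in> confs" "x \<in> V"
  shows "(\<Sum>\<tau>\<in>cls {x} \<sigma>. h \<tau>) = (\<Sum>c\<in>{1..q}. h (\<sigma>(x := c)))"
  using sum_cls_insert[OF assms, of "{}" h] by (simp add: cls_empty confs_upd assms)

lemma card_cls:
  assumes "finite A" "A \<subseteq> V" "\<sigma> \<in> confs"
  shows "card (cls A \<sigma>) = q ^ card A"
  using assms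
proof (induction A arbitrary: \<sigma> rule: finite_induct)
  case empty
  then show ?case by (simp add: cls_empty)
next
  case (insert x A)
  then show ?case using sum_cls_insert[of \<sigma> x A "\<lambda>_. 1::nat"] by (simp add: confs_upd)
qed

lemma ncol_le: "v \<in> V \<Longrightarrow> ncol E \<sigma> v c \<le> \<Delta>"
  unfolding ncol_def using degree_le[of v] card_mono[OF finite_nbrs, of "{u \<in> nbrs E v. \<sigma> u = c}" v]
  by (simp add: degree_def)

lemma ncol_upd [simp]: "ncol E (\<sigma>(v := c)) v c' = ncol E \<sigma> v c'"
  unfolding ncol_def by (rule arg_cong[where f = card]) (use not_self_nbr in auto)

lemma wt_upd: "wt (\<sigma>(v := c)) = lam ^ ncol E \<sigma> v c * lam ^ off_mono {v} \<sigma>"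
  unfolding wt_def mono_edges_split[of _ "{v}"] touch_mono_singleton
  using off_mono_cong[of "{v}" "\<sigma>(v := c)" \<sigma>] by (simp add: power_add)

lemma wt_upd_le: "v \<in> V \<Longrightarrow> wt (\<sigma>(v := c)) \<le> lam ^ \<Delta> * wt \<sigma>"
proof -
  assume v: "v \<in> V"
  have "wt (\<sigma>(v := c)) \<le> lam ^ \<Delta> * lam ^ off_mono {v} \<sigma>"
    unfolding wt_upd using lam_ge ncol_le[OF v]
    by (intro mult_right_mono power_increasing) auto
  also have "\<dots> \<le> lam ^ \<Delta> * wt \<sigma>"
    unfolding wt_def mono_edges_split[of _ "{v}"] using lam_ge
    by (intro mult_left_mono power_increasing) auto
  finally show ?thesis .
qed

text \<open>The factor from edges away from \<open>v\<close> is common to numerator and denominator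
  of the conditional expectation, leaving exactly the Glauber probabilities.\<close>

lemma sum_glauber:
  assumes "\<sigma> \<in> confs"
  shows "(\<Sum>\<tau>\<in>confs. glauber V E lam q \<sigma> \<tau> * g \<tau>) = mix_avg V (\<lambda>v. cls {v}) g \<sigma>"
proof -
  have "(\<Sum>\<tau>\<in>confs. glauber V E lam q \<sigma> \<tau> * g \<tau>)
    = (\<Sum>\<tau>\<in>confs. \<Sum>v\<in>V. \<Sum>c\<in>{1..q}. (if \<tau> = \<sigma>(v := c)
         then lam ^ ncol E \<sigma> v c / (\<Sum>c'\<in>{1..q}. lam ^ ncol E \<sigma> v c') * g \<tau> / real (card V) else 0))"
    unfolding glauber_def
    by (auto intro!: sum.cong simp: sum_distrib_left sum_distrib_right)
  also have "\<dots> = (\<Sum>v\<in>V. \<Sum>c\<in>{1..q}. \<Sum>\<tau>\<in>confs. (if \<tau> = \<sigma>(v := c)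
         then lam ^ ncol E \<sigma> v c / (\<Sum>c'\<in>{1..q}. lam ^ ncol E \<sigma> v c') * g \<tau> / real (card V) else 0))"
    by (subst sum.swap, rule sum.cong[OF refl], rule sum.swap)
  also have "\<dots> = (\<Sum>v\<in>V. avg (cls {v}) g \<sigma> / real (card V))"
  proof (rule sum.cong[OF refl])
    fix v assume v: "v \<in> V"
    let ?o = "lam ^ off_mono {v} \<sigma>"
    have "avg (cls {v}) g \<sigma> = (\<Sum>c\<in>{1..q}. wt (\<sigma>(v := c)) * g (\<sigma>(v := c))) / (\<Sum>c\<in>{1..q}. wt (\<sigma>(v := c)))"
      unfolding avg_def mass_def by (simp add: sum_cls_single assms v)
    also have "\<dots> = (\<Sum>c\<in>{1..q}. lam ^ ncol E \<sigma> v c * g (\<sigma>(v := c))) * ?o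
        / ((\<Sum>c\<in>{1..q}. lam ^ ncol E \<sigma> v c) * ?o)"
      unfolding wt_upd sum_distrib_right by (simp only: mult_ac)
    also have "\<dots> = (\<Sum>c\<in>{1..q}. lam ^ ncol E \<sigma> v c / (\<Sum>c'\<in>{1..q}. lam ^ ncol E \<sigma> v c') * g (\<sigma>(v := c)))"
      using lam_ge by (simp add: sum_divide_distrib)
    finally have a: "avg (cls {v}) g \<sigma> = \<dots>" .
    show "(\<Sum>c\<in>{1..q}. \<Sum>\<tau>\<in>confs. (if \<tau> = \<sigma>(v := c)
         then lam ^ ncol E \<sigma> v c / (\<Sum>c'\<in>{1..q}. lam ^ ncol E \<sigma> v c') * g \<tau> / real (card V) else 0))
       = avg (cls {v}) g \<sigma> / real (card V)"
      unfolding a sum_divide_distrib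
      by (rule sum.cong[OF refl]) (use confs_upd[OF assms v] in \<open>simp add: finite_confs\<close>)
  qed
  also have "\<dots> = mix_avg V (\<lambda>v. cls {v}) g \<sigma>"
    unfolding mix_avg_def by (simp add: sum_divide_distrib)
  finally show ?thesis .
qed

text \<open>The induction needs arbitrary \<open>g\<close>: the last step of the chain is the first
  operator applied to the test function.\<close>

lemma sum_glauber_pow:
  assumes "\<sigma> \<in> confs"
  shows "(\<Sum>\<tau>\<in>confs. glauber_pow V E lam q t \<sigma> \<tau> * g \<tau>) = (mix_avg V (\<lambda>v. cls {v}) ^^ t) g \<sigma>"
proof (induction t arbitrary: g)
  case 0
  have "(\<Sum>\<tau>\<in>confs. (if \<sigma> = \<tau> then 1 else 0) * g \<tau>) = (\<Sum>\<tau>\<in>confs. if \<tau> = \<sigma> then g \<tau> else 0)"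
    by (rule sum.cong) auto
  then show ?case using assms by (simp add: finite_confs)
next
  case (Suc t)
  have "(\<Sum>\<tau>\<in>confs. glauber_pow V E lam q (Suc t) \<sigma> \<tau> * g \<tau>)
    = (\<Sum>\<rho>\<in>confs. glauber_pow V E lam q t \<sigma> \<rho> * (\<Sum>\<tau>\<in>confs. glauber V E lam q \<rho> \<tau> * g \<tau>))"
    by (simp add: sum_distrib_left sum_distrib_right mult.assoc) (rule sum.swap)
  also have "\<dots> = (\<Sum>\<rho>\<in>confs. glauber_pow V E lam q t \<sigma> \<rho> * mix_avg V (\<lambda>v. cls {v}) g \<rho>)"
    by (simp add: sum_glauber cong: sum.cong)
  also have "\<dots> = (mix_avg V (\<lambda>v. cls {v}) ^^ Suc t) g \<sigma>"
    using Suc by (simp add: funpow_swap1)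
  finally show ?case .
qed

section \<open>Total variation distance from the spectral gap\<close>

lemma partition_fn_eq: "partition_fn V E lam q = (\<Sum>\<sigma>\<in>confs. wt \<sigma>)"
  unfolding partition_fn_def wt_def ..

lemma confs_nonempty: "confs \<noteq> {}"
  unfolding configs_def using q_pos by (auto simp: PiE_eq_empty_iff)

lemma partition_fn_pos: "0 < partition_fn V E lam q"
  unfolding partition_fn_eq by (intro sum_pos finite_confs confs_nonempty weight_pos)

lemma tv_dist_sq_le:
  assumes gap: "\<And>f. (\<Sum>\<sigma>\<in>confs. wt \<sigma> * f \<sigma>) = 0 \<Longrightarrow>
        (\<Sum>v\<in>V. dirichlet (cls {v}) f) \<ge> real (card V) * (\<gamma> * ip f f)"
    and \<gamma>: "\<gamma> \<le> 1" and \<sigma>: "\<sigma> \<in> confs"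
  shows "(2 * tv_dist V E lam q t \<sigma>)\<^sup>2 \<le> (1 - \<gamma>) ^ t * partition_fn V E lam q"
proof -
  let ?Z = "partition_fn V E lam q" and ?p = "glauber_pow V E lam q t \<sigma>" and ?\<pi> = "gibbs V E lam q"
  let ?P = "mix_avg V (\<lambda>v. cls {v})"
  define g where "g \<tau> = sgn (?p \<tau> - ?\<pi> \<tau>)" for \<tau>
  define m where "m = (\<Sum>\<tau>\<in>confs. ?\<pi> \<tau> * g \<tau>)"
  define h where "h \<tau> = g \<tau> - m" for \<tau>
  have \<pi>: "?\<pi> \<tau> = wt \<tau> / ?Z" for \<tau> unfolding gibbs_def wt_def ..
  have wsum: "(\<Sum>\<tau>\<in>confs. wt \<tau> * g \<tau>) = m * ?Z"
    unfolding m_def \<pi> sum_distrib_right using partition_fn_pos by (intro sum.cong) auto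
  have h0: "(\<Sum>\<tau>\<in>confs. wt \<tau> * h \<tau>) = 0"
  proof -
    have "(\<Sum>\<tau>\<in>confs. wt \<tau> * h \<tau>) = (\<Sum>\<tau>\<in>confs. wt \<tau> * g \<tau>) - m * ?Z"
      unfolding h_def partition_fn_eq sum_distrib_left sum_subtractf[symmetric]
      by (intro sum.cong) (auto simp: algebra_simps)
    then show ?thesis using wsum by simp
  qed
  have p1: "(\<Sum>\<tau>\<in>confs. ?p \<tau>) = 1"
  proof -
    have c: "(?P ^^ s) (\<lambda>_. 1) \<rho> = 1" if "\<rho> \<in> confs" for s \<rho>
      using that
    proof (induction s arbitrary: \<rho>)
      case (Suc s)
      have "?P ((?P ^^ s) (\<lambda>_. 1)) \<rho> = ?P (\<lambda>_. 1) \<rho>"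
        by (rule mix_avg_cong) (use Suc partitions_cls in auto)
      also have "\<dots> = 1"
        by (rule mix_avg_const) (use Suc partitions_cls finite_V V_nonempty in auto)
      finally show ?case by simp
    qed simp
    show ?thesis using sum_glauber_pow[OF \<sigma>, of t "\<lambda>_. 1"] c[OF \<sigma>] by simp
  qed
  have "2 * tv_dist V E lam q t \<sigma> = (\<Sum>\<tau>\<in>confs. (?p \<tau> - ?\<pi> \<tau>) * g \<tau>)"
    unfolding tv_dist_def g_def by (simp add: mult_sgn_abs abs_sgn mult.commute)
  also have "\<dots> = (\<Sum>\<tau>\<in>confs. ?p \<tau> * g \<tau>) - m"
    unfolding m_def by (simp add: left_diff_distrib sum_subtractf)
  also have "\<dots> = (\<Sum>\<tau>\<in>confs. ?p \<tau> * h \<tau>)"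
    unfolding h_def using p1 by (simp add: right_diff_distrib sum_subtractf flip: sum_distrib_right)
  also have "\<dots> = (?P ^^ t) h \<sigma>" by (rule sum_glauber_pow[OF \<sigma>])
  finally have tv: "2 * tv_dist V E lam q t \<sigma> = (?P ^^ t) h \<sigma>" .
  \<comment> \<open>All weights are at least 1, so the value at a single state is dominated by the
    whole unnormalised norm.\<close>
  have "((?P ^^ t) h \<sigma>)\<^sup>2 \<le> wt \<sigma> * (?P ^^ t) h \<sigma> * (?P ^^ t) h \<sigma>"
    using mult_right_mono[OF wt_ge_1[of \<sigma>], of "((?P ^^ t) h \<sigma>)\<^sup>2"] by (simp add: power2_eq_square mult.assoc)
  also have "\<dots> \<le> ip ((?P ^^ t) h) ((?P ^^ t) h)"
    unfolding ip_def
    by (rule member_le_sum[OF \<sigma>]) (auto simp: finite_confs mult.assoc less_imp_le weight_pos)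
  also have "\<dots> \<le> (1 - \<gamma>) ^ t * ip h h"
    using ip_mix_avg_pow_contract[of V "\<lambda>v. cls {v}" \<gamma> h t] gap \<gamma> h0 partitions_cls finite_V V_nonempty by blast
  also have "\<dots> \<le> (1 - \<gamma>) ^ t * ?Z"
  proof (rule mult_left_mono)
    have "ip h h = (\<Sum>\<tau>\<in>confs. wt \<tau> * g \<tau> * g \<tau>) - 2 * m * (\<Sum>\<tau>\<in>confs. wt \<tau> * g \<tau>) + m\<^sup>2 * ?Z"
      unfolding ip_def h_def partition_fn_eq sum_distrib_left sum_subtractf[symmetric] sum.distrib[symmetric]
      by (intro sum.cong) (auto simp: algebra_simps power2_eq_square)
    also have "\<dots> = (\<Sum>\<tau>\<in>confs. wt \<tau> * g \<tau> * g \<tau>) - m\<^sup>2 * ?Z"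
      unfolding wsum by (simp add: power2_eq_square)
    also have "\<dots> \<le> (\<Sum>\<tau>\<in>confs. wt \<tau> * g \<tau> * g \<tau>)"
      using partition_fn_pos by simp
    also have "\<dots> \<le> ?Z"
      unfolding partition_fn_eq g_def
      by (intro sum_mono) (auto simp: sgn_real_def weight_pos less_imp_le)
    finally show "ip h h \<le> ?Z" .
  qed (use \<gamma> in simp)
  finally show ?thesis using tv by simp
qed

section \<open>Comparison of block and single-vertex Dirichlet forms\<close>

definition energy :: "nat set \<Rightarrow> ((nat \<Rightarrow> nat) \<Rightarrow> real) \<Rightarrow> real" where
  "energy B f = (\<Sum>\<sigma>\<in>confs. \<Sum>\<tau>\<in>cls B \<sigma>. wt \<sigma> * (f \<sigma> - f \<tau>)\<^sup>2)"

lemma energy_nonneg: "0 \<le> energy B f"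
  unfolding energy_def
  by (intro sum_nonneg) (auto intro!: mult_nonneg_nonneg order_trans[OF zero_le_one wt_ge_1])

text \<open>\<open>energy\<close> drops the conditional probability \<open>wt \<tau> / mass\<close>,
  which is at most 1. Without the normalisation, the sum over a block can be split vertex by
  vertex.\<close>

lemma dirichlet_le_energy: "dirichlet (cls B) f \<le> energy B f"
proof -
  have "(\<Sum>\<sigma>\<in>confs. \<Sum>\<tau>\<in>cls B \<sigma>. wt \<sigma> * wt \<tau> / mass (cls B) \<sigma> * (f \<sigma> - f \<tau>)\<^sup>2) \<le> energy B f"
    unfolding energy_def
  proof (intro sum_mono mult_right_mono)
    fix \<sigma> \<tau> assume a: "\<sigma> \<in> confs" "\<tau> \<in> cls B \<sigma>"
    have "wt \<tau> \<le> mass (cls B) \<sigma>"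
      unfolding mass_def
      by (rule member_le_sum) (use a partitionsD(4)[OF partitions_cls a(1)] wt_ge_1 in \<open>auto intro: order_trans[OF zero_le_one]\<close>)
    then show "wt \<sigma> * wt \<tau> / mass (cls B) \<sigma> \<le> wt \<sigma>"
      using mass_pos[OF partitions_cls a(1), of B] weight_pos[OF a(1)] by (simp add: field_simps)
  qed simp
  then show ?thesis unfolding dirichlet_eq[OF partitions_cls] using energy_nonneg[of B f] by simp
qed

text \<open>The converse for one vertex: recolouring it changes the weight by at most
  \<open>lam ^ \<Delta>\<close>, so every conditional probability is at least 1 over
  \<open>q * lam ^ \<Delta>\<close>.\<close>

lemma energy_single_le:
  assumes "v \<in> V"
  shows "energy {v} f \<le> 2 * real q * lam ^ \<Delta> * dirichlet (cls {v}) f"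
proof -
  have "energy {v} f \<le> (\<Sum>\<sigma>\<in>confs. \<Sum>\<tau>\<in>cls {v} \<sigma>.
      real q * lam ^ \<Delta> * (wt \<sigma> * wt \<tau> / mass (cls {v}) \<sigma> * (f \<sigma> - f \<tau>)\<^sup>2))"
    unfolding energy_def
  proof (intro sum_mono)
    fix \<sigma> \<tau> assume a: "\<sigma> \<in> confs" "\<tau> \<in> cls {v} \<sigma>"
    have \<tau>: "\<tau> \<in> confs" using a unfolding cls_def by auto
    have "mass (cls {v}) \<sigma> = mass (cls {v}) \<tau>" using mass_cong[of "cls {v}" \<sigma> \<tau>] partitions_cls a by simp
    also have "\<dots> = (\<Sum>c\<in>{1..q}. wt (\<tau>(v := c)))"
      unfolding mass_def by (rule sum_cls_single[OF \<tau> assms])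
    also have "\<dots> \<le> (\<Sum>c\<in>{1..q}. lam ^ \<Delta> * wt \<tau>)"
      by (intro sum_mono wt_upd_le assms)
    finally have "mass (cls {v}) \<sigma> \<le> real q * lam ^ \<Delta> * wt \<tau>" by simp
    then have "wt \<sigma> \<le> real q * lam ^ \<Delta> * (wt \<sigma> * wt \<tau> / mass (cls {v}) \<sigma>)"
      using mass_pos[OF partitions_cls a(1), of "{v}"] weight_pos[OF a(1)] by (simp add: field_simps)
    from mult_right_mono[OF this, of "(f \<sigma> - f \<tau>)\<^sup>2"]
    show "wt \<sigma> * (f \<sigma> - f \<tau>)\<^sup>2 \<le> real q * lam ^ \<Delta> * (wt \<sigma> * wt \<tau> / mass (cls {v}) \<sigma> * (f \<sigma> - f \<tau>)\<^sup>2)"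
      by (simp add: mult.assoc)
  qed
  also have "\<dots> = 2 * real q * lam ^ \<Delta> * dirichlet (cls {v}) f"
    unfolding dirichlet_eq[OF partitions_cls] sum_distrib_left[symmetric] by simp
  finally show ?thesis .
qed

text \<open>Go from \<sigma> to \<tau> in two stages, recolouring \<open>x\<close> first and
  \<open>A\<close> afterwards, with the inequality (a + b)^2 at most 2 a^2 + 2 b^2. The first stage
  is repeated for each of the \<open>q ^ card A\<close> endpoints; the second starts at
  \<open>\<sigma>(x := c)\<close>, and changing the weight to that state costs
  \<open>lam ^ \<Delta>\<close>.\<close>

lemma energy_insert_le:
  assumes x: "x \<in> V" "x \<notin> A" and A: "finite A" "A \<subseteq> V"
  shows "energy (insert x A) f \<le> 2 * real q ^ card A * energy {x} f + 2 * lam ^ \<Delta> * real q * energy A f"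
proof -
  define G where "G \<rho> = (\<Sum>\<tau>\<in>cls A \<rho>. (f \<rho> - f \<tau>)\<^sup>2)" for \<rho>
  have two: "wt \<sigma> * (f \<sigma> - f \<tau>)\<^sup>2 \<le> 2 * (wt \<sigma> * (f \<sigma> - f \<rho>)\<^sup>2) + 2 * (wt \<sigma> * (f \<rho> - f \<tau>)\<^sup>2)" for \<sigma> \<rho> \<tau>
  proof -
    have "(f \<sigma> - f \<tau>)\<^sup>2 \<le> 2 * (f \<sigma> - f \<rho>)\<^sup>2 + 2 * (f \<rho> - f \<tau>)\<^sup>2"
      using zero_le_power2[of "f \<sigma> - 2 * f \<rho> + f \<tau>"] by (simp add: power2_eq_square algebra_simps)
    from mult_left_mono[OF this, of "wt \<sigma>"] show ?thesis using wt_ge_1[of \<sigma>] by (simp add: algebra_simps)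
  qed
  have "energy (insert x A) f = (\<Sum>\<sigma>\<in>confs. \<Sum>c\<in>{1..q}. \<Sum>\<tau>\<in>cls A (\<sigma>(x := c)). wt \<sigma> * (f \<sigma> - f \<tau>)\<^sup>2)"
    unfolding energy_def by (rule sum.cong[OF refl]) (rule sum_cls_insert[OF _ x])
  also have "\<dots> \<le> (\<Sum>\<sigma>\<in>confs. \<Sum>c\<in>{1..q}. \<Sum>\<tau>\<in>cls A (\<sigma>(x := c)).
      2 * (wt \<sigma> * (f \<sigma> - f (\<sigma>(x := c)))\<^sup>2) + 2 * (wt \<sigma> * (f (\<sigma>(x := c)) - f \<tau>)\<^sup>2))"
    by (intro sum_mono two)
  also have "\<dots> = (\<Sum>\<sigma>\<in>confs. \<Sum>c\<in>{1..q}. real (q ^ card A) * (2 * (wt \<sigma> * (f \<sigma> - f (\<sigma>(x := c)))\<^sup>2)))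
     + (\<Sum>\<sigma>\<in>confs. \<Sum>c\<in>{1..q}. 2 * (wt \<sigma> * G (\<sigma>(x := c))))"
    unfolding sum.distrib[symmetric] G_def
    by (intro sum.cong refl) (simp add: sum.distrib card_cls[OF A] confs_upd x sum_distrib_left)
  also have "(\<Sum>\<sigma>\<in>confs. \<Sum>c\<in>{1..q}. real (q ^ card A) * (2 * (wt \<sigma> * (f \<sigma> - f (\<sigma>(x := c)))\<^sup>2)))
      = 2 * real q ^ card A * energy {x} f"
    unfolding energy_def by (simp add: sum_cls_single x sum_distrib_left mult_ac cong: sum.cong)
  also have "(\<Sum>\<sigma>\<in>confs. \<Sum>c\<in>{1..q}. 2 * (wt \<sigma> * G (\<sigma>(x := c)))) \<le> 2 * lam ^ \<Delta> * real q * energy A f"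
  proof -
    have wr: "wt \<sigma> \<le> lam ^ \<Delta> * wt (\<sigma>(x := c))" for \<sigma> c
      using wt_upd_le[OF x(1), of "\<sigma>(x := c)" "\<sigma> x"] by simp
    have G0: "0 \<le> G \<rho>" for \<rho> unfolding G_def by (intro sum_nonneg) auto
    have "(\<Sum>\<sigma>\<in>confs. \<Sum>c\<in>{1..q}. 2 * (wt \<sigma> * G (\<sigma>(x := c))))
      \<le> (\<Sum>\<sigma>\<in>confs. \<Sum>c\<in>{1..q}. 2 * (lam ^ \<Delta> * wt (\<sigma>(x := c)) * G (\<sigma>(x := c))))"
      by (intro sum_mono mult_left_mono mult_right_mono wr G0) auto
    also have "\<dots> = (\<Sum>\<sigma>\<in>confs. \<Sum>\<rho>\<in>cls {x} \<sigma>. 2 * (lam ^ \<Delta> * wt \<rho> * G \<rho>))"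
      by (intro sum.cong refl) (simp add: sum_cls_single x)
    \<comment> \<open>After transposing, the summand is constant in the inner variable, which takes
      \<open>q\<close> values.\<close>
    also have "\<dots> = (\<Sum>\<sigma>\<in>confs. \<Sum>\<rho>\<in>cls {x} \<sigma>. 2 * (lam ^ \<Delta> * wt \<sigma> * G \<sigma>))"
      by (rule sum_classes_swap[OF partitions_cls])
    also have "\<dots> = 2 * lam ^ \<Delta> * real q * energy A f"
    proof -
      have "(\<Sum>\<rho>\<in>cls {x} \<sigma>. 2 * (lam ^ \<Delta> * wt \<sigma> * G \<sigma>))
          = 2 * lam ^ \<Delta> * real q * (\<Sum>\<tau>\<in>cls A \<sigma>. wt \<sigma> * (f \<sigma> - f \<tau>)\<^sup>2)" if "\<sigma> \<in> confs" for \<sigma>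
        using card_cls[of "{x}" \<sigma>] x that unfolding G_def by (simp add: sum_distrib_left mult_ac)
      then show ?thesis unfolding energy_def sum_distrib_left[of _ _ confs] by (intro sum.cong refl) auto
    qed
    finally show ?thesis .
  qed
  finally show ?thesis by simp
qed

text \<open>The base \<open>4 * lam ^ \<Delta> * real q\<close> is chosen so that one factor
  dominates the coefficient of \<open>energy A f\<close> and \<open>card A + 1\<close> factors
  dominate that of \<open>energy {x} f\<close>.\<close>

lemma energy_le_sum:
  assumes "finite B" "B \<subseteq> V"
  shows "energy B f \<le> (4 * lam ^ \<Delta> * real q) ^ card B * (\<Sum>v\<in>B. energy {v} f)"
  using assms
proof (induction B rule: finite_induct)
  case empty
  then show ?case by (simp add: energy_def cls_empty)
next
  case (insert x A)
  let ?K = "4 * lam ^ \<Delta> * real q" and ?s = "\<Sum>v\<in>A. energy {v} f"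
  have L: "1 \<le> lam ^ \<Delta>" using lam_ge by (rule one_le_power)
  have q: "1 \<le> real q" using q_pos by simp
  have Kq: "real q \<le> ?K" using mult_mono[of 1 "4 * lam ^ \<Delta>" "real q" "real q"] L by simp
  have K2: "2 \<le> ?K" using mult_mono[of 2 "4 * lam ^ \<Delta>" 1 "real q"] L q by simp
  have c1: "2 * real q ^ card A \<le> ?K ^ Suc (card A)"
    unfolding power_Suc using Kq K2 q by (intro mult_mono power_mono) auto
  have c2: "2 * lam ^ \<Delta> * real q * ?K ^ card A \<le> ?K ^ Suc (card A)"
    unfolding power_Suc using L q by (intro mult_right_mono) auto
  have "energy (insert x A) f \<le> 2 * real q ^ card A * energy {x} f + 2 * lam ^ \<Delta> * real q * energy A f"
    using insert by (intro energy_insert_le) auto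
  also have "\<dots> \<le> 2 * real q ^ card A * energy {x} f + 2 * lam ^ \<Delta> * real q * (?K ^ card A * ?s)"
    using insert L q by (intro add_left_mono mult_left_mono) auto
  also have "\<dots> \<le> ?K ^ Suc (card A) * energy {x} f + ?K ^ Suc (card A) * ?s"
  proof (intro add_mono)
    show "2 * real q ^ card A * energy {x} f \<le> ?K ^ Suc (card A) * energy {x} f"
      using c1 by (intro mult_right_mono energy_nonneg)
    have "0 \<le> ?s" by (intro sum_nonneg energy_nonneg)
    from mult_right_mono[OF c2 this]
    show "2 * lam ^ \<Delta> * real q * (?K ^ card A * ?s) \<le> ?K ^ Suc (card A) * ?s" by (simp add: mult.assoc)
  qed
  also have "\<dots> = ?K ^ card (insert x A) * (\<Sum>v\<in>insert x A. energy {v} f)"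
    using insert by (simp add: distrib_left)
  finally show ?case .
qed

text \<open>The constants of \<open>energy_single_le\<close> and \<open>energy_le_sum\<close>
  multiplied. The product does not mention the graph, so it is uniform over the class.\<close>

definition comparison_const :: "nat \<Rightarrow> real" where
  "comparison_const k = 2 * real q * lam ^ \<Delta> * (4 * lam ^ \<Delta> * real q) ^ k"

lemma comparison_const_ge_1: "1 \<le> comparison_const k"
proof -
  have L: "1 \<le> lam ^ \<Delta>" using lam_ge by (rule one_le_power)
  have q: "1 \<le> real q" using q_pos by simp
  have "1 \<le> real q * lam ^ \<Delta>" using mult_mono[OF q L] by simp
  then have a: "1 \<le> 2 * real q * lam ^ \<Delta>" "1 \<le> 4 * lam ^ \<Delta> * real q" by (simp_all add: mult_ac)
  show ?thesis unfolding comparison_const_def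
    using mult_mono[OF a(1) one_le_power[OF a(2), of k]] a by simp
qed

lemma dirichlet_block_le:
  assumes "B \<subseteq> V" "card B \<le> k"
  shows "dirichlet (cls B) f \<le> comparison_const k * (\<Sum>v\<in>B. dirichlet (cls {v}) f)"
proof -
  have B: "finite B" using assms(1) finite_V finite_subset by blast
  have L: "1 \<le> lam ^ \<Delta>" using lam_ge by (rule one_le_power)
  have q: "1 \<le> real q" using q_pos by simp
  let ?K = "4 * lam ^ \<Delta> * real q"
  have K: "1 \<le> ?K" using mult_mono[of 1 "4 * lam ^ \<Delta>" 1 "real q"] L q by simp
  have D0: "0 \<le> (\<Sum>v\<in>B. dirichlet (cls {v}) f)"
    by (intro sum_nonneg dirichlet_nonneg partitions_cls)
  have "dirichlet (cls B) f \<le> ?K ^ card B * (\<Sum>v\<in>B. energy {v} f)"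
    using dirichlet_le_energy energy_le_sum[OF B assms(1)] order_trans by blast
  also have "\<dots> \<le> ?K ^ k * (\<Sum>v\<in>B. 2 * real q * lam ^ \<Delta> * dirichlet (cls {v}) f)"
    using K assms order_trans[OF zero_le_one K]
    by (intro mult_mono power_increasing sum_mono energy_single_le sum_nonneg energy_nonneg zero_le_power) auto
  also have "\<dots> = comparison_const k * (\<Sum>v\<in>B. dirichlet (cls {v}) f)"
    unfolding comparison_const_def by (simp add: sum_distrib_left mult_ac)
  finally show ?thesis .
qed

text \<open>Each block form is bounded by the single-vertex sum over all of \<open>V\<close>. This
  costs a factor \<open>card V\<close>, hence the second factor 1/n in the gap, and applies equally
  to the one block \<open>V\<close>.\<close>

lemma glauber_gap_of_blocks:
  assumes blk: "\<And>v. v \<in> V \<Longrightarrow> B v \<subseteq> V \<and> card (B v) \<le> k"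
    and gap: "(\<Sum>v\<in>V. dirichlet (cls (B v)) f) \<ge> real (card V) * (\<kappa> * ip f f)"
  shows "(\<Sum>v\<in>V. dirichlet (cls {v}) f)
    \<ge> real (card V) * (\<kappa> / (real (card V) * comparison_const k) * ip f f)"
proof -
  let ?S = "\<Sum>v\<in>V. dirichlet (cls {v}) f" and ?K = "comparison_const k" and ?n = "real (card V)"
  have n: "?n > 0" using finite_V V_nonempty by (simp add: card_gt_0_iff)
  have K: "?K > 0" using comparison_const_ge_1[of k] by simp
  have "?n * (\<kappa> * ip f f) \<le> (\<Sum>v\<in>V. dirichlet (cls (B v)) f)" by (rule gap)
  also have "\<dots> \<le> (\<Sum>v\<in>V. ?K * ?S)"
  proof (rule sum_mono)
    fix v assume v: "v \<in> V"
    have "dirichlet (cls (B v)) f \<le> ?K * (\<Sum>v\<in>B v. dirichlet (cls {v}) f)"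
      using dirichlet_block_le blk[OF v] by blast
    also have "\<dots> \<le> ?K * ?S"
      using K blk[OF v] by (intro mult_left_mono sum_mono2 finite_V) (auto simp: dirichlet_nonneg partitions_cls)
    finally show "dirichlet (cls (B v)) f \<le> ?K * ?S" .
  qed
  also have "\<dots> = ?n * ?K * ?S" by simp
  finally show ?thesis using n K by (simp add: field_simps)
qed

end

section \<open>Connected vertex sets\<close>

context fin_graph
begin

text \<open>Connectedness stated as what growing a set needs: every nonempty proper part has an edge
  to the rest. No walks have to be handled.\<close>

definition conn :: "nat set \<Rightarrow> bool" where
  "conn B \<longleftrightarrow> (\<forall>A. A \<subset> B \<longrightarrow> A \<noteq> {} \<longrightarrow> (\<exists>x\<in>B - A. \<exists>y\<in>A. {x, y} \<in> E))"

lemma connD: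
  assumes "conn B" "A \<subset> B" "A \<noteq> {}"
  obtains x y where "x \<in> B" "x \<notin> A" "y \<in> A" "{x, y} \<in> E"
  using assms unfolding conn_def by blast

lemma conn_singleton: "conn {v}"
  unfolding conn_def by auto

lemma conn_insert:
  assumes "conn A" "y \<in> A" "{x, y} \<in> E"
  shows "conn (insert x A)"
  unfolding conn_def
proof (intro allI impI)
  fix S assume S: "S \<subset> insert x A" "S \<noteq> {}"
  show "\<exists>z\<in>insert x A - S. \<exists>u\<in>S. {z, u} \<in> E"
  proof (cases "S \<inter> A = {} \<or> A \<subseteq> S")
    case True
    then show ?thesis
    proof
      assume "S \<inter> A = {}"
      then have "S = {x}" using S by blast
      moreover have "y \<notin> S" using \<open>S \<inter> A = {}\<close> assms by blast
      ultimately show ?thesis using assms by (metis Diff_iff insert_commute insertCI)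
    next
      assume "A \<subseteq> S"
      then have "x \<notin> S" "y \<in> S" using S assms by auto
      then show ?thesis using assms by blast
    qed
  next
    case False
    then have "S \<inter> A \<subset> A" "S \<inter> A \<noteq> {}" by auto
    then show ?thesis using connD[OF assms(1)] by (metis DiffI IntD1 IntI insertCI)
  qed
qed

text \<open>A connected set is grown from a chosen root one vertex at a time; the step exposes an
  edge from the new vertex to an old one, which is the edge saved in all later counts.\<close>

lemma conn_induct [consumes 3, case_names base step]:
  assumes "finite B" "conn B" "r \<in> B"
    and base: "P {r}"
    and step: "\<And>A x y. r \<in> A \<Longrightarrow> A \<subseteq> B \<Longrightarrow> x \<in> B \<Longrightarrow> x \<notin> A \<Longrightarrow> y \<in> A \<Longrightarrow> {x, y} \<in> E \<Longrightarrow> P A \<Longrightarrow> P (insert x A)"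
  shows "P B"
proof -
  \<comment> \<open>Every cardinality up to that of \<open>B\<close> is reached; at the top the
    subset must be \<open>B\<close> itself.\<close>
  have "\<exists>A\<subseteq>B. r \<in> A \<and> card A = Suc m \<and> P A" if "Suc m \<le> card B" for m
    using that
  proof (induction m)
    case 0
    then show ?case using assms by (intro exI[of _ "{r}"]) auto
  next
    case (Suc m)
    then obtain A where A: "A \<subseteq> B" "r \<in> A" "card A = Suc m" "P A" by auto
    then have "A \<subset> B" using Suc.prems by auto
    then obtain x y where xy: "x \<in> B" "x \<notin> A" "y \<in> A" "{x, y} \<in> E"
      using A connD[OF assms(2)] by (metis empty_iff)
    have "finite A" using A assms(1) finite_subset by blast
    then show ?case using A xy step[of A x y] by (intro exI[of _ "insert x A"]) auto
  qed
  from this[of "card B - 1"] obtain A where "A \<subseteq> B" "card A = card B" "P A"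
    using assms(1,3) by (metis Suc_pred' card_gt_0_iff empty_iff le_refl)
  then show ?thesis using assms(1) card_subset_eq by metis
qed

text \<open>A walk from a vertex of \<open>A\<close> to one outside has to use an edge that leaves
  \<open>A\<close>.\<close>

lemma conn_V:
  assumes "connected_graph V E"
  shows "conn V"
  unfolding conn_def
proof (intro allI impI)
  fix A assume A: "A \<subset> V" "A \<noteq> {}"
  then obtain y z where yz: "y \<in> A" "z \<in> V" "z \<notin> A" by blast
  then have "(\<lambda>x y. {x, y} \<in> E)\<^sup>*\<^sup>* y z" using assms A unfolding connected_graph_def by blast
  from this yz(1,3) have "\<exists>a b. a \<in> A \<and> b \<notin> A \<and> {a, b} \<in> E"
    by (induction rule: rtranclp_induct) auto
  then obtain a b where "a \<in> A" "b \<notin> A" "{a, b} \<in> E" by blast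
  moreover then have "b \<in> V" using edges_subset by auto
  ultimately show "\<exists>x\<in>V - A. \<exists>y\<in>A. {x, y} \<in> E" by (metis DiffI insert_commute)
qed

section \<open>Graph balls and the existence of connected blocks\<close>

definition ball_rel :: "(nat \<times> nat) set" where
  "ball_rel = {(x, y). x = y \<or> {x, y} \<in> E}"

definition gball :: "nat \<Rightarrow> nat \<Rightarrow> nat set" where
  "gball m v = (ball_rel ^^ m) `` {v}"

lemma gball_0 [simp]: "gball 0 v = {v}"
  unfolding gball_def by auto

lemma gball_Suc: "gball (Suc m) v = (\<Union>x\<in>gball m v. insert x (nbrs E x))"
  unfolding gball_def ball_rel_def nbrs_def by (auto simp: insert_commute relcomp.simps)

text \<open>Symmetry turns a bound on the size of balls into a bound on how many centres have a
  given vertex in their ball.\<close>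

lemma gball_sym: "u \<in> gball m v \<Longrightarrow> v \<in> gball m u"
proof -
  have s: "(x, y) \<in> ball_rel \<Longrightarrow> (y, x) \<in> ball_rel" for x y
    unfolding ball_rel_def by (auto simp: insert_commute)
  have "(x, y) \<in> ball_rel ^^ m \<Longrightarrow> (y, x) \<in> ball_rel ^^ m" for x y
  proof (induction m arbitrary: x y)
    case (Suc m)
    then obtain z where "(x, z) \<in> ball_rel ^^ m" "(z, y) \<in> ball_rel" by (auto simp: relcomp.simps)
    then have "(y, z) \<in> ball_rel" "(z, x) \<in> ball_rel ^^ m" using s Suc.IH by auto
    then show ?case by (rule relpow_Suc_I2)
  qed auto
  then show "u \<in> gball m v \<Longrightarrow> v \<in> gball m u" unfolding gball_def by auto
qed

lemma gball_subset: "v \<in> V \<Longrightarrow> gball m v \<subseteq> V"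
  by (induction m) (use nbrs_subset in \<open>auto simp: gball_Suc\<close>)

text \<open>Grow from \<open>v\<close>: each added vertex is adjacent to the block, so the radius
  increases by at most one per vertex.\<close>

lemma exists_conn_block:
  assumes "connected_graph V E" "v \<in> V" "Suc m \<le> card V"
  shows "\<exists>B\<subseteq>V. v \<in> B \<and> conn B \<and> card B = Suc m \<and> B \<subseteq> gball m v"
  using assms(3)
proof (induction m)
  case 0
  then show ?case using assms by (intro exI[of _ "{v}"]) (auto simp: conn_singleton)
next
  case (Suc m)
  then obtain B where B: "B \<subseteq> V" "v \<in> B" "conn B" "card B = Suc m" "B \<subseteq> gball m v" by auto
  then have "B \<subset> V" using Suc.prems by auto
  then obtain x y where xy: "x \<in> V" "x \<notin> B" "y \<in> B" "{x, y} \<in> E"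
    using B connD[OF conn_V[OF assms(1)]] by (metis empty_iff)
  have "insert x B \<subseteq> gball (Suc m) v"
    using B xy unfolding gball_Suc by (auto simp: mem_nbrs_iff)
  moreover have "finite B" using B finite_V finite_subset by blast
  ultimately show ?case using B xy conn_insert[OF B(3) xy(3,4)]
    by (intro exI[of _ "insert x B"]) auto
qed

end

context potts
begin

lemma card_gball_le: "v \<in> V \<Longrightarrow> card (gball m v) \<le> Suc \<Delta> ^ m"
proof (induction m)
  case (Suc m)
  have fin: "finite (gball m v)" using gball_subset[OF Suc.prems] finite_V finite_subset by blast
  have "card (gball (Suc m) v) \<le> (\<Sum>x\<in>gball m v. card (insert x (nbrs E x)))"
    unfolding gball_Suc by (rule card_UN_le[OF fin])
  also have "\<dots> \<le> (\<Sum>x\<in>gball m v. Suc \<Delta>)"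
  proof (rule sum_mono)
    fix x assume "x \<in> gball m v"
    then have "x \<in> V" using gball_subset[OF Suc.prems] by blast
    then have "card (nbrs E x) \<le> \<Delta>" using degree_le unfolding degree_def by blast
    then show "card (insert x (nbrs E x)) \<le> Suc \<Delta>"
      using card_insert_le_m1[of "Suc \<Delta>" "nbrs E x" x] by simp
  qed
  also have "\<dots> \<le> Suc \<Delta> ^ m * Suc \<Delta>"
    using mult_le_mono1[OF Suc.IH[OF Suc.prems], of "Suc \<Delta>"] by simp
  finally show ?case by (simp add: mult.commute)
qed simp

section \<open>Colour probabilities in a block\<close>

text \<open>At most \<open>N\<close> colours occur on \<open>X\<close>, each contributing at most
  \<open>lam ^ D\<close>; every other colour contributes 1.\<close>

lemma sum_pow_colour_le:
  assumes "finite Q" "finite X" "card X \<le> N" "\<And>c. c \<in> Q \<Longrightarrow> card {y\<in>X. \<sigma> y = c} \<le> D"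
  shows "(\<Sum>c\<in>Q. lam ^ card {y\<in>X. \<sigma> y = (c::nat)}) \<le> real (card Q) + real N * lam ^ D"
proof -
  have "(\<Sum>c\<in>Q. lam ^ card {y\<in>X. \<sigma> y = c}) \<le> (\<Sum>c\<in>Q. 1 + (if c \<in> \<sigma> ` X then lam ^ D else 0))"
  proof (rule sum_mono)
    fix c assume c: "c \<in> Q"
    show "lam ^ card {y\<in>X. \<sigma> y = c} \<le> 1 + (if c \<in> \<sigma> ` X then lam ^ D else 0)"
    proof (cases "c \<in> \<sigma> ` X")
      case True
      then show ?thesis using power_increasing[OF assms(4)[OF c] lam_ge] by simp
    next
      case False
      then have "{y\<in>X. \<sigma> y = c} = {}" by auto
      then show ?thesis using False by (simp only: card.empty power_0) simp
    qed
  qed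
  also have "\<dots> = real (card Q) + real (card (Q \<inter> \<sigma> ` X)) * lam ^ D"
    using assms(1) by (simp add: sum.distrib flip: sum.inter_restrict)
  also have "\<dots> \<le> real (card Q) + real N * lam ^ D"
  proof -
    have "card (Q \<inter> \<sigma> ` X) \<le> card (\<sigma> ` X)" using assms by (intro card_mono) auto
    also have "\<dots> \<le> N" using card_image_le[OF assms(2), of \<sigma>] assms(3) by simp
    finally show ?thesis using lam_ge by (intro add_left_mono mult_right_mono) auto
  qed
  finally show ?thesis .
qed

lemma card_nbrs_diff_le:
  assumes "x \<in> V" "y \<in> A" "{x, y} \<in> E" "\<Delta> = Suc D"
  shows "card (nbrs E x - A) \<le> D"
proof -
  have "y \<in> nbrs E x" using assms by (metis mem_nbrs_commute mem_nbrs_iff)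
  then have "nbrs E x - A \<subset> nbrs E x" using assms by blast
  then have "card (nbrs E x - A) < card (nbrs E x)" by (rule psubset_card_mono[OF finite_nbrs])
  then show ?thesis using degree_le[OF assms(1)] assms(4) unfolding degree_def by simp
qed

text \<open>Summing out the vertices of a connected set in the reverse of an order that grows it from
  \<open>r\<close>, every vertex other than \<open>r\<close> sees at most \<open>\<Delta> - 1\<close> already coloured neighbours; for \<open>r\<close>
  itself this is imposed.\<close>

lemma rooted_sum_le:
  assumes B: "finite B" "conn B" "r \<in> B" "B \<subseteq> V" and D: "\<Delta> = Suc D"
    and Q: "\<And>v. Q v \<subseteq> {1..q}" and \<sigma>: "\<sigma> \<in> confs"
  shows "(\<Sum>\<tau>\<in>cls B \<sigma>. if (\<forall>v\<in>B. \<tau> v \<in> Q v) \<and> ncol E \<tau> r (\<tau> r) \<le> D then lam ^ touch_mono B \<tau> else 0)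
    \<le> (\<Prod>v\<in>B. real (card (Q v)) + real \<Delta> * lam ^ D)"
proof -
  \<comment> \<open>All boundary conditions are quantified over, since colouring a new vertex alters
    the boundary seen by \<open>A\<close>.\<close>
  define P where "P A \<longleftrightarrow> (\<forall>\<sigma>\<in>confs. (\<Sum>\<tau>\<in>cls A \<sigma>. if (\<forall>v\<in>A. \<tau> v \<in> Q v) \<and> ncol E \<tau> r (\<tau> r) \<le> D
      then lam ^ touch_mono A \<tau> else 0) \<le> (\<Prod>v\<in>A. real (card (Q v)) + real \<Delta> * lam ^ D))" for A
  have finQ: "finite (Q v)" for v using Q[of v] finite_subset by blast
  from B(1-3) have "P B"
  proof (induction rule: conn_induct)
    case base
    have r: "r \<in> V" using B by blast
    show ?case unfolding P_def
    proof
      fix \<sigma> assume \<sigma>: "\<sigma> \<in> confs"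
      \<comment> \<open>The colours that meet the root condition: for these the exponent is at most
        \<open>D\<close> even when the root has \<open>D + 1\<close> neighbours.\<close>
      define Q' where "Q' = {c\<in>Q r. ncol E \<sigma> r c \<le> D}"
      have "(\<Sum>\<tau>\<in>cls {r} \<sigma>. if (\<forall>v\<in>{r}. \<tau> v \<in> Q v) \<and> ncol E \<tau> r (\<tau> r) \<le> D then lam ^ touch_mono {r} \<tau> else 0)
        = (\<Sum>c\<in>{1..q}. if c \<in> Q r \<and> ncol E \<sigma> r c \<le> D then lam ^ ncol E \<sigma> r c else 0)"
        by (simp add: sum_cls_single[OF \<sigma> r] touch_mono_singleton cong: if_cong)
      also have "\<dots> = (\<Sum>c\<in>Q'. lam ^ ncol E \<sigma> r c)"
        by (rule sum.mono_neutral_cong_right) (use Q[of r] in \<open>auto simp: Q'_def\<close>)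
      also have "\<dots> \<le> real (card Q') + real \<Delta> * lam ^ D"
        unfolding ncol_def
        by (rule sum_pow_colour_le)
          (use finQ[of r] finite_nbrs degree_le[OF r] in \<open>auto simp: Q'_def degree_def ncol_def\<close>)
      also have "\<dots> \<le> real (card (Q r)) + real \<Delta> * lam ^ D"
        using card_mono[OF finQ[of r], of Q'] by (simp add: Q'_def)
      finally show "(\<Sum>\<tau>\<in>cls {r} \<sigma>. if (\<forall>v\<in>{r}. \<tau> v \<in> Q v) \<and> ncol E \<tau> r (\<tau> r) \<le> D
          then lam ^ touch_mono {r} \<tau> else 0) \<le> (\<Prod>v\<in>{r}. real (card (Q v)) + real \<Delta> * lam ^ D)" by simp
    qed
  next
    case (step A x y)
    have x: "x \<in> V" and finA: "finite A" using step B finite_subset by blast+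
    let ?g = "\<lambda>A \<tau>. if (\<forall>v\<in>A. \<tau> v \<in> Q v) \<and> ncol E \<tau> r (\<tau> r) \<le> D then lam ^ touch_mono A \<tau> else 0"
    let ?p = "\<lambda>A. \<Prod>v\<in>A. real (card (Q v)) + real \<Delta> * lam ^ D"
    have p0: "0 \<le> ?p A" using lam_ge by (intro prod_nonneg) auto
    show ?case unfolding P_def
    proof
      fix \<sigma> assume \<sigma>: "\<sigma> \<in> confs"
      let ?m = "\<lambda>c. card {z\<in>nbrs E x - A. \<sigma> z = c}"
      have "(\<Sum>\<tau>\<in>cls (insert x A) \<sigma>. ?g (insert x A) \<tau>)
          = (\<Sum>c\<in>{1..q}. \<Sum>\<tau>\<in>cls A (\<sigma>(x := c)). ?g (insert x A) \<tau>)"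
        by (rule sum_cls_insert) (use \<sigma> x step in auto)
      \<comment> \<open>Edges from \<open>x\<close> into \<open>A\<close> belong to
        \<open>touch_mono A\<close>; the remaining ones lead to vertices coloured by \<sigma>, so
        their factor leaves the inner sum.\<close>
      also have "\<dots> = (\<Sum>c\<in>{1..q}. \<Sum>\<tau>\<in>cls A (\<sigma>(x := c)). (if c \<in> Q x then lam ^ ?m c else 0) * ?g A \<tau>)"
      proof (intro sum.cong refl)
        fix c \<tau> assume \<tau>: "\<tau> \<in> cls A (\<sigma>(x := c))"
        have \<tau>x: "\<tau> x = c" using \<tau> step unfolding cls_def by auto
        have "{z\<in>nbrs E x - A. \<tau> z = \<tau> x} = {z\<in>nbrs E x - A. \<sigma> z = c}"
          using \<tau> \<tau>x not_self_nbr[of x] unfolding cls_def by (auto split: if_splits)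
        then have "touch_mono (insert x A) \<tau> = touch_mono A \<tau> + ?m c"
          using touch_mono_insert[of x A \<tau>] step by simp
        then show "?g (insert x A) \<tau> = (if c \<in> Q x then lam ^ ?m c else 0) * ?g A \<tau>"
          using \<tau>x by (simp add: power_add)
      qed
      also have "\<dots> = (\<Sum>c\<in>{1..q}. (if c \<in> Q x then lam ^ ?m c else 0) * (\<Sum>\<tau>\<in>cls A (\<sigma>(x := c)). ?g A \<tau>))"
        by (simp add: sum_distrib_left)
      also have "\<dots> \<le> (\<Sum>c\<in>{1..q}. (if c \<in> Q x then lam ^ ?m c else 0) * ?p A)"
        using step(7) confs_upd[OF \<sigma> x] lam_ge unfolding P_def by (intro sum_mono mult_left_mono) auto
      also have "\<dots> = (\<Sum>c\<in>{1..q}. (if c \<in> Q x then lam ^ ?m c else 0)) * ?p A"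
        by (simp add: sum_distrib_right)
      also have "(\<Sum>c\<in>{1..q}. (if c \<in> Q x then lam ^ ?m c else 0)) = (\<Sum>c\<in>Q x. lam ^ ?m c)"
        by (rule sum.mono_neutral_cong_right) (use Q[of x] in auto)
      also have "\<dots> * ?p A \<le> (real (card (Q x)) + real \<Delta> * lam ^ D) * ?p A"
      proof (rule mult_right_mono[OF _ p0], rule sum_pow_colour_le)
        have c: "card (nbrs E x - A) \<le> D" using card_nbrs_diff_le[OF x step(5,6) D] .
        then show "card (nbrs E x - A) \<le> \<Delta>" using D by simp
        show "?m c \<le> D" for c
          using card_mono[of "nbrs E x - A" "{z\<in>nbrs E x - A. \<sigma> z = c}"] finite_nbrs c by fastforce
      qed (use finQ finite_nbrs in auto)
      also have "\<dots> = ?p (insert x A)" using step finA by simp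
      finally show "(\<Sum>\<tau>\<in>cls (insert x A) \<sigma>. ?g (insert x A) \<tau>) \<le> ?p (insert x A)" .
    qed
  qed
  then show ?thesis using \<sigma> unfolding P_def by blast
qed

text \<open>The root brings at most \<open>D + 1\<close> edges and every further vertex at most
  \<open>D\<close> new ones; hence the single extra 1.\<close>

lemma touch_mono_le:
  assumes "B \<subseteq> V" "conn B" "B \<noteq> {}" and D: "\<Delta> = Suc D"
  shows "touch_mono B \<tau> \<le> D * card B + 1"
proof -
  obtain r where r: "r \<in> B" using assms by blast
  have fin: "finite B" using assms finite_V finite_subset by blast
  from fin assms(2) r have "card {e\<in>E. e \<inter> B \<noteq> {} \<and> True} \<le> D * card B + 1"
  proof (induction rule: conn_induct)
    case base
    have "r \<in> V" using r assms by blast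
    then have "card {y\<in>nbrs E r. True} \<le> Suc D" using degree_le D unfolding degree_def by simp
    moreover have "card {e\<in>E. e \<inter> {r} \<noteq> {} \<and> True} = card {y\<in>nbrs E r. True}"
      using card_edges_at[of r "\<lambda>_. True"] by simp
    ultimately show ?case by simp
  next
    case (step A x y)
    have x: "x \<in> V" and finA: "finite A" using step assms fin finite_subset by blast+
    have "card {e\<in>E. e \<inter> insert x A \<noteq> {} \<and> True} = card {e\<in>E. e \<inter> A \<noteq> {} \<and> True} + card (nbrs E x - A)"
      using card_touch_insert[of x A "\<lambda>_. True"] step by (simp add: set_diff_eq)
    moreover have "card (nbrs E x - A) \<le> D" using card_nbrs_diff_le[OF x step(5,6) D] .
    ultimately show ?case using step finA by (simp add: algebra_simps)
  qed
  moreover have "touch_mono B \<tau> \<le> card {e\<in>E. e \<inter> B \<noteq> {} \<and> True}"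
    unfolding touch_mono_def by (rule card_mono) (auto simp: finite_E)
  ultimately show ?thesis by linarith
qed

lemma wt_cls: "\<tau> \<in> cls B \<sigma> \<Longrightarrow> wt \<tau> = lam ^ off_mono B \<sigma> * lam ^ touch_mono B \<tau>"
  unfolding wt_def mono_edges_split[of \<tau> B] using off_mono_cong[of B \<tau> \<sigma>]
  by (simp add: cls_def power_add)

text \<open>An upper bound for the probability of one colour at one vertex of a block of size
  \<open>k\<close>. The first summand is a union over the choice of root, with the factor
  \<open>1 + \<Delta> * lam ^ D\<close> for the vertex whose colour is prescribed; the second is the
  entirely monochromatic configuration. The denominator bounds the block partition function from
  below.\<close>

definition colour_bound :: "nat \<Rightarrow> nat \<Rightarrow> real" where
  "colour_bound D k = (real k * ((1 + real \<Delta> * lam ^ D) * (real q + real \<Delta> * lam ^ D) ^ (k - 1))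
     + lam ^ (D * k + 1)) / real q ^ k"

text \<open>If some vertex of \<open>B\<close> has at most \<open>D\<close> neighbours of its own
  colour, it serves as the root. Otherwise all edges touching \<open>B\<close> are monochromatic,
  and by connectedness only the configuration \<open>\<tau>0\<close> is left.\<close>

lemma touch_colour_sum_le:
  assumes B: "B \<subseteq> V" "conn B" "card B = k" and D: "\<Delta> = Suc D"
    and \<sigma>: "\<sigma> \<in> confs" and x: "x \<in> B" and c: "c \<in> {1..q}"
  shows "(\<Sum>\<tau>\<in>{\<tau>\<in>cls B \<sigma>. \<tau> x = c}. lam ^ touch_mono B \<tau>)
    \<le> colour_bound D k * real q ^ k"
proof -
  have fin: "finite B" using B finite_V finite_subset by blast
  define Q where "Q v = (if v = x then {c} else {1..q})" for v
  define \<tau>0 where "\<tau>0 v = (if v \<in> B then c else \<sigma> v)" for v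
  let ?ok = "\<lambda>r \<tau>. (\<forall>v\<in>B. \<tau> v \<in> Q v) \<and> ncol E \<tau> r (\<tau> r) \<le> D"
  let ?g = "\<lambda>\<tau>. lam ^ touch_mono B \<tau>"
  have fincls: "finite (cls B \<sigma>)" using finite_confs by (auto simp: cls_def)
  have pt: "?g \<tau> \<le> (\<Sum>r\<in>B. if ?ok r \<tau> then ?g \<tau> else 0) + (if \<tau> = \<tau>0 then lam ^ (D * k + 1) else 0)"
    if \<tau>: "\<tau> \<in> cls B \<sigma>" "\<tau> x = c" for \<tau>
  proof -
    have \<tau>Q: "\<forall>v\<in>B. \<tau> v \<in> Q v"
      using \<tau> B confs_mem[of \<tau>] unfolding Q_def cls_def by auto
    show ?thesis
    proof (cases "\<exists>r\<in>B. ncol E \<tau> r (\<tau> r) \<le> D")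
      case True
      then obtain r where r: "r \<in> B" "ncol E \<tau> r (\<tau> r) \<le> D" by blast
      have "?g \<tau> = (if ?ok r \<tau> then ?g \<tau> else 0)" using r \<tau>Q by simp
      also have "\<dots> \<le> (\<Sum>r\<in>B. if ?ok r \<tau> then ?g \<tau> else 0)"
        by (rule member_le_sum) (use r fin lam_ge in auto)
      also have "\<dots> \<le> (\<Sum>r\<in>B. if ?ok r \<tau> then ?g \<tau> else 0) + (if \<tau> = \<tau>0 then lam ^ (D * k + 1) else 0)"
        using lam_ge by simp
      finally show ?thesis .
    next
      case False
      \<comment> \<open>More than \<open>D\<close> neighbours of equal colour means all of them, as
        the degree is at most \<open>D + 1\<close>.\<close>
      have same: "\<tau> u = \<tau> r" if "r \<in> B" "u \<in> nbrs E r" for r u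
      proof -
        have "card (nbrs E r) \<le> card {u\<in>nbrs E r. \<tau> u = \<tau> r}"
          using False that B degree_le[of r] D unfolding degree_def ncol_def by fastforce
        then have "{u\<in>nbrs E r. \<tau> u = \<tau> r} = nbrs E r" by (intro card_seteq finite_nbrs) auto
        then show ?thesis using that by blast
      qed
      have "{v\<in>B. \<tau> v = c} = B"
      proof (rule ccontr)
        assume "{v\<in>B. \<tau> v = c} \<noteq> B"
        then have "{v\<in>B. \<tau> v = c} \<subset> B" "{v\<in>B. \<tau> v = c} \<noteq> {}" using \<tau> x by auto
        from connD[OF B(2) this] obtain z y where "z \<in> B" "\<tau> z \<noteq> c" "y \<in> B" "\<tau> y = c" "{z, y} \<in> E"
          by blast
        then show False using same[of y z] by (simp add: mem_nbrs_iff)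
      qed
      then have "\<forall>v\<in>B. \<tau> v = c" by blast
      then have "\<tau> = \<tau>0" using \<tau> unfolding \<tau>0_def cls_def by auto
      moreover have "?g \<tau> \<le> lam ^ (D * k + 1)"
        using touch_mono_le[OF B(1,2) _ D, of \<tau>] x B(3) lam_ge by (intro power_increasing) auto
      moreover have "0 \<le> (\<Sum>r\<in>B. if ?ok r \<tau> then ?g \<tau> else 0)"
        using lam_ge by (intro sum_nonneg) auto
      ultimately show ?thesis by simp
    qed
  qed
  have "(\<Sum>\<tau>\<in>{\<tau>\<in>cls B \<sigma>. \<tau> x = c}. ?g \<tau>)
     \<le> (\<Sum>\<tau>\<in>{\<tau>\<in>cls B \<sigma>. \<tau> x = c}. (\<Sum>r\<in>B. if ?ok r \<tau> then ?g \<tau> else 0) + (if \<tau> = \<tau>0 then lam ^ (D * k + 1) else 0))"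
    by (intro sum_mono pt) auto
  also have "\<dots> \<le> (\<Sum>\<tau>\<in>cls B \<sigma>. (\<Sum>r\<in>B. if ?ok r \<tau> then ?g \<tau> else 0) + (if \<tau> = \<tau>0 then lam ^ (D * k + 1) else 0))"
    using lam_ge by (intro sum_mono2 fincls add_nonneg_nonneg sum_nonneg) auto
  also have "\<dots> = (\<Sum>r\<in>B. \<Sum>\<tau>\<in>cls B \<sigma>. if ?ok r \<tau> then ?g \<tau> else 0) + (\<Sum>\<tau>\<in>cls B \<sigma>. if \<tau> = \<tau>0 then lam ^ (D * k + 1) else 0)"
    unfolding sum.distrib by (subst sum.swap) simp
  also have "\<dots> \<le> (\<Sum>r\<in>B. (1 + real \<Delta> * lam ^ D) * (real q + real \<Delta> * lam ^ D) ^ (k - 1)) + lam ^ (D * k + 1)"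
  proof (rule add_mono)
    show "(\<Sum>\<tau>\<in>cls B \<sigma>. if \<tau> = \<tau>0 then lam ^ (D * k + 1) else 0) \<le> lam ^ (D * k + 1)"
      using fincls lam_ge by (simp add: sum.delta)
    have prod: "(\<Prod>v\<in>B. real (card (Q v)) + real \<Delta> * lam ^ D)
        = (1 + real \<Delta> * lam ^ D) * (real q + real \<Delta> * lam ^ D) ^ (k - 1)"
    proof -
      have "(\<Prod>v\<in>B. real (card (Q v)) + real \<Delta> * lam ^ D)
        = (1 + real \<Delta> * lam ^ D) * (\<Prod>v\<in>B - {x}. real (card (Q v)) + real \<Delta> * lam ^ D)"
        by (subst prod.remove[OF fin x]) (simp add: Q_def)
      also have "(\<Prod>v\<in>B - {x}. real (card (Q v)) + real \<Delta> * lam ^ D) = (\<Prod>v\<in>B - {x}. real q + real \<Delta> * lam ^ D)"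
        by (intro prod.cong) (auto simp: Q_def)
      finally show ?thesis using x B(3) fin by simp
    qed
    show "(\<Sum>r\<in>B. \<Sum>\<tau>\<in>cls B \<sigma>. if ?ok r \<tau> then ?g \<tau> else 0)
       \<le> (\<Sum>r\<in>B. (1 + real \<Delta> * lam ^ D) * (real q + real \<Delta> * lam ^ D) ^ (k - 1))"
      unfolding prod[symmetric]
      by (intro sum_mono rooted_sum_le) (use fin B D \<sigma> c in \<open>auto simp: Q_def split: if_splits\<close>)
  qed
  also have "\<dots> = colour_bound D k * real q ^ k"
    unfolding colour_bound_def using B(3) q_pos by simp
  finally show ?thesis .
qed

lemma touch_sum_ge:
  assumes "B \<subseteq> V" "card B = k" "\<sigma> \<in> confs"
  shows "real q ^ k \<le> (\<Sum>\<tau>\<in>cls B \<sigma>. lam ^ touch_mono B \<tau>)"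
proof -
  have fin: "finite B" using assms finite_V finite_subset by blast
  have "real q ^ k = (\<Sum>\<tau>\<in>cls B \<sigma>. 1)" using card_cls[OF fin assms(1,3)] assms(2) by simp
  also have "\<dots> \<le> (\<Sum>\<tau>\<in>cls B \<sigma>. lam ^ touch_mono B \<tau>)"
    using lam_ge by (intro sum_mono one_le_power)
  finally show ?thesis .
qed

end

section \<open>Contraction of the block dynamics\<close>

lemma sum_UN_le:
  fixes f :: "'a \<Rightarrow> real"
  assumes "finite I" "\<And>i. i \<in> I \<Longrightarrow> finite (A i)" "\<And>i x. i \<in> I \<Longrightarrow> x \<in> A i \<Longrightarrow> 0 \<le> f x"
  shows "sum f (\<Union>i\<in>I. A i) \<le> (\<Sum>i\<in>I. sum f (A i))"
  using assms
proof (induction I rule: finite_induct)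
  case (insert i I)
  have "sum f (A i \<union> (\<Union>i\<in>I. A i)) \<le> sum f (A i) + sum f (\<Union>i\<in>I. A i)"
  proof -
    have "0 \<le> sum f (A i \<inter> (\<Union>i\<in>I. A i))" using insert by (intro sum_nonneg) auto
    moreover have "finite (A i)" "finite (\<Union>i\<in>I. A i)" using insert by auto
    ultimately show ?thesis using sum.union_inter[of "A i" "\<Union>i\<in>I. A i" f] by linarith
  qed
  also have "\<dots> \<le> sum f (A i) + (\<Sum>i\<in>I. sum f (A i))"
    by (intro add_left_mono insert.IH) (use insert.prems in auto)
  finally show ?case using insert by simp
qed simp

text \<open>The two normalised weights differ by at most \<open>3 * b\<close> in total:
  \<open>2 * b\<close> on \<open>bad\<close>, and \<open>b\<close> off it, where they are
  proportional. The functions being averaged differ by at most \<Lambda>.\<close>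

lemma weighted_mean_diff_le:
  fixes a a' g g' :: "'s \<Rightarrow> real"
  assumes S: "finite S" "S \<noteq> {}" and pos: "\<And>s. s \<in> S \<Longrightarrow> 0 < a s" "\<And>s. s \<in> S \<Longrightarrow> 0 < a' s"
    and bad: "bad \<subseteq> S" "\<And>s. s \<in> S \<Longrightarrow> s \<notin> bad \<Longrightarrow> a s = a' s"
    and g: "\<And>s. s \<in> S \<Longrightarrow> \<bar>g' s - g s\<bar> \<le> \<Lambda>" "\<And>s. s \<in> S \<Longrightarrow> \<bar>g s - mid\<bar> \<le> M"
    and b: "sum a bad \<le> b * sum a S" "sum a' bad \<le> b * sum a' S"
  shows "\<bar>(\<Sum>s\<in>S. a' s * g' s) / sum a' S - (\<Sum>s\<in>S. a s * g s) / sum a S\<bar> \<le> \<Lambda> + 3 * M * b"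
proof -
  define A where "A = sum a S"
  define A' where "A' = sum a' S"
  have A: "A > 0" "A' > 0" unfolding A_def A'_def using S pos by (auto intro!: sum_pos)
  define p where "p s = a s / A" for s
  define p' where "p' s = a' s / A'" for s
  have p1: "sum p S = 1" "sum p' S = 1"
    unfolding p_def p'_def sum_divide_distrib[symmetric] using A unfolding A_def A'_def by auto
  have pp: "\<And>s. s \<in> S \<Longrightarrow> 0 \<le> p s" "\<And>s. s \<in> S \<Longrightarrow> 0 \<le> p' s"
    unfolding p_def p'_def using pos A by (auto simp: less_imp_le)
  obtain s0 where "s0 \<in> S" using S by blast
  then have M: "0 \<le> M" using g(2)[of s0] by linarith
  have pb: "sum p bad \<le> b" "sum p' bad \<le> b"
    unfolding p_def p'_def sum_divide_distrib[symmetric] using A b unfolding A_def A'_def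
    by (auto simp: field_simps)
  have pb0: "0 \<le> sum p bad" "0 \<le> sum p' bad" using pp bad by (auto intro!: sum_nonneg)
  have split: "sum h S = sum h bad + sum h (S - bad)" for h :: "'s \<Rightarrow> real"
    using sum.subset_diff[OF bad(1) S(1), of h] by simp
  \<comment> \<open>Off \<open>bad\<close> the difference is \<open>a s\<close> times one common
    number, so all terms have the same sign. Their sum is then fixed by the masses of
    \<open>bad\<close>.\<close>
  have good: "(\<Sum>s\<in>S - bad. \<bar>p' s - p s\<bar>) = \<bar>\<Sum>s\<in>S - bad. p' s - p s\<bar>"
  proof -
    have e: "p' s - p s = a s * (1 / A' - 1 / A)" if "s \<in> S - bad" for s
      using bad(2)[of s] that unfolding p_def p'_def by (simp add: algebra_simps)
    have "(\<Sum>s\<in>S - bad. \<bar>p' s - p s\<bar>) = (\<Sum>s\<in>S - bad. a s * \<bar>1 / A' - 1 / A\<bar>)"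
      by (rule sum.cong[OF refl], subst e) (auto simp: abs_mult pos less_imp_le)
    also have "\<dots> = (\<Sum>s\<in>S - bad. a s) * \<bar>1 / A' - 1 / A\<bar>" by (simp add: sum_distrib_right)
    also have "\<dots> = \<bar>(\<Sum>s\<in>S - bad. a s) * (1 / A' - 1 / A)\<bar>"
    proof -
      have "0 \<le> (\<Sum>s\<in>S - bad. a s)" using pos by (intro sum_nonneg) (auto simp: less_imp_le)
      then show ?thesis by (simp add: abs_mult)
    qed
    also have "(\<Sum>s\<in>S - bad. a s) * (1 / A' - 1 / A) = (\<Sum>s\<in>S - bad. p' s - p s)"
      unfolding sum_distrib_right by (intro sum.cong refl) (simp add: e)
    finally show ?thesis .
  qed
  have "(\<Sum>s\<in>S - bad. p' s - p s) = sum p bad - sum p' bad"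
    using split[of p] split[of p'] p1 by (simp add: sum_subtractf)
  then have gd: "(\<Sum>s\<in>S - bad. \<bar>p' s - p s\<bar>) \<le> b" unfolding good using pb pb0 by linarith
  have "(\<Sum>s\<in>bad. \<bar>p' s - p s\<bar>) \<le> (\<Sum>s\<in>bad. p' s + p s)"
    by (rule sum_mono) (use pp bad in \<open>auto intro!: abs_leI simp: subset_iff\<close>)
  then have bd: "(\<Sum>s\<in>bad. \<bar>p' s - p s\<bar>) \<le> 2 * b" using pb by (simp add: sum.distrib)
  have tv: "(\<Sum>s\<in>S. \<bar>p' s - p s\<bar>) \<le> 3 * b" using split[of "\<lambda>s. \<bar>p' s - p s\<bar>"] gd bd by simp
  have "(\<Sum>s\<in>S. a' s * g' s) / A' - (\<Sum>s\<in>S. a s * g s) / A = (\<Sum>s\<in>S. p' s * g' s - p s * g s)"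
    unfolding p_def p'_def by (simp add: sum_divide_distrib sum_subtractf)
  \<comment> \<open>Both distributions have total mass 1, so \<open>g\<close> may be recentred at
    \<open>mid\<close> and only its oscillation counts.\<close>
  also have "\<dots> = (\<Sum>s\<in>S. p' s * (g' s - g s)) + (\<Sum>s\<in>S. (p' s - p s) * (g s - mid)) + (sum p' S - sum p S) * mid"
    unfolding sum_subtractf[symmetric] sum_distrib_right sum.distrib[symmetric]
    by (intro sum.cong refl) (simp add: algebra_simps)
  finally have eq: "(\<Sum>s\<in>S. a' s * g' s) / A' - (\<Sum>s\<in>S. a s * g s) / A
      = (\<Sum>s\<in>S. p' s * (g' s - g s)) + (\<Sum>s\<in>S. (p' s - p s) * (g s - mid))" using p1 by simp
  have "\<bar>\<Sum>s\<in>S. p' s * (g' s - g s)\<bar> \<le> (\<Sum>s\<in>S. p' s * \<Lambda>)"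
    by (rule order_trans[OF sum_abs sum_mono]) (use pp g in \<open>auto simp: abs_mult intro: mult_left_mono\<close>)
  then have f1: "\<bar>\<Sum>s\<in>S. p' s * (g' s - g s)\<bar> \<le> \<Lambda>" using p1 by (simp flip: sum_distrib_right)
  have "\<bar>\<Sum>s\<in>S. (p' s - p s) * (g s - mid)\<bar> \<le> (\<Sum>s\<in>S. \<bar>p' s - p s\<bar> * M)"
    by (rule order_trans[OF sum_abs sum_mono]) (use g in \<open>auto simp: abs_mult intro: mult_left_mono\<close>)
  also have "\<dots> \<le> 3 * b * M" unfolding sum_distrib_right[symmetric] using tv M by (intro mult_right_mono)
  finally have f2: "\<bar>\<Sum>s\<in>S. (p' s - p s) * (g s - mid)\<bar> \<le> 3 * M * b" by (simp add: mult_ac)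
  show ?thesis unfolding A_def[symmetric] A'_def[symmetric] eq using f1 f2 by linarith
qed

context potts
begin

text \<open>Lipschitz continuity for the Hamming distance, tested on single recolourings. This is
  the functional form of path coupling.\<close>

definition lip :: "((nat \<Rightarrow> nat) \<Rightarrow> real) \<Rightarrow> real \<Rightarrow> bool" where
  "lip f \<Lambda> \<longleftrightarrow> (\<forall>\<sigma>\<in>confs. \<forall>u\<in>V. \<forall>c\<in>{1..q}. \<bar>f (\<sigma>(u := c)) - f \<sigma>\<bar> \<le> \<Lambda>)"

lemma lip_nonneg: "lip f \<Lambda> \<Longrightarrow> 0 \<le> \<Lambda>"
  using confs_nonempty V_nonempty q_pos unfolding lip_def
  by (metis abs_ge_zero all_not_in_conv atLeastAtMost_iff order_refl order_trans)

lemma lip_cls: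
  assumes "lip f \<Lambda>" "finite B" "B \<subseteq> V" "\<sigma> \<in> confs" "\<tau> \<in> cls B \<sigma>"
  shows "\<bar>f \<tau> - f \<sigma>\<bar> \<le> real (card B) * \<Lambda>"
  using assms(2-5)
proof (induction B arbitrary: \<sigma> rule: finite_induct)
  case empty
  then show ?case using cls_empty by auto
next
  case (insert x A)
  have \<tau>: "\<tau> \<in> confs" using insert unfolding cls_def by auto
  have tx: "\<tau> x \<in> {1..q}" using confs_mem[OF \<tau>] insert by auto
  let ?\<rho> = "\<sigma>(x := \<tau> x)"
  have "?\<rho> \<in> confs" using confs_upd[OF _ _ tx] insert by auto
  moreover have "\<tau> \<in> cls A ?\<rho>" using insert unfolding cls_def by auto
  ultimately have "\<bar>f \<tau> - f ?\<rho>\<bar> \<le> real (card A) * \<Lambda>" using insert by auto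
  moreover have "\<bar>f ?\<rho> - f \<sigma>\<bar> \<le> \<Lambda>" using assms(1) insert tx unfolding lip_def by blast
  ultimately show ?case using insert by (simp add: algebra_simps)
qed

lemma lip_exists: "\<exists>\<Lambda>. lip f \<Lambda>"
proof -
  have "lip f (2 * (\<Sum>\<sigma>\<in>confs. \<bar>f \<sigma>\<bar>))"
    unfolding lip_def
  proof (intro ballI)
    fix \<sigma> u c assume a: "\<sigma> \<in> confs" "u \<in> V" "c \<in> {1..q}"
    have "\<bar>f \<tau>\<bar> \<le> (\<Sum>\<sigma>\<in>confs. \<bar>f \<sigma>\<bar>)" if "\<tau> \<in> confs" for \<tau>
      by (rule member_le_sum) (use that finite_confs in auto)
    from this[OF a(1)] this[OF confs_upd[OF a]] show "\<bar>f (\<sigma>(u := c)) - f \<sigma>\<bar> \<le> 2 * (\<Sum>\<sigma>\<in>confs. \<bar>f \<sigma>\<bar>)"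
      by linarith
  qed
  then show ?thesis by blast
qed

lemma cls_V: "\<sigma> \<in> confs \<Longrightarrow> cls V \<sigma> = confs"
  using confs_ext unfolding cls_def by (auto, metis)

lemma lip_sup_le:
  assumes "lip f \<Lambda>" "(\<Sum>\<sigma>\<in>confs. wt \<sigma> * f \<sigma>) = 0" "\<sigma> \<in> confs"
  shows "\<bar>f \<sigma>\<bar> \<le> real (card V) * \<Lambda>"
proof -
  let ?Z = "\<Sum>\<tau>\<in>confs. wt \<tau>"
  have Z: "?Z > 0" using partition_fn_pos partition_fn_eq by simp
  have "f \<sigma> * ?Z = (\<Sum>\<tau>\<in>confs. wt \<tau> * (f \<sigma> - f \<tau>))"
    using assms(2) by (simp add: right_diff_distrib sum_subtractf sum_distrib_left mult.commute)
  then have "\<bar>f \<sigma>\<bar> * ?Z = \<bar>\<Sum>\<tau>\<in>confs. wt \<tau> * (f \<sigma> - f \<tau>)\<bar>"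
    using Z by (metis abs_mult abs_of_pos)
  also have "\<dots> \<le> (\<Sum>\<tau>\<in>confs. wt \<tau> * (real (card V) * \<Lambda>))"
  proof (rule order_trans[OF sum_abs sum_mono])
    fix \<tau> assume \<tau>: "\<tau> \<in> confs"
    have "\<bar>f \<tau> - f \<sigma>\<bar> \<le> real (card V) * \<Lambda>"
      using lip_cls[OF assms(1) finite_V order_refl assms(3), of \<tau>] cls_V[OF assms(3)] \<tau> by simp
    then show "\<bar>wt \<tau> * (f \<sigma> - f \<tau>)\<bar> \<le> wt \<tau> * (real (card V) * \<Lambda>)"
      using weight_pos[OF \<tau>] by (simp add: abs_mult abs_minus_commute)
  qed
  also have "\<dots> = (real (card V) * \<Lambda>) * ?Z" unfolding sum_distrib_right[symmetric] by (rule mult.commute)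
  finally show ?thesis using Z by simp
qed

lemma avg_touch:
  assumes "\<sigma> \<in> confs"
  shows "avg (cls B) f \<sigma> = (\<Sum>\<tau>\<in>cls B \<sigma>. lam ^ touch_mono B \<tau> * f \<tau>) / (\<Sum>\<tau>\<in>cls B \<sigma>. lam ^ touch_mono B \<tau>)"
proof -
  let ?o = "lam ^ off_mono B \<sigma>"
  have "avg (cls B) f \<sigma> = (?o * (\<Sum>\<tau>\<in>cls B \<sigma>. lam ^ touch_mono B \<tau> * f \<tau>)) / (?o * (\<Sum>\<tau>\<in>cls B \<sigma>. lam ^ touch_mono B \<tau>))"
    unfolding avg_def mass_def sum_distrib_left
    by (intro arg_cong2[where f = "(/)"] sum.cong refl) (simp_all add: wt_cls)
  then show ?thesis using lam_ge by simp
qed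

text \<open>For \<open>u\<close> outside \<open>B\<close>, overwriting \<open>u\<close> is a
  bijection between the block states for two boundary conditions that differ at \<open>u\<close>. It
  couples the two block distributions by identical colours on \<open>B\<close>.\<close>

lemma sum_cls_shift:
  fixes h :: "(nat \<Rightarrow> nat) \<Rightarrow> real"
  assumes "\<sigma> \<in> confs" "u \<in> V" "u \<notin> B" "c \<in> {1..q}" "\<And>\<tau>. \<tau> \<in> confs \<Longrightarrow> P (\<tau>(u := c)) \<longleftrightarrow> P \<tau>"
    "\<And>\<tau>. \<tau> \<in> confs \<Longrightarrow> P (\<tau>(u := \<sigma> u)) \<longleftrightarrow> P \<tau>"
  shows "(\<Sum>\<tau>\<in>{\<tau>\<in>cls B \<sigma>. P \<tau>}. h (\<tau>(u := c))) = (\<Sum>\<tau>\<in>{\<tau>\<in>cls B (\<sigma>(u := c)). P \<tau>}. h \<tau>)"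
proof (rule sum.reindex_bij_witness[where i = "\<lambda>\<tau>. \<tau>(u := \<sigma> u)" and j = "\<lambda>\<tau>. \<tau>(u := c)"])
  have su: "\<sigma> u \<in> {1..q}" using confs_mem assms by blast
  fix \<tau>
  show "\<tau> \<in> {\<tau>\<in>cls B \<sigma>. P \<tau>} \<Longrightarrow> (\<tau>(u := c))(u := \<sigma> u) = \<tau>"
    using assms(3) unfolding cls_def by (auto simp: fun_upd_idem)
  show "\<tau> \<in> {\<tau>\<in>cls B \<sigma>. P \<tau>} \<Longrightarrow> \<tau>(u := c) \<in> {\<tau>\<in>cls B (\<sigma>(u := c)). P \<tau>}"
    using assms confs_upd[of \<tau> u c] unfolding cls_def by auto
  show "\<tau> \<in> {\<tau>\<in>cls B (\<sigma>(u := c)). P \<tau>} \<Longrightarrow> (\<tau>(u := \<sigma> u))(u := c) = \<tau>"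
    using assms(3) unfolding cls_def by (auto simp: fun_upd_idem)
  show "\<tau> \<in> {\<tau>\<in>cls B (\<sigma>(u := c)). P \<tau>} \<Longrightarrow> \<tau>(u := \<sigma> u) \<in> {\<tau>\<in>cls B \<sigma>. P \<tau>}"
    using assms confs_upd[of \<tau> u "\<sigma> u"] su unfolding cls_def by auto
qed simp

text \<open>An edge from \<open>u\<close> into \<open>B\<close> changes status only if its end in
  \<open>B\<close> carries the old or the new colour of \<open>u\<close>.\<close>

lemma touch_mono_upd_eq:
  assumes "u \<notin> B" "\<And>y. y \<in> nbrs E u \<Longrightarrow> y \<in> B \<Longrightarrow> \<tau> y \<noteq> \<tau> u \<and> \<tau> y \<noteq> c"
  shows "touch_mono B (\<tau>(u := c)) = touch_mono B \<tau>"
proof -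
  have "mono_edge (\<tau>(u := c)) e \<longleftrightarrow> mono_edge \<tau> e" if e: "e \<in> E" "e \<inter> B \<noteq> {}" for e
  proof (cases "u \<in> e")
    case True
    obtain x y where xy: "e = {x, y}" "x \<noteq> y" using edgeE[OF e(1)] by metis
    define z where "z = (if u = x then y else x)"
    have z: "e = {u, z}" "z \<noteq> u" using True xy unfolding z_def by auto
    then have "z \<in> nbrs E u" "z \<in> B" using e assms(1) by (auto simp: mem_nbrs_iff insert_commute)
    then have "\<tau> z \<noteq> \<tau> u" "\<tau> z \<noteq> c" using assms(2) by blast+
    then show ?thesis unfolding z(1) mono_edge_iff using z(2) by auto
  next
    case False
    then show ?thesis by (rule_tac edgeE[OF e(1)]) auto
  qed
  then show ?thesis unfolding touch_mono_def by (metis (mono_tags, lifting))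
qed

text \<open>The two block distributions are compared on a common space. Their weights agree except
  on \<open>bad\<close>, so \<open>weighted_mean_diff_le\<close> applies; 6 is 3 from that lemma
  times 2 colours.\<close>

lemma block_avg_diff_le:
  assumes B: "B \<subseteq> V" and \<sigma>: "\<sigma> \<in> confs" and u: "u \<in> V" "u \<notin> B" and c: "c \<in> {1..q}"
    and f: "lip f \<Lambda>" and D: "\<Delta> = Suc D"
    and nice: "nbrs E u \<inter> B \<noteq> {} \<Longrightarrow> conn B \<and> card B = k"
  shows "\<bar>avg (cls B) f (\<sigma>(u := c)) - avg (cls B) f \<sigma>\<bar>
     \<le> \<Lambda> + (if nbrs E u \<inter> B = {} then 0 else 6 * real k * real \<Delta> * colour_bound D k * \<Lambda>)"
proof -
  have fin: "finite B" using B finite_V finite_subset by blast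
  define S where "S = cls B \<sigma>"
  define a where "a \<tau> = lam ^ touch_mono B \<tau>" for \<tau>
  define a' where "a' \<tau> = lam ^ touch_mono B (\<tau>(u := c))" for \<tau>
  \<comment> \<open>Some neighbour of \<open>u\<close> in the block has the old or the new colour of
    \<open>u\<close>: at most \<open>2 * \<Delta>\<close> events, each controlled by
    \<open>colour_bound\<close>.\<close>
  define bad where "bad = (\<Union>(y, d)\<in>(nbrs E u \<inter> B) \<times> {\<sigma> u, c}. {\<tau>\<in>S. \<tau> y = d})"
  define b where "b = (if nbrs E u \<inter> B = {} then 0 else 2 * real \<Delta> * colour_bound D k)"
  have su: "\<sigma> u \<in> {1..q}" using confs_mem \<sigma> u by blast
  have \<sigma>': "\<sigma>(u := c) \<in> confs" by (rule confs_upd[OF \<sigma> u(1) c])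
  have finS: "finite S" unfolding S_def cls_def using finite_confs by simp
  have Suq: "\<tau> u = \<sigma> u" if "\<tau> \<in> S" for \<tau> using that u unfolding S_def cls_def by auto
  have shift: "(\<Sum>\<tau>\<in>S. h (\<tau>(u := c))) = (\<Sum>\<tau>\<in>cls B (\<sigma>(u := c)). h \<tau>)" for h :: "(nat \<Rightarrow> nat) \<Rightarrow> real"
    using sum_cls_shift[OF \<sigma> u c, of "\<lambda>_. True" h] unfolding S_def by simp
  have card_pairs: "card ((nbrs E u \<inter> B) \<times> {\<sigma> u, c}) \<le> 2 * \<Delta>"
  proof -
    have "card (nbrs E u \<inter> B) \<le> \<Delta>"
      using card_mono[OF finite_nbrs, of "nbrs E u \<inter> B" u] degree_le[OF u(1)] unfolding degree_def by simp
    moreover have "card {\<sigma> u, c} \<le> 2" by (simp add: card_insert_if)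
    ultimately show ?thesis using mult_le_mono by (fastforce simp: card_cartesian_product)
  qed
  have finp: "finite ((nbrs E u \<inter> B) \<times> {\<sigma> u, c})" using fin by simp
  have cb0: "0 \<le> colour_bound D k"
    unfolding colour_bound_def using lam_ge by (intro divide_nonneg_nonneg add_nonneg_nonneg mult_nonneg_nonneg) auto
  have bad_le: "sum h bad \<le> b * sum h S"
    if h: "\<And>\<tau>. 0 \<le> h \<tau>" and ge: "nbrs E u \<inter> B \<noteq> {} \<Longrightarrow> real q ^ k \<le> sum h S"
      and col: "\<And>y d. nbrs E u \<inter> B \<noteq> {} \<Longrightarrow> y \<in> nbrs E u \<inter> B \<Longrightarrow> d \<in> {1..q} \<Longrightarrow>
        sum h {\<tau>\<in>S. \<tau> y = d} \<le> colour_bound D k * real q ^ k"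
    for h :: "(nat \<Rightarrow> nat) \<Rightarrow> real"
  proof (cases "nbrs E u \<inter> B = {}")
    case True
    then show ?thesis unfolding b_def bad_def by simp
  next
    case False
    have "sum h bad \<le> (\<Sum>yd\<in>(nbrs E u \<inter> B) \<times> {\<sigma> u, c}. sum h (case yd of (y, d) \<Rightarrow> {\<tau>\<in>S. \<tau> y = d}))"
      unfolding bad_def by (rule sum_UN_le[OF finp]) (use finS h in auto)
    also have "\<dots> \<le> (\<Sum>yd\<in>(nbrs E u \<inter> B) \<times> {\<sigma> u, c}. colour_bound D k * real q ^ k)"
    proof (rule sum_mono)
      fix yd assume "yd \<in> (nbrs E u \<inter> B) \<times> {\<sigma> u, c}"
      then obtain y d where "yd = (y, d)" "y \<in> nbrs E u \<inter> B" "d \<in> {1..q}" using su c by auto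
      then show "sum h (case yd of (y, d) \<Rightarrow> {\<tau>\<in>S. \<tau> y = d}) \<le> colour_bound D k * real q ^ k"
        using col[OF False] by simp
    qed
    also have "\<dots> \<le> real (2 * \<Delta>) * (colour_bound D k * real q ^ k)"
      unfolding sum_constant using card_pairs cb0 by (intro mult_right_mono) (auto simp del: of_nat_mult)
    also have "\<dots> \<le> real (2 * \<Delta>) * (colour_bound D k * sum h S)"
      using ge[OF False] cb0 by (intro mult_left_mono) auto
    finally show ?thesis using False unfolding b_def by (simp add: mult_ac)
  qed
  have "\<bar>(\<Sum>\<tau>\<in>S. a' \<tau> * f (\<tau>(u := c))) / sum a' S - (\<Sum>\<tau>\<in>S. a \<tau> * f \<tau>) / sum a S\<bar>
      \<le> \<Lambda> + 3 * (real (card B) * \<Lambda>) * b"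
  \<comment> \<open>Within the class, \<open>f\<close> stays within \<open>card B\<close>
    recolourings of \<open>f \<sigma>\<close>, which supplies the radius.\<close>
  proof (rule weighted_mean_diff_le[where bad = bad and mid = "f \<sigma>"])
    show "S \<noteq> {}" using partitionsD(1)[OF partitions_cls \<sigma>] unfolding S_def by blast
    show "bad \<subseteq> S" unfolding bad_def by auto
    show "a \<tau> = a' \<tau>" if "\<tau> \<in> S" "\<tau> \<notin> bad" for \<tau>
      unfolding a_def a'_def
    proof (rule arg_cong[where f = "\<lambda>n. lam ^ n"], rule touch_mono_upd_eq[symmetric])
      show "\<tau> y \<noteq> \<tau> u \<and> \<tau> y \<noteq> c" if "y \<in> nbrs E u" "y \<in> B" for y
        using that \<open>\<tau> \<in> S\<close> \<open>\<tau> \<notin> bad\<close> Suq[of \<tau>] unfolding bad_def by auto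
    qed (rule u)
    show "\<bar>f (\<tau>(u := c)) - f \<tau>\<bar> \<le> \<Lambda>" if "\<tau> \<in> S" for \<tau>
      using f that u c unfolding lip_def S_def cls_def by blast
    show "\<bar>f \<tau> - f \<sigma>\<bar> \<le> real (card B) * \<Lambda>" if "\<tau> \<in> S" for \<tau>
      using lip_cls[OF f fin B \<sigma>] that unfolding S_def by blast
    show "sum a bad \<le> b * sum a S"
    proof (rule bad_le)
      show "real q ^ k \<le> sum a S" if "nbrs E u \<inter> B \<noteq> {}"
        using touch_sum_ge[OF B _ \<sigma>] nice[OF that] unfolding S_def a_def by auto
      show "sum a {\<tau>\<in>S. \<tau> y = d} \<le> colour_bound D k * real q ^ k"
        if "nbrs E u \<inter> B \<noteq> {}" "y \<in> nbrs E u \<inter> B" "d \<in> {1..q}" for y d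
        using touch_colour_sum_le[OF B _ _ D \<sigma>, of k y d] nice[OF that(1)] that unfolding S_def a_def by auto
    qed (use lam_ge in \<open>auto simp: a_def\<close>)
    show "sum a' bad \<le> b * sum a' S"
    proof (rule bad_le)
      show "real q ^ k \<le> sum a' S" if "nbrs E u \<inter> B \<noteq> {}"
        using touch_sum_ge[OF B _ \<sigma>'] nice[OF that] shift[of "\<lambda>\<tau>. lam ^ touch_mono B \<tau>"]
        unfolding a'_def by auto
      show "sum a' {\<tau>\<in>S. \<tau> y = d} \<le> colour_bound D k * real q ^ k"
        if "nbrs E u \<inter> B \<noteq> {}" "y \<in> nbrs E u \<inter> B" "d \<in> {1..q}" for y d
      proof -
        have "y \<noteq> u" using that u by auto
        then have "sum a' {\<tau>\<in>S. \<tau> y = d} = (\<Sum>\<tau>\<in>{\<tau>\<in>cls B (\<sigma>(u := c)). \<tau> y = d}. lam ^ touch_mono B \<tau>)"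
          unfolding a'_def S_def by (intro sum_cls_shift \<sigma> u c) auto
        then show ?thesis
          using touch_colour_sum_le[OF B _ _ D \<sigma>', of k y d] nice[OF that(1)] that by auto
      qed
    qed (use lam_ge in \<open>auto simp: a'_def\<close>)
  qed (use finS lam_ge in \<open>auto simp: a_def a'_def\<close>)
  moreover have "avg (cls B) f (\<sigma>(u := c)) = (\<Sum>\<tau>\<in>S. a' \<tau> * f (\<tau>(u := c))) / sum a' S"
    unfolding avg_touch[OF \<sigma>'] shift[symmetric] a'_def ..
  moreover have "avg (cls B) f \<sigma> = (\<Sum>\<tau>\<in>S. a \<tau> * f \<tau>) / sum a S"
    unfolding avg_touch[OF \<sigma>] a_def S_def ..
  moreover have "3 * (real (card B) * \<Lambda>) * b = (if nbrs E u \<inter> B = {} then 0 else 6 * real k * real \<Delta> * colour_bound D k * \<Lambda>)"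
    using nice unfolding b_def by auto
  ultimately show ?thesis by simp
qed

text \<open>Path coupling: the block chosen at \<open>u\<close> contains \<open>u\<close> and erases
  the discrepancy, a gain of \<Lambda>. The at most \<open>N\<close> blocks bordering on
  \<open>u\<close> lose at most half of that by \<open>small\<close>, leaving a net gain of
  \<Lambda>/2 among the \<open>card V\<close> blocks.\<close>

lemma block_contraction:
  assumes blk: "\<And>v. v \<in> V \<Longrightarrow> v \<in> B v \<and> B v \<subseteq> V \<and> (B v = V \<or> conn (B v) \<and> card (B v) = k)"
    and few: "\<And>u. u \<in> V \<Longrightarrow> card {v\<in>V. u \<notin> B v \<and> nbrs E u \<inter> B v \<noteq> {}} \<le> N"
    and small: "6 * real k * real \<Delta> * colour_bound D k * real N \<le> 1 / 2"
    and D: "\<Delta> = Suc D" and f: "lip f \<Lambda>"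
  shows "lip (mix_avg V (\<lambda>v. cls (B v)) f) ((1 - 1 / (2 * real (card V))) * \<Lambda>)"
  unfolding lip_def
proof (intro ballI)
  fix \<sigma> u c assume a: "\<sigma> \<in> confs" "u \<in> V" "c \<in> {1..q}"
  let ?n = "real (card V)" and ?x = "6 * real k * real \<Delta> * colour_bound D k * \<Lambda>"
  let ?N = "{v\<in>V. u \<notin> B v \<and> nbrs E u \<inter> B v \<noteq> {}}"
  let ?d = "\<lambda>v. avg (cls (B v)) f (\<sigma>(u := c)) - avg (cls (B v)) f \<sigma>"
  have n: "?n > 0" using finite_V V_nonempty by (simp add: card_gt_0_iff)
  have \<Lambda>: "0 \<le> \<Lambda>" using lip_nonneg[OF f] .
  have cb0: "0 \<le> colour_bound D k"
    unfolding colour_bound_def using lam_ge by (intro divide_nonneg_nonneg add_nonneg_nonneg mult_nonneg_nonneg) auto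
  have x0: "0 \<le> ?x" using \<Lambda> cb0 by simp
  have dv: "\<bar>?d v\<bar> \<le> (if v = u then 0 else \<Lambda>) + (if v \<in> ?N then ?x else 0)" if v: "v \<in> V" for v
  proof (cases "u \<in> B v")
    case True
    then have "\<sigma>(u := c) \<in> cls (B v) \<sigma>" using confs_upd[OF a] unfolding cls_def by auto
    then have "?d v = 0" using avg_cong[of "cls (B v)" \<sigma>] partitions_cls a(1) by simp
    then show ?thesis using \<Lambda> x0 by simp
  next
    case False
    then have vu: "v \<noteq> u" using blk[OF v] by auto
    have "\<bar>?d v\<bar> \<le> \<Lambda> + (if nbrs E u \<inter> B v = {} then 0 else ?x)"
      using blk[OF v] False a f D by (intro block_avg_diff_le) auto
    then show ?thesis using vu False v by (cases "nbrs E u \<inter> B v = {}") simp_all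
  qed
  have "\<bar>\<Sum>v\<in>V. ?d v\<bar> \<le> (\<Sum>v\<in>V. (if v = u then 0 else \<Lambda>) + (if v \<in> ?N then ?x else 0))"
    by (rule order_trans[OF sum_abs sum_mono]) (rule dv)
  also have "\<dots> = (?n - 1) * \<Lambda> + real (card ?N) * ?x"
  proof -
    have "(\<Sum>v\<in>V. if v = u then 0 else \<Lambda>) = (\<Sum>v\<in>V - {u}. \<Lambda>)"
      by (rule sum.mono_neutral_cong_right) (use finite_V in auto)
    also have "\<dots> = (?n - 1) * \<Lambda>" using a(2) n by (simp add: card_Diff_singleton of_nat_diff)
    finally have s1: "(\<Sum>v\<in>V. if v = u then 0 else \<Lambda>) = (?n - 1) * \<Lambda>" .
    have "(\<Sum>v\<in>V. if v \<in> ?N then ?x else 0) = (\<Sum>v\<in>?N. ?x)"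
      by (rule sum.mono_neutral_cong_right) (use finite_V in auto)
    then show ?thesis using s1 by (simp add: sum.distrib)
  qed
  also have "\<dots> \<le> (?n - 1) * \<Lambda> + real N * ?x"
    using few[OF a(2)] x0 by (intro add_left_mono mult_right_mono) auto
  also have "\<dots> \<le> (?n - 1) * \<Lambda> + 1 / 2 * \<Lambda>"
    using mult_right_mono[OF small \<Lambda>] by (simp add: mult_ac)
  also have "\<dots> = ?n * ((1 - 1 / (2 * ?n)) * \<Lambda>)" using n by (simp add: field_simps)
  finally have le: "\<bar>\<Sum>v\<in>V. ?d v\<bar> \<le> ?n * ((1 - 1 / (2 * ?n)) * \<Lambda>)" .
  have eq: "mix_avg V (\<lambda>v. cls (B v)) f (\<sigma>(u := c)) - mix_avg V (\<lambda>v. cls (B v)) f \<sigma> = (\<Sum>v\<in>V. ?d v) / ?n"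
    unfolding mix_avg_def by (simp add: sum_subtractf diff_divide_distrib)
  show "\<bar>mix_avg V (\<lambda>v. cls (B v)) f (\<sigma>(u := c)) - mix_avg V (\<lambda>v. cls (B v)) f \<sigma>\<bar>
      \<le> (1 - 1 / (2 * ?n)) * \<Lambda>"
    unfolding eq abs_divide using le n by (simp only: abs_of_pos pos_divide_le_eq mult.commute[of _ ?n])
qed

lemma glauber_gap:
  assumes conn: "connected_graph V E" and D: "\<Delta> = Suc D" and k: "1 \<le> k"
    and small: "6 * real k * real \<Delta> * colour_bound D k * real (Suc \<Delta> ^ k) \<le> 1 / 2"
    and f: "(\<Sum>\<sigma>\<in>confs. wt \<sigma> * f \<sigma>) = 0"
  shows "(\<Sum>v\<in>V. dirichlet (cls {v}) f)
    \<ge> real (card V) * (1 / (2 * (real (card V))\<^sup>2 * comparison_const k) * ip f f)"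
proof -
  \<comment> \<open>Graphs with fewer than \<open>k\<close> vertices get the block \<open>V\<close>.
    It contains every \<open>u\<close>, so no boundary estimate is ever asked of it.\<close>
  have "\<exists>B. v \<in> B \<and> B \<subseteq> V \<and> (B = V \<or> conn B \<and> card B = k) \<and> card B \<le> k \<and> (B = V \<or> B \<subseteq> gball (k - 1) v)"
    if v: "v \<in> V" for v
  proof (cases "k \<le> card V")
    case True
    then show ?thesis using exists_conn_block[OF conn v, of "k - 1"] k by fastforce
  next
    case False
    then show ?thesis using v by (intro exI[of _ V]) auto
  qed
  then obtain B where B: "\<And>v. v \<in> V \<Longrightarrow> v \<in> B v \<and> B v \<subseteq> V \<and> (B v = V \<or> conn (B v) \<and> card (B v) = k)
      \<and> card (B v) \<le> k \<and> (B v = V \<or> B v \<subseteq> gball (k - 1) v)" by metis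
  have few: "card {v\<in>V. u \<notin> B v \<and> nbrs E u \<inter> B v \<noteq> {}} \<le> Suc \<Delta> ^ k" if u: "u \<in> V" for u
  proof -
    \<comment> \<open>A block bordering on \<open>u\<close> has its centre within distance
      \<open>k - 1\<close> of a neighbour of \<open>u\<close>.\<close>
    have "{v\<in>V. u \<notin> B v \<and> nbrs E u \<inter> B v \<noteq> {}} \<subseteq> gball k u"
    proof
      fix v assume "v \<in> {v\<in>V. u \<notin> B v \<and> nbrs E u \<inter> B v \<noteq> {}}"
      then obtain y where v: "v \<in> V" "u \<notin> B v" "y \<in> nbrs E u" "y \<in> B v" by blast
      then have "B v \<noteq> V" using u by auto
      then have "y \<in> gball (k - 1) v" using B[OF v(1)] v by blast
      moreover have "u \<in> nbrs E y" using v mem_nbrs_commute by blast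
      ultimately have "u \<in> gball (Suc (k - 1)) v" unfolding gball_Suc by blast
      then show "v \<in> gball k u" using k gball_sym by simp
    qed
    then have "card {v\<in>V. u \<notin> B v \<and> nbrs E u \<inter> B v \<noteq> {}} \<le> card (gball k u)"
      by (rule card_mono[OF finite_subset[OF gball_subset[OF u] finite_V]])
    then show ?thesis using card_gball_le[OF u, of k] by linarith
  qed
  let ?n = "real (card V)"
  have n: "?n \<ge> 1" using finite_V V_nonempty by (simp add: Suc_le_eq card_gt_0_iff)
  obtain \<Lambda> where \<Lambda>: "lip f \<Lambda>" using lip_exists by blast
  have "(\<Sum>v\<in>V. dirichlet (cls (B v)) f) \<ge> ?n * (1 / (2 * ?n) * ip f f)"
  proof (rule sum_dirichlet_ge_of_contraction[where N = lip and S = ?n])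
    show "lip (mix_avg V (\<lambda>i. cls (B i)) f) ((1 - 1 / (2 * ?n)) * x)" if "lip f x" for f x
      by (rule block_contraction[OF _ few small D that]) (use B in auto)
  qed (use partitions_cls finite_V V_nonempty lip_sup_le \<Lambda> f n in auto)
  from glauber_gap_of_blocks[OF _ this, of k] B
  have "(\<Sum>v\<in>V. dirichlet (cls {v}) f) \<ge> ?n * ((1 / (2 * ?n)) / (?n * comparison_const k) * ip f f)" by blast
  then show ?thesis by (simp add: power2_eq_square mult.assoc)
qed

end

section \<open>Rapid mixing\<close>

context potts
begin

lemma mix_time_eps_le:
  assumes "\<And>\<sigma>. \<sigma> \<in> confs \<Longrightarrow> tv_dist V E lam q T \<sigma> \<le> \<epsilon>"
  shows "mix_time_eps V E lam q \<epsilon> \<le> T"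
  unfolding mix_time_eps_def
  by (subst Max_le_iff)
     (use finite_confs confs_nonempty assms in \<open>auto simp: mix_time_from_def intro: Least_le\<close>)

lemma card_touch_le: "A \<subseteq> V \<Longrightarrow> card {e\<in>E. e \<inter> A \<noteq> {}} \<le> \<Delta> * card A"
proof -
  assume A: "A \<subseteq> V"
  have "finite A" using A finite_V finite_subset by blast
  then show ?thesis using A
  proof (induction A rule: finite_induct)
    case (insert x A)
    have "card {y\<in>nbrs E x - A. True} \<le> card (nbrs E x)" by (rule card_mono[OF finite_nbrs]) auto
    also have "\<dots> \<le> \<Delta>" using degree_le[of x] insert unfolding degree_def by auto
    finally show ?case using card_touch_insert[OF insert(2), of "\<lambda>_. True"] insert by simp
  qed simp
qed

lemma partition_fn_le: "partition_fn V E lam q \<le> (real q * lam ^ \<Delta>) ^ card V"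
proof -
  have "mono_edges E \<sigma> \<le> \<Delta> * card V" for \<sigma>
  proof -
    have "mono_edges E \<sigma> \<le> card {e\<in>E. e \<inter> V \<noteq> {}}"
      unfolding mono_edges_eq by (rule card_mono) (auto simp: finite_E elim: edgeE)
    then show ?thesis using card_touch_le[of V] by simp
  qed
  then have "partition_fn V E lam q \<le> (\<Sum>\<sigma>\<in>confs. lam ^ (\<Delta> * card V))"
    unfolding partition_fn_def using lam_ge by (intro sum_mono power_increasing) auto
  also have "\<dots> = (real q * lam ^ \<Delta>) ^ card V"
    using finite_V by (simp add: configs_def card_PiE power_mult_distrib power_mult)
  finally show ?thesis .
qed

text \<open>The partition function is only exponential in \<open>card V\<close>, so its logarithm is
  linear. The absolute value covers both signs of the logarithm of
  \<open>4 * \<epsilon>\<^sup>2\<close>.\<close>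

lemma tv_dist_le_of_gap:
  assumes gap: "\<And>f. (\<Sum>\<sigma>\<in>confs. wt \<sigma> * f \<sigma>) = 0 \<Longrightarrow>
        (\<Sum>v\<in>V. dirichlet (cls {v}) f) \<ge> real (card V) * (\<gamma> * ip f f)"
    and \<gamma>: "\<gamma> \<le> 1" and \<sigma>: "\<sigma> \<in> confs" and \<epsilon>: "0 < \<epsilon>"
    and T: "real (card V) * ln (real q * lam ^ \<Delta>) + \<bar>ln (4 * \<epsilon>\<^sup>2)\<bar> \<le> \<gamma> * real T"
  shows "tv_dist V E lam q T \<sigma> \<le> \<epsilon>"
proof -
  let ?Z = "partition_fn V E lam q"
  have q: "0 < real q * lam ^ \<Delta>" using q_pos lam_ge by simp
  have "(1 - \<gamma>) ^ T \<le> exp (- \<gamma>) ^ T"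
    using \<gamma> exp_ge_add_one_self[of "- \<gamma>"] by (intro power_mono) auto
  also have "\<dots> = exp (- (\<gamma> * real T))" by (simp add: mult.commute flip: exp_of_nat_mult)
  finally have e: "(1 - \<gamma>) ^ T \<le> exp (- (\<gamma> * real T))" .
  have "(2 * tv_dist V E lam q T \<sigma>)\<^sup>2 \<le> (1 - \<gamma>) ^ T * ?Z"
    by (rule tv_dist_sq_le[OF gap \<gamma> \<sigma>])
  also have "\<dots> \<le> exp (- (\<gamma> * real T)) * (real q * lam ^ \<Delta>) ^ card V"
    using e partition_fn_le partition_fn_pos by (intro mult_mono) auto
  also have "(real q * lam ^ \<Delta>) ^ card V = exp (real (card V) * ln (real q * lam ^ \<Delta>))"
    using q by (simp only: exp_of_nat_mult exp_ln)
  also have "exp (- (\<gamma> * real T)) * \<dots> = exp (real (card V) * ln (real q * lam ^ \<Delta>) - \<gamma> * real T)"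
    by (simp add: exp_diff exp_minus field_simps)
  also have "\<dots> \<le> exp (ln (4 * \<epsilon>\<^sup>2))" using T by (subst exp_le_cancel_iff) linarith
  also have "\<dots> = (2 * \<epsilon>)\<^sup>2" using \<epsilon> by (simp add: power_mult_distrib)
  finally have "2 * tv_dist V E lam q T \<sigma> \<le> 2 * \<epsilon>" by (rule power2_le_imp_le) (use \<epsilon> in simp)
  then show ?thesis by simp
qed

lemma colour_bound_le:
  assumes c: "1 \<le> c" and q: "c * lam powr (real D + \<eta>) \<le> real q" and \<eta>: "0 < \<eta>"
    and k: "1 \<le> real k * \<eta>" "1 \<le> k"
  shows "colour_bound D k \<le> (real k * real (Suc \<Delta>) ^ k + 1) / c"
proof -
  have l: "lam ^ D \<le> lam powr (real D + \<eta>)"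
    using lam_ge \<eta> by (subst powr_realpow[symmetric]) (auto intro: powr_mono)
  have qc: "lam powr (real D + \<eta>) \<le> real q / c" using q c by (simp add: field_simps)
  have q1: "1 \<le> real q" using q_pos by simp
  have lq: "lam ^ D \<le> real q / c" using l qc by linarith
  have lq': "lam ^ D \<le> real q" using lq c q1 by (smt (verit) divide_le_eq mult_le_cancel_left1)
  have l1: "1 \<le> lam ^ D" using lam_ge by (rule one_le_power)
  have f1: "1 + real \<Delta> * lam ^ D \<le> real (Suc \<Delta>) * (real q / c)"
  proof -
    have "1 + real \<Delta> * lam ^ D \<le> real (Suc \<Delta>) * lam ^ D" using l1 by (simp add: algebra_simps)
    also have "\<dots> \<le> real (Suc \<Delta>) * (real q / c)" using lq by (intro mult_left_mono) auto
    finally show ?thesis .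
  qed
  have f2: "real q + real \<Delta> * lam ^ D \<le> real (Suc \<Delta>) * real q"
    using mult_left_mono[OF lq', of "real \<Delta>"] by (simp add: algebra_simps)
  have "real k * ((1 + real \<Delta> * lam ^ D) * (real q + real \<Delta> * lam ^ D) ^ (k - 1))
      \<le> real k * ((real (Suc \<Delta>) * (real q / c)) * (real (Suc \<Delta>) * real q) ^ (k - 1))"
    using f1 f2 l1 c by (intro mult_left_mono mult_mono power_mono) auto
  also have "\<dots> = real k * real (Suc \<Delta>) ^ k / c * real q ^ k"
    using k(2) by (cases k) (auto simp: power_mult_distrib)
  finally have s1: "real k * ((1 + real \<Delta> * lam ^ D) * (real q + real \<Delta> * lam ^ D) ^ (k - 1))
      \<le> real k * real (Suc \<Delta>) ^ k / c * real q ^ k" .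
  have "lam ^ (D * k + 1) = lam powr (real (D * k + 1))"
    using lam_ge by (subst powr_realpow) auto
  \<comment> \<open>Here \<open>k * \<eta> \<ge> 1\<close> pays for the one surplus edge of the
    monochromatic block.\<close>
  also have "\<dots> \<le> lam powr ((real D + \<eta>) * real k)"
    using k lam_ge by (intro powr_mono) (auto simp: algebra_simps)
  also have "\<dots> = (lam powr (real D + \<eta>)) ^ k"
    using lam_ge by (simp add: powr_powr[symmetric] powr_realpow)
  also have "\<dots> \<le> (real q / c) ^ k" using qc by (intro power_mono) auto
  also have "\<dots> \<le> 1 / c * real q ^ k"
  proof -
    have "c \<le> c ^ k" using c k(2) by (simp add: self_le_power)
    then have "1 / c ^ k \<le> 1 / c" using c by (simp add: field_simps)
    from mult_right_mono[OF this, of "real q ^ k"] show ?thesis by (simp add: power_divide)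
  qed
  finally have s2: "lam ^ (D * k + 1) \<le> 1 / c * real q ^ k" .
  have "colour_bound D k \<le> ((real k * real (Suc \<Delta>) ^ k / c + 1 / c) * real q ^ k) / real q ^ k"
    unfolding colour_bound_def using s1 s2 q1 by (intro divide_right_mono) (auto simp: algebra_simps)
  also have "\<dots> = (real k * real (Suc \<Delta>) ^ k + 1) / c"
    using q1 by (simp add: add_divide_distrib)
  finally show ?thesis .
qed

end

theorem rapid_mixing:
  fixes \<Delta> :: nat and \<eta> :: real
  assumes \<Delta>: "\<Delta> \<ge> 2" and \<eta>: "0 < \<eta>"
  shows "\<exists>c1>0. \<forall>(q::nat) lam::real. q \<ge> 2 \<longrightarrow> lam > 1 \<longrightarrow> real q > c1 * lam powr (real \<Delta> - 1 + \<eta>) \<longrightarrow>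
    mixes_rapidly_on (\<lambda>V E. simple_graph V E \<and> connected_graph V E \<and> max_degree_eq V E \<Delta>) lam q"
proof -
  obtain D where D: "\<Delta> = Suc D" using \<Delta> by (cases \<Delta>) auto
  define k where "k = nat \<lceil>1 / \<eta>\<rceil>"
  have k: "1 \<le> real k * \<eta>" "1 \<le> k"
  proof -
    have "1 / \<eta> \<le> real k" unfolding k_def by linarith
    then show "1 \<le> real k * \<eta>" using \<eta> by (simp add: field_simps)
    then show "1 \<le> k" using \<eta> by (cases k) auto
  qed
  define m where "m = real k * real (Suc \<Delta>) ^ k + 1"
  \<comment> \<open>Since 12 is twice 6, dividing by \<open>c1\<close> brings the expression in
    \<open>small\<close> below 1/2; the added 1 ensures \<open>c1 \<ge> 1\<close>.\<close>
  define c1 where "c1 = 12 * real k * real \<Delta> * m * real (Suc \<Delta> ^ k) + 1"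
  have m: "1 \<le> m" unfolding m_def by simp
  have c1: "1 \<le> c1" unfolding c1_def using m by simp
  show ?thesis
  proof (intro exI[of _ c1] conjI allI impI)
    show "c1 > 0" using c1 by simp
    fix q :: nat and lam :: real
    assume q: "q \<ge> 2" and lam: "lam > 1" and big: "real q > c1 * lam powr (real \<Delta> - 1 + \<eta>)"
    show "mixes_rapidly_on (\<lambda>V E. simple_graph V E \<and> connected_graph V E \<and> max_degree_eq V E \<Delta>) lam q"
      unfolding mixes_rapidly_on_def
    proof (intro allI impI)
      fix \<epsilon> :: real assume \<epsilon>: "\<epsilon> > 0"
      \<comment> \<open>Everything in the polynomial is fixed before the graph is.\<close>
      define K where "K = potts.comparison_const lam q \<Delta> k"
      define L where "L = ln (real q * lam ^ \<Delta>)"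
      define l where "l = \<bar>ln (4 * \<epsilon>\<^sup>2)\<bar>"
      \<comment> \<open>This is \<open>(n * L + l) / \<gamma> + 1\<close> with
        \<open>1 / \<gamma> = 2 * n\<^sup>2 * K\<close>; the 1 accounts for rounding
        \<open>T\<close> up.\<close>
      define p :: "real poly" where "p = [:1, 0, 2 * K * l, 2 * K * L:]"
      show "\<exists>p::real poly. \<forall>V E. simple_graph V E \<and> connected_graph V E \<and> max_degree_eq V E \<Delta> \<longrightarrow>
          real (mix_time_eps V E lam q \<epsilon>) \<le> poly p (real (card V))"
      proof (intro exI[of _ p] allI impI)
        fix V :: "nat set" and E :: "nat set set"
        assume G: "simple_graph V E \<and> connected_graph V E \<and> max_degree_eq V E \<Delta>"
        interpret potts V E lam q \<Delta>
          using G q lam by unfold_locales (auto simp: connected_graph_def max_degree_eq_def)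
        let ?n = "real (card V)"
        have n: "?n \<ge> 1" using finite_V V_nonempty by (simp add: Suc_le_eq card_gt_0_iff)
        have K: "1 \<le> K" unfolding K_def by (rule comparison_const_ge_1)
        have "colour_bound D k \<le> m / c1"
          unfolding m_def using c1 big \<eta> k D by (intro colour_bound_le[where \<eta> = \<eta>]) auto
        then have "6 * real k * real \<Delta> * colour_bound D k * real (Suc \<Delta> ^ k)
            \<le> 6 * real k * real \<Delta> * (m / c1) * real (Suc \<Delta> ^ k)"
          by (intro mult_left_mono mult_right_mono) auto
        also have "\<dots> \<le> 1 / 2" using c1 unfolding c1_def by (simp add: field_simps)
        finally have small: "6 * real k * real \<Delta> * colour_bound D k * real (Suc \<Delta> ^ k) \<le> 1 / 2" .
        define \<gamma> where "\<gamma> = 1 / (2 * ?n\<^sup>2 * K)"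
        have nK: "1 \<le> ?n\<^sup>2 * K" using mult_mono[of 1 "?n\<^sup>2" 1 K] n K by simp
        have \<gamma>: "0 < \<gamma>" "\<gamma> \<le> 1" unfolding \<gamma>_def using nK by (auto simp: mult.assoc)
        have gap: "(\<Sum>v\<in>V. dirichlet (cls {v}) f) \<ge> ?n * (\<gamma> * ip f f)"
          if "(\<Sum>\<sigma>\<in>confs. wt \<sigma> * f \<sigma>) = 0" for f
          using glauber_gap[OF _ D k(2) small that] G unfolding \<gamma>_def K_def by blast
        define T where "T = nat \<lceil>(?n * L + l) / \<gamma>\<rceil>"
        have L: "0 \<le> L" unfolding L_def
        proof (rule ln_ge_zero)
          show "1 \<le> real q * lam ^ \<Delta>"
            using mult_mono[of 1 "real q" 1 "lam ^ \<Delta>"] q lam by (simp add: one_le_power)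
        qed
        have l: "0 \<le> l" unfolding l_def by simp
        have "(?n * L + l) / \<gamma> \<le> real T" unfolding T_def by linarith
        then have T: "?n * L + l \<le> \<gamma> * real T" using \<gamma> by (simp add: pos_divide_le_eq mult.commute)
        have "mix_time_eps V E lam q \<epsilon> \<le> T"
          by (rule mix_time_eps_le, rule tv_dist_le_of_gap[OF gap \<gamma>(2)])
            (use T \<epsilon> in \<open>auto simp: L_def l_def\<close>)
        then have "real (mix_time_eps V E lam q \<epsilon>) \<le> real T" by simp
        also have "\<dots> \<le> (?n * L + l) / \<gamma> + 1"
        proof -
          have "0 \<le> (?n * L + l) / \<gamma>" using L l \<gamma> by simp
          then show ?thesis unfolding T_def by linarith
        qed
        also have "\<dots> = poly p ?n"
          unfolding p_def \<gamma>_def by (simp add: algebra_simps power2_eq_square)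
        finally show "real (mix_time_eps V E lam q \<epsilon>) \<le> poly p ?n" .
      qed
    qed
  qed
qed

section \<open>Bottlenecks\<close>

context potts
begin

abbreviation "gl \<equiv> glauber V E lam q"
abbreviation "glp \<equiv> glauber_pow V E lam q"

lemma glauber_nonneg: "0 \<le> gl \<sigma> \<tau>"
  unfolding glauber_def using lam_ge
  by (intro mult_nonneg_nonneg sum_nonneg) (auto intro!: divide_nonneg_nonneg sum_nonneg)

lemma sum_glauber_1: "\<sigma> \<in> confs \<Longrightarrow> (\<Sum>\<tau>\<in>confs. gl \<sigma> \<tau>) = 1"
  using sum_glauber[of \<sigma> "\<lambda>_. 1"] mix_avg_const[of V "\<lambda>v. cls {v}" \<sigma> 1] partitions_cls finite_V V_nonempty
  by simp

lemma glauber_stationary: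
  assumes "\<tau> \<in> confs"
  shows "(\<Sum>\<rho>\<in>confs. wt \<rho> * gl \<rho> \<tau>) = wt \<tau>"
proof -
  let ?g = "\<lambda>\<tau>'. if \<tau>' = \<tau> then 1 else 0 :: real"
  have "gl \<rho> \<tau> = mix_avg V (\<lambda>v. cls {v}) ?g \<rho>" if "\<rho> \<in> confs" for \<rho>
  proof -
    have "gl \<rho> \<tau> = (\<Sum>\<tau>'\<in>confs. gl \<rho> \<tau>' * ?g \<tau>')"
      using assms finite_confs by (simp add: if_distrib cong: if_cong)
    then show ?thesis using sum_glauber[OF that, of ?g] by simp
  qed
  then have "(\<Sum>\<rho>\<in>confs. wt \<rho> * gl \<rho> \<tau>) = (\<Sum>\<rho>\<in>confs. wt \<rho> * mix_avg V (\<lambda>v. cls {v}) ?g \<rho>)"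
    by simp
  also have "\<dots> = (\<Sum>\<rho>\<in>confs. wt \<rho> * ?g \<rho>)"
    by (rule sum_weight_mix_avg) (auto simp: partitions_cls finite_V V_nonempty)
  finally show ?thesis using assms finite_confs by (simp add: if_distrib cong: if_cong)
qed

lemma glauber_pow_nonneg: "0 \<le> glp t \<sigma> \<tau>"
  by (induction t arbitrary: \<tau>) (auto intro!: sum_nonneg mult_nonneg_nonneg glauber_nonneg)

lemma glauber_pow_stationary:
  assumes "\<tau> \<in> confs"
  shows "(\<Sum>\<sigma>\<in>confs. wt \<sigma> * glp t \<sigma> \<tau>) = wt \<tau>"
  using assms
proof (induction t arbitrary: \<tau>)
  case 0
  then show ?case using finite_confs by (simp add: if_distrib cong: if_cong)
next
  case (Suc t)
  have "(\<Sum>\<sigma>\<in>confs. wt \<sigma> * glp (Suc t) \<sigma> \<tau>) = (\<Sum>\<rho>\<in>confs. (\<Sum>\<sigma>\<in>confs. wt \<sigma> * glp t \<sigma> \<rho>) * gl \<rho> \<tau>)"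
    by (simp add: sum_distrib_left sum_distrib_right mult.assoc) (rule sum.swap)
  also have "\<dots> = wt \<tau>" using Suc by (simp add: glauber_stationary)
  finally show ?case .
qed

text \<open>The error at the next time is the present error pushed through a stochastic matrix that
  fixes \<open>gibbs\<close>, which cannot increase the absolute sum.\<close>

lemma tv_dist_Suc_le: "tv_dist V E lam q (Suc t) \<sigma> \<le> tv_dist V E lam q t \<sigma>"
proof -
  let ?\<pi> = "gibbs V E lam q"
  have \<pi>: "?\<pi> \<tau> = wt \<tau> / partition_fn V E lam q" for \<tau> unfolding gibbs_def wt_def ..
  have eq: "glp (Suc t) \<sigma> \<tau> - ?\<pi> \<tau> = (\<Sum>\<rho>\<in>confs. (glp t \<sigma> \<rho> - ?\<pi> \<rho>) * gl \<rho> \<tau>)" if "\<tau> \<in> confs" for \<tau>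
  proof -
    have "?\<pi> \<tau> = (\<Sum>\<rho>\<in>confs. ?\<pi> \<rho> * gl \<rho> \<tau>)"
      unfolding \<pi> using glauber_stationary[OF that] by (simp flip: sum_divide_distrib)
    then show ?thesis by (simp add: left_diff_distrib sum_subtractf)
  qed
  have "(\<Sum>\<tau>\<in>confs. \<bar>glp (Suc t) \<sigma> \<tau> - ?\<pi> \<tau>\<bar>) \<le> (\<Sum>\<tau>\<in>confs. \<Sum>\<rho>\<in>confs. \<bar>glp t \<sigma> \<rho> - ?\<pi> \<rho>\<bar> * gl \<rho> \<tau>)"
  proof (rule sum_mono)
    fix \<tau> assume "\<tau> \<in> confs"
    then show "\<bar>glp (Suc t) \<sigma> \<tau> - ?\<pi> \<tau>\<bar> \<le> (\<Sum>\<rho>\<in>confs. \<bar>glp t \<sigma> \<rho> - ?\<pi> \<rho>\<bar> * gl \<rho> \<tau>)"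
      using eq sum_abs[of "\<lambda>\<rho>. (glp t \<sigma> \<rho> - ?\<pi> \<rho>) * gl \<rho> \<tau>" confs] glauber_nonneg by (simp add: abs_mult)
  qed
  also have "\<dots> = (\<Sum>\<rho>\<in>confs. \<bar>glp t \<sigma> \<rho> - ?\<pi> \<rho>\<bar> * (\<Sum>\<tau>\<in>confs. gl \<rho> \<tau>))"
    by (subst sum.swap) (simp add: sum_distrib_left)
  also have "\<dots> = (\<Sum>\<rho>\<in>confs. \<bar>glp t \<sigma> \<rho> - ?\<pi> \<rho>\<bar>)" by (simp add: sum_glauber_1)
  finally show ?thesis unfolding tv_dist_def by simp
qed

lemma tv_dist_antimono: "s \<le> t \<Longrightarrow> tv_dist V E lam q t \<sigma> \<le> tv_dist V E lam q s \<sigma>"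
  by (induction rule: dec_induct) (auto intro: order_trans[OF tv_dist_Suc_le])

text \<open>Without convergence the \<open>LEAST\<close> in \<open>mix_time_from\<close> would carry
  no information. The single block \<open>V\<close> has gap 1, and the comparison yields a gap that
  is tiny, since the block size is \<open>card V\<close>, but positive.\<close>

lemma exists_tv_dist_le:
  assumes "\<sigma> \<in> confs" "0 < \<epsilon>"
  shows "\<exists>t. tv_dist V E lam q t \<sigma> \<le> \<epsilon>"
proof -
  let ?n = "real (card V)"
  have n: "?n \<ge> 1" using finite_V V_nonempty by (simp add: Suc_le_eq card_gt_0_iff)
  define \<gamma> where "\<gamma> = 1 / (?n * comparison_const (card V))"
  have "1 \<le> ?n * comparison_const (card V)"
    using mult_mono[of 1 ?n 1 "comparison_const (card V)"] n comparison_const_ge_1 by simp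
  then have \<gamma>: "0 < \<gamma>" "\<gamma> \<le> 1" unfolding \<gamma>_def by (auto simp: divide_le_eq_1)
  have gap: "(\<Sum>v\<in>V. dirichlet (cls {v}) f) \<ge> ?n * (\<gamma> * ip f f)"
    if f: "(\<Sum>\<sigma>\<in>confs. wt \<sigma> * f \<sigma>) = 0" for f
    unfolding \<gamma>_def
  proof (rule glauber_gap_of_blocks[where B = "\<lambda>_. V"])
    have "avg (cls V) f \<sigma> = 0" if "\<sigma> \<in> confs" for \<sigma>
      unfolding avg_def using cls_V[OF that] f by simp
    then have "ip f (avg (cls V) f) = 0" unfolding ip_def by simp
    then show "?n * (1 * ip f f) \<le> (\<Sum>v\<in>V. dirichlet (cls V) f)" unfolding dirichlet_def by simp
  qed auto
  obtain T :: nat where "(?n * ln (real q * lam ^ \<Delta>) + \<bar>ln (4 * \<epsilon>\<^sup>2)\<bar>) / \<gamma> \<le> real T"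
    using real_arch_simple by blast
  then have "?n * ln (real q * lam ^ \<Delta>) + \<bar>ln (4 * \<epsilon>\<^sup>2)\<bar> \<le> \<gamma> * real T"
    using \<gamma> by (simp add: pos_divide_le_eq mult.commute)
  then show ?thesis using tv_dist_le_of_gap[OF gap \<gamma>(2) assms] by blast
qed

lemma tv_dist_mix_time_le:
  assumes "\<sigma> \<in> confs"
  shows "tv_dist V E lam q (mix_time V E lam q) \<sigma> \<le> 1 / (2 * exp 1)"
proof -
  let ?\<epsilon> = "1 / (2 * exp 1) :: real"
  have "tv_dist V E lam q (mix_time_from V E lam q ?\<epsilon> \<sigma>) \<sigma> \<le> ?\<epsilon>"
    unfolding mix_time_from_def by (rule LeastI_ex) (rule exists_tv_dist_le[OF assms], simp)
  moreover have "mix_time_from V E lam q ?\<epsilon> \<sigma> \<le> mix_time V E lam q"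
    unfolding mix_time_def mix_time_eps_def using assms finite_confs by (intro Max_ge) auto
  ultimately show ?thesis using tv_dist_antimono order_trans by blast
qed

text \<open>Start from \<open>wt\<close> restricted to \<open>A\<close>. At every time the mass at a
  state is at most its stationary weight, and only \<open>bd\<close> leads out of \<open>A\<close>,
  so each step releases at most \<open>sum wt bd\<close>.\<close>

lemma bottleneck_flow_le:
  assumes A: "A \<subseteq> confs" and bd: "bd \<subseteq> A"
    and exit: "\<And>\<rho> \<tau>. \<rho> \<in> A - bd \<Longrightarrow> \<tau> \<in> confs - A \<Longrightarrow> gl \<rho> \<tau> = 0"
  shows "(\<Sum>\<sigma>\<in>A. \<Sum>\<tau>\<in>confs - A. wt \<sigma> * glp t \<sigma> \<tau>) \<le> real t * sum wt bd"
proof (induction t)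
  case 0
  have "(\<Sum>\<sigma>\<in>A. \<Sum>\<tau>\<in>confs - A. wt \<sigma> * glp 0 \<sigma> \<tau>) = 0"
    by (intro sum.neutral ballI) auto
  then show ?case by simp
next
  case (Suc t)
  define X where "X \<rho> = (\<Sum>\<sigma>\<in>A. wt \<sigma> * glp t \<sigma> \<rho>)" for \<rho>
  define Y where "Y \<rho> = (\<Sum>\<tau>\<in>confs - A. gl \<rho> \<tau>)" for \<rho>
  have finA: "finite A" using A finite_confs finite_subset by blast
  have w0: "0 \<le> wt \<sigma>" for \<sigma> using wt_ge_1[of \<sigma>] by simp
  have X0: "0 \<le> X \<rho>" for \<rho> unfolding X_def by (intro sum_nonneg mult_nonneg_nonneg w0 glauber_pow_nonneg)
  have Xw: "X \<rho> \<le> wt \<rho>" if "\<rho> \<in> confs" for \<rho>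
    unfolding X_def glauber_pow_stationary[OF that, of t, symmetric]
    by (intro sum_mono2 finite_confs A mult_nonneg_nonneg w0 glauber_pow_nonneg)
  have Y0: "0 \<le> Y \<rho>" for \<rho> unfolding Y_def by (intro sum_nonneg glauber_nonneg)
  have Y1: "Y \<rho> \<le> 1" if "\<rho> \<in> confs" for \<rho>
    unfolding Y_def sum_glauber_1[OF that, symmetric]
    by (intro sum_mono2 finite_confs glauber_nonneg) auto
  have "(\<Sum>\<sigma>\<in>A. \<Sum>\<tau>\<in>confs - A. wt \<sigma> * glp (Suc t) \<sigma> \<tau>)
      = (\<Sum>\<sigma>\<in>A. \<Sum>\<tau>\<in>confs - A. \<Sum>\<rho>\<in>confs. wt \<sigma> * glp t \<sigma> \<rho> * gl \<rho> \<tau>)"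
    by (simp add: sum_distrib_left mult.assoc)
  also have "\<dots> = (\<Sum>\<sigma>\<in>A. \<Sum>\<rho>\<in>confs. \<Sum>\<tau>\<in>confs - A. wt \<sigma> * glp t \<sigma> \<rho> * gl \<rho> \<tau>)"
    by (intro sum.cong refl sum.swap)
  also have "\<dots> = (\<Sum>\<rho>\<in>confs. \<Sum>\<sigma>\<in>A. \<Sum>\<tau>\<in>confs - A. wt \<sigma> * glp t \<sigma> \<rho> * gl \<rho> \<tau>)"
    by (rule sum.swap)
  also have "\<dots> = (\<Sum>\<rho>\<in>confs. X \<rho> * Y \<rho>)"
    unfolding X_def Y_def by (simp add: sum_product)
  \<comment> \<open>Mass arriving outside \<open>A\<close> either crosses from \<open>bd\<close> now
    or was outside before.\<close>
  also have "\<dots> \<le> (\<Sum>\<rho>\<in>confs. (if \<rho> \<in> bd then wt \<rho> else 0) + (if \<rho> \<in> confs - A then X \<rho> else 0))"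
  proof (rule sum_mono)
    fix \<rho> assume \<rho>: "\<rho> \<in> confs"
    have XY: "X \<rho> * Y \<rho> \<le> X \<rho>" using mult_left_mono[OF Y1[OF \<rho>] X0] by simp
    consider "\<rho> \<in> bd" | "\<rho> \<in> A - bd" | "\<rho> \<in> confs - A" using \<rho> by blast
    then show "X \<rho> * Y \<rho> \<le> (if \<rho> \<in> bd then wt \<rho> else 0) + (if \<rho> \<in> confs - A then X \<rho> else 0)"
    proof cases
      case 1
      then show ?thesis using XY Xw[OF \<rho>] bd by auto
    next
      case 2
      then have "Y \<rho> = 0" unfolding Y_def using exit by (intro sum.neutral) auto
      then show ?thesis using 2 by simp
    next
      case 3
      then show ?thesis using XY bd by auto
    qed
  qed
  also have "\<dots> = sum wt bd + (\<Sum>\<rho>\<in>confs - A. X \<rho>)"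
  proof -
    have "(\<Sum>\<rho>\<in>confs. if \<rho> \<in> bd then wt \<rho> else 0) = sum wt bd"
      using A bd finite_confs by (intro sum.mono_neutral_cong_right) auto
    moreover have "(\<Sum>\<rho>\<in>confs. if \<rho> \<in> confs - A then X \<rho> else 0) = (\<Sum>\<rho>\<in>confs - A. X \<rho>)"
      using finite_confs by (intro sum.mono_neutral_cong_right) auto
    ultimately show ?thesis by (simp add: sum.distrib)
  qed
  also have "(\<Sum>\<rho>\<in>confs - A. X \<rho>) = (\<Sum>\<sigma>\<in>A. \<Sum>\<tau>\<in>confs - A. wt \<sigma> * glp t \<sigma> \<tau>)"
    unfolding X_def by (rule sum.swap)
  finally show ?case using Suc by (simp add: algebra_simps)
qed

text \<open>At the mixing time, from every start in \<open>A\<close>, the chance to be outside is at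
  least 1/2 - 1/e, which exceeds 1/10. Averaging over starts in \<open>A\<close> and comparing with
  the flow bound gives the factor 10.\<close>

lemma bottleneck_mix_time:
  assumes A: "A \<subseteq> confs" and bd: "bd \<subseteq> A"
    and exit: "\<And>\<rho> \<tau>. \<rho> \<in> A - bd \<Longrightarrow> \<tau> \<in> confs - A \<Longrightarrow> gl \<rho> \<tau> = 0"
    and half: "2 * sum wt A \<le> sum wt confs"
  shows "sum wt A \<le> 10 * real (mix_time V E lam q) * sum wt bd"
proof -
  let ?T = "mix_time V E lam q" and ?\<pi> = "gibbs V E lam q" and ?Z = "partition_fn V E lam q"
  have \<pi>: "?\<pi> \<tau> = wt \<tau> / ?Z" for \<tau> unfolding gibbs_def wt_def ..
  have w0: "0 \<le> wt \<sigma>" for \<sigma> using wt_ge_1[of \<sigma>] by simp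
  \<comment> \<open>From e at least 1 + 1 + 1/2.\<close>
  have e: "1 / exp 1 \<le> (2 / 5 :: real)"
    using exp_lower_Taylor_quadratic[of "1::real"] by (simp add: field_simps)
  have "sum ?\<pi> (confs - A) \<ge> 1 / 2"
  proof -
    have "sum wt (confs - A) = ?Z - sum wt A"
      unfolding partition_fn_eq by (rule sum_diff[OF finite_confs A])
    also have "\<dots> \<ge> ?Z / 2" using half unfolding partition_fn_eq by simp
    finally show ?thesis unfolding \<pi> sum_divide_distrib[symmetric] using partition_fn_pos by (simp add: field_simps)
  qed
  have low: "1 / 10 \<le> (\<Sum>\<tau>\<in>confs - A. glp ?T \<sigma> \<tau>)" if \<sigma>: "\<sigma> \<in> A" for \<sigma>
  proof -
    have "sum ?\<pi> (confs - A) - (\<Sum>\<tau>\<in>confs - A. glp ?T \<sigma> \<tau>) \<le> (\<Sum>\<tau>\<in>confs - A. \<bar>glp ?T \<sigma> \<tau> - ?\<pi> \<tau>\<bar>)"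
      unfolding sum_subtractf[symmetric] by (rule sum_mono) auto
    also have "\<dots> \<le> (\<Sum>\<tau>\<in>confs. \<bar>glp ?T \<sigma> \<tau> - ?\<pi> \<tau>\<bar>)"
      by (intro sum_mono2 finite_confs) auto
    also have "\<dots> = 2 * tv_dist V E lam q ?T \<sigma>" unfolding tv_dist_def by simp
    also have "\<dots> \<le> 1 / exp 1" using tv_dist_mix_time_le[of \<sigma>] \<sigma> A by (auto simp: field_simps)
    finally show ?thesis using \<open>sum ?\<pi> (confs - A) \<ge> 1 / 2\<close> e by linarith
  qed
  have "sum wt A * (1 / 10) \<le> (\<Sum>\<sigma>\<in>A. wt \<sigma> * (\<Sum>\<tau>\<in>confs - A. glp ?T \<sigma> \<tau>))"
    unfolding sum_distrib_right by (intro sum_mono mult_left_mono low w0)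
  also have "\<dots> = (\<Sum>\<sigma>\<in>A. \<Sum>\<tau>\<in>confs - A. wt \<sigma> * glp ?T \<sigma> \<tau>)" by (simp add: sum_distrib_left)
  also have "\<dots> \<le> real ?T * sum wt bd" by (rule bottleneck_flow_le[OF A bd exit])
  finally show ?thesis by simp
qed

section \<open>Configurations close to a constant colouring\<close>

definition defects :: "nat \<Rightarrow> (nat \<Rightarrow> nat) \<Rightarrow> nat set" where
  "defects c \<sigma> = {v\<in>V. \<sigma> v \<noteq> c}"

definition near :: "nat \<Rightarrow> nat \<Rightarrow> (nat \<Rightarrow> nat) set" where
  "near c u = {\<sigma>\<in>confs. card (defects c \<sigma>) \<le> u}"

lemma finite_defects: "finite (defects c \<sigma>)"
  unfolding defects_def using finite_V by simp

text \<open>Exchanging colours 1 and 2 preserves the weight and carries this set to a disjoint one: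
  a vertex cannot have both colours, and \<open>2 * u\<close> is less than
  \<open>card V\<close>.\<close>

lemma sum_near_le_half:
  assumes u: "2 * u < card V" and q: "2 \<le> q"
  shows "2 * sum wt (near 1 u) \<le> sum wt confs"
proof -
  \<comment> \<open>An involution on colours, valid because \<open>2 \<le> q\<close>.\<close>
  define p where "p c = (if c = 1 then 2 else if c = 2 then 1 else c)" for c :: nat
  define F where "F \<sigma> = (\<lambda>v. if v \<in> V then p (\<sigma> v) else undefined)" for \<sigma> :: "nat \<Rightarrow> nat"
  have pp: "p (p c) = c" for c unfolding p_def by auto
  have FF: "F (F \<sigma>) = \<sigma>" if "\<sigma> \<in> confs" for \<sigma>
    using confs_ext[OF that] unfolding F_def by (auto simp: pp)
  have Fc: "F \<sigma> \<in> confs" if "\<sigma> \<in> confs" for \<sigma>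
    using that q confs_mem[OF that] unfolding F_def configs_def by (auto simp: p_def)
  have Fw: "wt (F \<sigma>) = wt \<sigma>" for \<sigma>
  proof -
    have "mono_edge (F \<sigma>) e \<longleftrightarrow> mono_edge \<sigma> e" if e: "e \<in> E" for e
    proof -
      obtain x y where xy: "e = {x, y}" "x \<in> V" "y \<in> V" using edgeE[OF e] by metis
      have "p (\<sigma> x) = p (\<sigma> y) \<longleftrightarrow> \<sigma> x = \<sigma> y" using pp by metis
      then show ?thesis using xy by (simp add: F_def)
    qed
    then have "{e\<in>E. mono_edge (F \<sigma>) e} = {e\<in>E. mono_edge \<sigma> e}" by blast
    then show ?thesis unfolding wt_def mono_edges_eq by simp
  qed
  have Fd: "defects 2 (F \<sigma>) = defects 1 \<sigma>" "defects 1 (F \<sigma>) = defects 2 \<sigma>" for \<sigma>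
    unfolding defects_def F_def p_def by auto
  have "sum wt (near 2 u) = sum wt (near 1 u)"
    by (rule sum.reindex_bij_witness[where i = F and j = F]) (auto simp: near_def FF Fc Fw Fd simp del: One_nat_def)
  moreover have "near 1 u \<inter> near 2 u = {}"
  proof (rule ccontr)
    assume "near 1 u \<inter> near 2 u \<noteq> {}"
    then obtain \<sigma> where "card (defects 1 \<sigma>) \<le> u" "card (defects 2 \<sigma>) \<le> u" unfolding near_def by blast
    moreover have "V = defects 1 \<sigma> \<union> defects 2 \<sigma>" unfolding defects_def by auto
    then have "card V \<le> card (defects 1 \<sigma>) + card (defects 2 \<sigma>)" by (metis card_Un_le)
    ultimately show False using u by linarith
  qed
  moreover have "sum wt (near 1 u \<union> near 2 u) \<le> sum wt confs"
    by (intro sum_mono2 finite_confs) (auto simp: near_def intro: order_trans[OF zero_le_one wt_ge_1])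
  moreover have "finite (near c u)" for c using finite_confs unfolding near_def by simp
  ultimately show ?thesis by (simp add: sum.union_disjoint)
qed

text \<open>The all-1 configuration alone gives \<open>near 1 u\<close> weight at least
  \<open>lam ^ card E\<close>, and the level of exactly \<open>u\<close> defects is its
  boundary.\<close>

lemma mix_time_ge_of_defects:
  assumes u: "2 * u < card V" and q: "2 \<le> q"
  shows "lam ^ card E \<le> 10 * real (mix_time V E lam q) * sum wt {\<sigma>\<in>confs. card (defects 1 \<sigma>) = u}"
proof -
  let ?one = "\<lambda>v. if v \<in> V then 1 else undefined :: nat"
  have one: "?one \<in> confs" using q unfolding configs_def by auto
  have "mono_edge ?one e" if "e \<in> E" for e by (rule edgeE[OF that]) auto
  then have "{e\<in>E. mono_edge ?one e} = E" by blast
  then have "wt ?one = lam ^ card E" unfolding wt_def mono_edges_eq by simp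
  moreover have "defects 1 ?one = {}" unfolding defects_def by auto
  then have "?one \<in> near 1 u" using one unfolding near_def by simp
  then have "wt ?one \<le> sum wt (near 1 u)"
    by (rule member_le_sum) (use finite_confs in \<open>auto simp: near_def intro: order_trans[OF zero_le_one wt_ge_1]\<close>)
  moreover have "sum wt (near 1 u) \<le> 10 * real (mix_time V E lam q) * sum wt {\<sigma>\<in>confs. card (defects 1 \<sigma>) = u}"
  proof (rule bottleneck_mix_time)
    show "near 1 u \<subseteq> confs" "{\<sigma>\<in>confs. card (defects 1 \<sigma>) = u} \<subseteq> near 1 u" unfolding near_def by auto
    show "2 * sum wt (near 1 u) \<le> sum wt confs" by (rule sum_near_le_half[OF u q])
    fix \<rho> \<tau> assume \<rho>: "\<rho> \<in> near 1 u - {\<sigma>\<in>confs. card (defects 1 \<sigma>) = u}" and \<tau>: "\<tau> \<in> confs - near 1 u"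
    \<comment> \<open>One update creates at most one defect, so level \<open>u\<close> cannot be
      jumped over.\<close>
    have "\<tau> \<noteq> \<rho>(v := c)" for v c
    proof
      assume "\<tau> = \<rho>(v := c)"
      then have "defects 1 \<tau> \<subseteq> insert v (defects 1 \<rho>)" unfolding defects_def by auto
      then have "card (defects 1 \<tau>) \<le> card (insert v (defects 1 \<rho>))"
        by (intro card_mono) (simp_all add: finite_defects)
      also have "\<dots> \<le> Suc (card (defects 1 \<rho>))" by (simp add: card_insert_if finite_defects)
      finally have "card (defects 1 \<tau>) \<le> Suc (card (defects 1 \<rho>))" .
      then show False using \<rho> \<tau> unfolding near_def by auto
    qed
    then show "gl \<rho> \<tau> = 0" unfolding glauber_def by simp
  qed
  ultimately show ?thesis by linarith
qed

end

section \<open>Weight of the bottleneck\<close>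

context fin_graph
begin

definition e_in :: "nat set \<Rightarrow> nat" where
  "e_in A = card {e\<in>E. e \<subseteq> A}"

definition mono_in :: "nat set \<Rightarrow> (nat \<Rightarrow> nat) \<Rightarrow> nat" where
  "mono_in A \<sigma> = card {e\<in>E. e \<subseteq> A \<and> mono_edge \<sigma> e}"

lemma card_in_insert:
  assumes "x \<notin> A"
  shows "card {e\<in>E. e \<subseteq> insert x A \<and> P e} = card {e\<in>E. e \<subseteq> A \<and> P e} + card {y\<in>nbrs E x \<inter> A. P {x, y}}"
proof -
  have "{e\<in>E. e \<subseteq> insert x A \<and> P e} = {e\<in>E. e \<subseteq> A \<and> P e} \<union> {e\<in>E. x \<in> e \<and> (e \<subseteq> insert x A \<and> P e)}" by blast
  moreover have "{e\<in>E. e \<subseteq> A \<and> P e} \<inter> {e\<in>E. x \<in> e \<and> (e \<subseteq> insert x A \<and> P e)} = {}" using assms by blast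
  ultimately have "card {e\<in>E. e \<subseteq> insert x A \<and> P e}
    = card {e\<in>E. e \<subseteq> A \<and> P e} + card {e\<in>E. x \<in> e \<and> (e \<subseteq> insert x A \<and> P e)}"
    by (simp, subst card_Un_disjoint) (auto simp: finite_E)
  also have "card {e\<in>E. x \<in> e \<and> (e \<subseteq> insert x A \<and> P e)} = card {y\<in>nbrs E x. {x, y} \<subseteq> insert x A \<and> P {x, y}}"
    by (rule card_edges_at)
  also have "{y\<in>nbrs E x. {x, y} \<subseteq> insert x A \<and> P {x, y}} = {y\<in>nbrs E x \<inter> A. P {x, y}}"
    using not_self_nbr[of x] by auto
  finally show ?thesis .
qed

lemma e_in_insert: "x \<notin> A \<Longrightarrow> e_in (insert x A) = e_in A + card (nbrs E x \<inter> A)"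
  using card_in_insert[of x A "\<lambda>_. True"] unfolding e_in_def by (simp add: Int_def)

lemma e_in_empty [simp]: "e_in {} = 0"
  unfolding e_in_def by (auto elim: edgeE)

lemma mono_in_insert:
  "x \<notin> A \<Longrightarrow> mono_in (insert x A) \<sigma> = mono_in A \<sigma> + card {y\<in>nbrs E x \<inter> A. \<sigma> y = \<sigma> x}"
  unfolding mono_in_def card_in_insert by (auto simp: eq_commute)

lemma mono_in_cong: "(\<And>v. v \<in> A \<Longrightarrow> \<sigma> v = \<tau> v) \<Longrightarrow> mono_in A \<sigma> = mono_in A \<tau>"
proof -
  assume a: "\<And>v. v \<in> A \<Longrightarrow> \<sigma> v = \<tau> v"
  have "mono_edge \<sigma> e \<longleftrightarrow> mono_edge \<tau> e" if "e \<in> E" "e \<subseteq> A" for e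
    by (rule edgeE[OF that(1)]) (use that a in auto)
  then show ?thesis unfolding mono_in_def by (metis (mono_tags, lifting))
qed

lemma e_in_Un_disjoint:
  assumes "A \<inter> C = {}" "\<And>x y. x \<in> A \<Longrightarrow> y \<in> C \<Longrightarrow> {x, y} \<notin> E"
  shows "e_in (A \<union> C) = e_in A + e_in C"
proof -
  have "{e\<in>E. e \<subseteq> A \<union> C} = {e\<in>E. e \<subseteq> A} \<union> {e\<in>E. e \<subseteq> C}"
  proof (intro equalityI subsetI)
    fix e assume e: "e \<in> {e\<in>E. e \<subseteq> A \<union> C}"
    obtain x y where xy: "e = {x, y}" using e edgeE[of e] by blast
    then have "x \<in> A \<union> C" "y \<in> A \<union> C" "{x, y} \<in> E" "{y, x} \<in> E" using e by (auto simp: insert_commute)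
    then show "e \<in> {e\<in>E. e \<subseteq> A} \<union> {e\<in>E. e \<subseteq> C}" using xy assms(2) by blast
  qed auto
  moreover have "{e\<in>E. e \<subseteq> A} \<inter> {e\<in>E. e \<subseteq> C} = {}"
    using assms(1) by (force elim: edgeE)
  ultimately show ?thesis unfolding e_in_def by (simp add: card_Un_disjoint finite_E)
qed

lemma sum_e_in_le:
  assumes "finite \<P>" "disjoint \<P>"
  shows "(\<Sum>C\<in>\<P>. e_in C) \<le> e_in (\<Union>\<P>)"
proof -
  have "(\<Sum>C\<in>\<P>. e_in C) = card (\<Union>C\<in>\<P>. {e\<in>E. e \<subseteq> C})"
    unfolding e_in_def
  proof (rule card_UN_disjoint[symmetric, OF assms(1)])
    show "\<forall>i\<in>\<P>. \<forall>j\<in>\<P>. i \<noteq> j \<longrightarrow> {e\<in>E. e \<subseteq> i} \<inter> {e\<in>E. e \<subseteq> j} = {}"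
    proof (intro ballI impI)
      fix i j assume "i \<in> \<P>" "j \<in> \<P>" "i \<noteq> j"
      then have "i \<inter> j = {}" using assms(2) by (auto simp: disjoint_def)
      then show "{e\<in>E. e \<subseteq> i} \<inter> {e\<in>E. e \<subseteq> j} = {}" by (force elim: edgeE)
    qed
  qed (auto simp: finite_E)
  also have "\<dots> \<le> e_in (\<Union>\<P>)" unfolding e_in_def by (rule card_mono) (auto simp: finite_E)
  finally show ?thesis .
qed

text \<open>A connected subset through \<open>v\<close> of maximal size; an edge leaving it inside
  \<open>U\<close> would allow \<open>conn_insert\<close> to enlarge it.\<close>

lemma exists_component:
  assumes "U \<subseteq> V" "U \<noteq> {}"
  shows "\<exists>C\<subseteq>U. C \<noteq> {} \<and> conn C \<and> (\<forall>x\<in>U - C. \<forall>y\<in>C. {x, y} \<notin> E)"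
proof -
  obtain v where v: "v \<in> U" using assms by blast
  have fin: "finite U" using assms finite_V finite_subset by blast
  let ?S = "{C. C \<subseteq> U \<and> v \<in> C \<and> conn C}"
  have S: "finite ?S" "?S \<noteq> {}" using fin v conn_singleton[of v] by auto
  then have "Max (card ` ?S) \<in> card ` ?S" by (intro Max_in) auto
  then obtain C where C1: "C \<in> ?S" and Cm: "card C = Max (card ` ?S)" by (metis (no_types, lifting) imageE)
  have C2: "card C' \<le> card C" if "C' \<in> ?S" for C'
    unfolding Cm by (rule Max_ge) (use S that in blast)+
  have "{x, y} \<notin> E" if "x \<in> U - C" "y \<in> C" for x y
  proof
    assume "{x, y} \<in> E"
    then have "insert x C \<in> ?S" using C1 that conn_insert[of C y x] by auto
    then have "card (insert x C) \<le> card C" by (rule C2)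
    moreover have "finite C" using C1 fin finite_subset by blast
    ultimately show False using that by simp
  qed
  then show ?thesis using C1 by blast
qed

end

section \<open>Partition functions of induced subgraphs\<close>

context potts
begin

definition zin :: "nat set \<Rightarrow> (nat \<Rightarrow> nat) \<Rightarrow> real" where
  "zin A \<sigma> = (\<Sum>\<tau>\<in>cls A \<sigma>. lam ^ mono_in A \<tau>)"

lemma zin_nonneg: "0 \<le> zin A \<sigma>"
  unfolding zin_def using lam_ge by (intro sum_nonneg) simp

text \<open>\<open>zin\<close> counts only edges inside \<open>A\<close>, so \<sigma> merely fills
  in values elsewhere. That is why the sums for different colours of \<open>x\<close> can all be
  shifted to the same class.\<close>

lemma zin_insert_le:
  assumes x: "x \<in> V" "x \<notin> A" and A: "A \<subseteq> V" and \<sigma>: "\<sigma> \<in> confs"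
  shows "zin (insert x A) \<sigma> \<le> zin A \<sigma> * (real q + real \<Delta> * lam ^ card (nbrs E x \<inter> A))"
proof -
  let ?d = "\<lambda>\<tau> c. card {y\<in>nbrs E x \<inter> A. \<tau> y = c}"
  have "zin (insert x A) \<sigma> = (\<Sum>c\<in>{1..q}. \<Sum>\<tau>\<in>cls A (\<sigma>(x := c)). lam ^ mono_in (insert x A) \<tau>)"
    unfolding zin_def by (rule sum_cls_insert[OF \<sigma> x])
  also have "\<dots> = (\<Sum>c\<in>{1..q}. \<Sum>\<tau>\<in>cls A \<sigma>. lam ^ mono_in (insert x A) (\<tau>(x := c)))"
    using sum_cls_shift[OF \<sigma> x, of _ "\<lambda>_. True" "\<lambda>\<tau>. lam ^ mono_in (insert x A) \<tau>"]
    by (intro sum.cong[OF refl, of "{1..q}"]) simp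
  also have "\<dots> = (\<Sum>c\<in>{1..q}. \<Sum>\<tau>\<in>cls A \<sigma>. lam ^ mono_in A \<tau> * lam ^ ?d \<tau> c)"
  proof (intro sum.cong refl)
    fix c \<tau>
    have "mono_in A (\<tau>(x := c)) = mono_in A \<tau>" by (rule mono_in_cong) (use x in auto)
    moreover have "{y\<in>nbrs E x \<inter> A. (\<tau>(x := c)) y = (\<tau>(x := c)) x} = {y\<in>nbrs E x \<inter> A. \<tau> y = c}"
      using x by auto
    ultimately show "lam ^ mono_in (insert x A) (\<tau>(x := c)) = lam ^ mono_in A \<tau> * lam ^ ?d \<tau> c"
      using mono_in_insert[OF x(2), of "\<tau>(x := c)"] by (simp add: power_add)
  qed
  also have "\<dots> = (\<Sum>\<tau>\<in>cls A \<sigma>. lam ^ mono_in A \<tau> * (\<Sum>c\<in>{1..q}. lam ^ ?d \<tau> c))"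
    by (subst sum.swap) (simp add: sum_distrib_left)
  also have "\<dots> \<le> (\<Sum>\<tau>\<in>cls A \<sigma>. lam ^ mono_in A \<tau> * (real q + real \<Delta> * lam ^ card (nbrs E x \<inter> A)))"
  proof (intro sum_mono mult_left_mono)
    fix \<tau>
    have "(\<Sum>c\<in>{1..q}. lam ^ ?d \<tau> c) \<le> real (card {1..q}) + real \<Delta> * lam ^ card (nbrs E x \<inter> A)"
    proof (rule sum_pow_colour_le)
      show "card (nbrs E x \<inter> A) \<le> \<Delta>"
        using card_mono[OF finite_nbrs, of "nbrs E x \<inter> A" x] degree_le[OF x(1)] unfolding degree_def by simp
      show "?d \<tau> c \<le> card (nbrs E x \<inter> A)" for c
        by (rule card_mono) (use finite_nbrs in auto)
    qed (use finite_nbrs in auto)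
    then show "(\<Sum>c\<in>{1..q}. lam ^ ?d \<tau> c) \<le> real q + real \<Delta> * lam ^ card (nbrs E x \<inter> A)" by simp
  qed (use lam_ge in simp)
  also have "\<dots> = zin A \<sigma> * (real q + real \<Delta> * lam ^ card (nbrs E x \<inter> A))"
    unfolding zin_def by (simp add: sum_distrib_right)
  finally show ?thesis .
qed

text \<open>A vertex attached by \<open>d \<ge> 1\<close> edges multiplies the sum by at most
  \<open>(q + \<Delta> * lam) * lam ^ (d - 1)\<close>, the root by
  \<open>q + \<Delta> * lam\<close>. The total exponent of \<open>lam\<close> is the cyclomatic
  number \<open>e_in C - card C + 1\<close>; the factor \<open>lam ^ card C\<close> on the left
  avoids subtraction.\<close>

lemma zin_Un_component_le:
  assumes C: "C \<subseteq> V" "conn C" "C \<noteq> {}" and A: "A \<subseteq> V" "A \<inter> C = {}"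
    and sep: "\<And>x y. x \<in> A \<Longrightarrow> y \<in> C \<Longrightarrow> {x, y} \<notin> E" and \<sigma>: "\<sigma> \<in> confs"
  shows "zin (A \<union> C) \<sigma> * lam ^ card C \<le> zin A \<sigma> * (real q + real \<Delta> * lam) ^ card C * lam ^ (e_in C + 1)"
proof -
  obtain r where r: "r \<in> C" using C by blast
  have fin: "finite C" using C finite_V finite_subset by blast
  have nA: "nbrs E x \<inter> A = {}" if "x \<in> C" for x using sep that by (auto simp: mem_nbrs_iff)
  let ?Q = "real q + real \<Delta> * lam"
  from fin C(2) r show ?thesis
  proof (induction rule: conn_induct)
    case base
    have "zin (insert r A) \<sigma> \<le> zin A \<sigma> * (real q + real \<Delta> * lam ^ card (nbrs E r \<inter> A))"
      by (rule zin_insert_le) (use r C A \<sigma> in auto)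
    also have "\<dots> \<le> zin A \<sigma> * ?Q"
      unfolding nA[OF r] using lam_ge mult_left_mono[OF lam_ge, of "real \<Delta>"]
      by (intro mult_left_mono zin_nonneg) auto
    finally have "zin (insert r A) \<sigma> * lam \<le> zin A \<sigma> * ?Q * lam" using lam_ge by (intro mult_right_mono) auto
    moreover have "e_in {r} = 0" using e_in_insert[of r "{}"] by simp
    ultimately show ?case by simp
  next
    case (step C' x y)
    let ?d = "card (nbrs E x \<inter> C')"
    have x: "x \<in> V" "x \<notin> A \<union> C'" using step C A by auto
    have C': "finite C'" using step fin finite_subset by blast
    have "y \<in> nbrs E x \<inter> C'" using step by (metis IntI mem_nbrs_commute mem_nbrs_iff)
    then have d: "1 \<le> ?d" using finite_nbrs[of x] by (metis One_nat_def Suc_leI card_gt_0_iff empty_iff finite_Int)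
    have "zin (insert x (A \<union> C')) \<sigma> \<le> zin (A \<union> C') \<sigma> * (real q + real \<Delta> * lam ^ card (nbrs E x \<inter> (A \<union> C')))"
      by (rule zin_insert_le) (use x step C A \<sigma> in auto)
    also have "nbrs E x \<inter> (A \<union> C') = nbrs E x \<inter> C'" using nA[OF step(3)] by blast
    also have "zin (A \<union> C') \<sigma> * (real q + real \<Delta> * lam ^ ?d) \<le> zin (A \<union> C') \<sigma> * (?Q * lam ^ (?d - 1))"
    proof (intro mult_left_mono zin_nonneg)
      have "lam ^ ?d = lam * lam ^ (?d - 1)" using d by (cases ?d) auto
      moreover have "real q \<le> real q * lam ^ (?d - 1)"
        using lam_ge mult_left_mono[OF one_le_power[OF lam_ge, of "?d - 1"], of "real q"] by simp
      ultimately show "real q + real \<Delta> * lam ^ ?d \<le> ?Q * lam ^ (?d - 1)" by (simp add: algebra_simps)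
    qed
    finally have z: "zin (insert x (A \<union> C')) \<sigma> \<le> zin (A \<union> C') \<sigma> * (?Q * lam ^ (?d - 1))" .
    have "zin (A \<union> insert x C') \<sigma> * lam ^ card (insert x C') = zin (insert x (A \<union> C')) \<sigma> * (lam ^ card C' * lam)"
      using step C' by simp
    also have "\<dots> \<le> zin (A \<union> C') \<sigma> * (?Q * lam ^ (?d - 1)) * (lam ^ card C' * lam)"
      using z lam_ge by (intro mult_right_mono) auto
    also have "\<dots> = (zin (A \<union> C') \<sigma> * lam ^ card C') * (?Q * (lam * lam ^ (?d - 1)))" by (simp add: mult_ac)
    also have "lam * lam ^ (?d - 1) = lam ^ ?d" using d by (cases ?d) auto
    also have "(zin (A \<union> C') \<sigma> * lam ^ card C') * (?Q * lam ^ ?d)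
        \<le> (zin A \<sigma> * ?Q ^ card C' * lam ^ (e_in C' + 1)) * (?Q * lam ^ ?d)"
      using step lam_ge by (intro mult_right_mono) auto
    also have "\<dots> = zin A \<sigma> * ?Q ^ card (insert x C') * lam ^ (e_in (insert x C') + 1)"
      using step C' by (simp add: e_in_insert power_add mult_ac)
    finally show ?case .
  qed
qed

text \<open>For a tree component \<open>e_in C + 1 = card C\<close>, so its powers of
  \<open>lam\<close> on the two sides cancel and each vertex costs exactly
  \<open>q + \<Delta> * lam\<close>.\<close>

lemma zin_components:
  assumes "U \<subseteq> V"
  shows "\<exists>\<P>. finite \<P> \<and> disjoint \<P> \<and> \<Union>\<P> = U \<and> {} \<notin> \<P> \<and> e_in U = (\<Sum>C\<in>\<P>. e_in C) \<and>
    (\<forall>\<sigma>\<in>confs. zin U \<sigma> * lam ^ card U \<le> (real q + real \<Delta> * lam) ^ card U * lam ^ (\<Sum>C\<in>\<P>. e_in C + 1))"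
  using finite_subset[OF assms finite_V] assms
proof (induction U rule: finite_psubset_induct)
  case (psubset U)
  let ?Q = "real q + real \<Delta> * lam"
  show ?case
  proof (cases "U = {}")
    case True
    have "mono_in {} \<sigma> = 0" for \<sigma> unfolding mono_in_def by (auto elim: edgeE)
    then have "zin {} \<sigma> = 1" if "\<sigma> \<in> confs" for \<sigma> unfolding zin_def using cls_empty[OF that] by simp
    then show ?thesis using True by (intro exI[of _ "{}"]) auto
  next
    case False
    obtain C where C: "C \<subseteq> U" "C \<noteq> {}" "conn C" "\<forall>x\<in>U - C. \<forall>y\<in>C. {x, y} \<notin> E"
      using exists_component[OF psubset.prems False] by blast
    have "U - C \<subset> U" "U - C \<subseteq> V" using C psubset.prems by auto
    from psubset.IH[OF this] obtain \<P> where P: "finite \<P>" "disjoint \<P>" "\<Union>\<P> = U - C" "{} \<notin> \<P>"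
      "e_in (U - C) = (\<Sum>C\<in>\<P>. e_in C)"
      "\<And>\<sigma>. \<sigma> \<in> confs \<Longrightarrow> zin (U - C) \<sigma> * lam ^ card (U - C) \<le> ?Q ^ card (U - C) * lam ^ (\<Sum>C\<in>\<P>. e_in C + 1)"
      by metis
    have CP: "C \<notin> \<P>" using P(3,4) C(2) by blast
    have finU: "finite U" "finite C" using psubset.hyps finite_subset[OF C(1)] by auto
    have cardU: "card U = card (U - C) + card C"
      using C(1) finU by (simp add: card_Diff_subset card_mono)
    have U: "U - C \<union> C = U" using C by blast
    have eU: "e_in U = e_in (U - C) + e_in C"
      using e_in_Un_disjoint[of "U - C" C] C(4) U by auto
    show ?thesis
    proof (intro exI[of _ "insert C \<P>"] conjI ballI)
      show "disjoint (insert C \<P>)" using P(2,3) by (auto simp: disjoint_def)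
      show "\<Union>(insert C \<P>) = U" using P(3) C by auto
      show "e_in U = (\<Sum>C\<in>insert C \<P>. e_in C)" using eU P CP by simp
      fix \<sigma> assume \<sigma>: "\<sigma> \<in> confs"
      have "zin (U - C \<union> C) \<sigma> * lam ^ card C \<le> zin (U - C) \<sigma> * ?Q ^ card C * lam ^ (e_in C + 1)"
        by (rule zin_Un_component_le) (use C psubset.prems \<sigma> in auto)
      then have "zin U \<sigma> * lam ^ card C * lam ^ card (U - C)
          \<le> zin (U - C) \<sigma> * ?Q ^ card C * lam ^ (e_in C + 1) * lam ^ card (U - C)"
        unfolding U using lam_ge by (intro mult_right_mono) auto
      also have "\<dots> = (zin (U - C) \<sigma> * lam ^ card (U - C)) * (?Q ^ card C * lam ^ (e_in C + 1))"
        by (simp only: mult_ac)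
      also have "\<dots> \<le> (?Q ^ card (U - C) * lam ^ (\<Sum>C\<in>\<P>. e_in C + 1)) * (?Q ^ card C * lam ^ (e_in C + 1))"
        using P(6)[OF \<sigma>] lam_ge by (intro mult_right_mono) auto
      finally show "zin U \<sigma> * lam ^ card U \<le> ?Q ^ card U * lam ^ (\<Sum>C\<in>insert C \<P>. e_in C + 1)"
        using P(1) CP unfolding cardU by (simp add: power_add mult_ac)
    qed (use P C in auto)
  qed
qed

text \<open>A tree component contributes at most twice its size. The other components are jointly sparse,
  and there are few of them: the small ones by \<open>short\<close>, the large ones because of their size.\<close>

lemma component_exponent_le:
  assumes P: "finite \<P>" "disjoint \<P>" "\<Union>\<P> = U" "{} \<notin> \<P>" and U: "U \<subseteq> V"
    and sparse: "\<And>W. W \<subseteq> U \<Longrightarrow> e_in W \<le> card W + J"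
    and short: "card {W. W \<subseteq> V \<and> W \<noteq> {} \<and> card W \<le> L \<and> card W \<le> e_in W} \<le> J"
    and L: "0 < L" "card U \<le> L * J"
  shows "(\<Sum>C\<in>\<P>. 2 * e_in C + 1) \<le> 2 * card U + 4 * J"
proof -
  \<comment> \<open>The components that contain a cycle, split below by size.\<close>
  define N where "N = {C\<in>\<P>. card C \<le> e_in C}"
  define N1 where "N1 = {C\<in>N. card C \<le> L}"
  define N2 where "N2 = {C\<in>N. \<not> card C \<le> L}"
  have finU: "finite U" using U finite_V finite_subset by blast
  have finC: "finite C" if "C \<in> \<P>" for C using that P(3) finU by (meson Union_upper finite_subset)
  have fN: "finite N" "finite N1" "finite N2" unfolding N_def N1_def N2_def using P(1) by auto
  have cU: "(\<Sum>C\<in>\<P>. card C) = card U"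
    unfolding P(3)[symmetric]
    by (rule card_Union_disjoint[symmetric]) (use P(2) finC in \<open>simp_all add: disjoint_def pairwise_def disjnt_def\<close>)
  have dN: "disjoint N" using P(2) unfolding N_def by (auto simp: disjoint_def)
  have cW: "(\<Sum>C\<in>N. card C) = card (\<Union>N)"
    by (rule card_Union_disjoint[symmetric])
      (use dN finC N_def in \<open>simp_all add: disjoint_def pairwise_def disjnt_def\<close>)
  have eN: "(\<Sum>C\<in>N. e_in C) \<le> (\<Sum>C\<in>N. card C) + J"
  proof -
    have "(\<Sum>C\<in>N. e_in C) \<le> e_in (\<Union>N)" by (rule sum_e_in_le[OF fN(1) dN])
    \<comment> \<open>Sparsity is applied to the union of all cyclic components, so the excess
      \<open>J\<close> is paid once and not per component.\<close>
    also have "\<dots> \<le> card (\<Union>N) + J" using P(3) by (intro sparse) (auto simp: N_def)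
    finally show ?thesis using cW by simp
  qed
  have "card N1 \<le> card {W. W \<subseteq> V \<and> W \<noteq> {} \<and> card W \<le> L \<and> card W \<le> e_in W}"
    using P(3,4) U finite_V unfolding N1_def N_def by (intro card_mono) auto
  then have n1: "card N1 \<le> J" using short by simp
  have n2: "card N2 \<le> J"
  proof -
    have "L * card N2 = (\<Sum>C\<in>N2. L)" by simp
    also have "\<dots> \<le> (\<Sum>C\<in>N2. card C)" by (intro sum_mono) (auto simp: N2_def)
    also have "\<dots> \<le> (\<Sum>C\<in>\<P>. card C)" using P(1) by (intro sum_mono2) (auto simp: N2_def N_def)
    also have "\<dots> \<le> L * J" using cU L by simp
    finally show ?thesis using L(1) by simp
  qed
  have "N = N1 \<union> N2" unfolding N1_def N2_def by auto
  then have cN: "card N \<le> 2 * J" using n1 n2 card_Un_le[of N1 N2] by simp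
  have sN: "(\<Sum>C\<in>N. 2 * e_in C + 1) = 2 * (\<Sum>C\<in>N. e_in C) + card N"
    by (simp only: sum.distrib sum_distrib_left card_eq_sum)
  have sR: "(\<Sum>C\<in>\<P> - N. 2 * e_in C + 1) \<le> 2 * (\<Sum>C\<in>\<P> - N. card C)"
    unfolding sum_distrib_left by (intro sum_mono) (auto simp: N_def)
  have NP: "N \<subseteq> \<P>" unfolding N_def by auto
  have "(\<Sum>C\<in>\<P>. 2 * e_in C + 1) = (\<Sum>C\<in>\<P> - N. 2 * e_in C + 1) + (\<Sum>C\<in>N. 2 * e_in C + 1)"
    by (rule sum.subset_diff[OF NP P(1)])
  moreover have "card U = (\<Sum>C\<in>\<P> - N. card C) + (\<Sum>C\<in>N. card C)"
    unfolding cU[symmetric] by (rule sum.subset_diff[OF NP P(1)])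
  ultimately show ?thesis using sN sR eN cN by linarith
qed

text \<open>Degree sum: edges inside \<open>A\<close> are counted from both ends.\<close>

lemma touch_plus_e_in:
  assumes reg: "regular V E \<Delta>" and "A \<subseteq> V"
  shows "card {e\<in>E. e \<inter> A \<noteq> {}} + e_in A = \<Delta> * card A"
  using finite_subset[OF assms(2) finite_V] assms(2)
proof (induction A rule: finite_induct)
  case (insert x A)
  have d: "card (nbrs E x) = \<Delta>" using reg insert unfolding regular_def degree_def by auto
  have "card {e\<in>E. e \<inter> insert x A \<noteq> {}} = card {e\<in>E. e \<inter> A \<noteq> {}} + card (nbrs E x - A)"
    using card_touch_insert[OF insert(2), of "\<lambda>_. True"] by (simp add: set_diff_eq)
  moreover have "e_in (insert x A) = e_in A + card (nbrs E x \<inter> A)" by (rule e_in_insert[OF insert(2)])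
  moreover have "card (nbrs E x - A) + card (nbrs E x \<inter> A) = \<Delta>"
    using d card_Diff_subset_Int[of "nbrs E x" A] card_mono[OF finite_nbrs, of "nbrs E x \<inter> A" x] finite_nbrs[of x]
    by simp
  ultimately show ?case using insert by simp
qed simp

text \<open>Edges avoiding the defects have both ends coloured 1 and are monochromatic; an edge with
  exactly one end in the defect set never is.\<close>

lemma wt_defects:
  assumes reg: "regular V E \<Delta>"
  shows "wt \<sigma> * lam ^ (\<Delta> * card (defects 1 \<sigma>)) = lam ^ card E * lam ^ e_in (defects 1 \<sigma>) * lam ^ mono_in (defects 1 \<sigma>) \<sigma>"
proof -
  let ?U = "defects 1 \<sigma>"
  have t: "touch_mono ?U \<sigma> = mono_in ?U \<sigma>"
  proof -
    have "(e \<inter> ?U \<noteq> {} \<and> mono_edge \<sigma> e) \<longleftrightarrow> (e \<subseteq> ?U \<and> mono_edge \<sigma> e)" if "e \<in> E" for e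
      by (rule edgeE[OF that]) (auto simp: defects_def)
    then show ?thesis unfolding touch_mono_def mono_in_def by (metis (mono_tags, lifting))
  qed
  have o: "off_mono ?U \<sigma> = card {e\<in>E. e \<inter> ?U = {}}"
  proof -
    have "(e \<inter> ?U = {} \<and> mono_edge \<sigma> e) \<longleftrightarrow> e \<inter> ?U = {}" if "e \<in> E" for e
      by (rule edgeE[OF that]) (auto simp: defects_def)
    then show ?thesis unfolding off_mono_def by (metis (mono_tags, lifting))
  qed
  have "E = {e\<in>E. e \<inter> ?U \<noteq> {}} \<union> {e\<in>E. e \<inter> ?U = {}}" by blast
  then have c: "card E = card {e\<in>E. e \<inter> ?U \<noteq> {}} + card {e\<in>E. e \<inter> ?U = {}}"
    using card_Un_disjoint[of "{e\<in>E. e \<inter> ?U \<noteq> {}}" "{e\<in>E. e \<inter> ?U = {}}"] finite_E by auto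
  have "card {e\<in>E. e \<inter> ?U \<noteq> {}} + e_in ?U = \<Delta> * card ?U"
    by (rule touch_plus_e_in[OF reg]) (auto simp: defects_def)
  then have "mono_edges E \<sigma> + \<Delta> * card ?U = card E + e_in ?U + mono_in ?U \<sigma>"
    using mono_edges_split[of \<sigma> ?U] t o c by linarith
  then show ?thesis unfolding wt_def by (metis power_add)
qed

text \<open>For each of the at most \<open>2 ^ card V\<close> defect sets, the weight is a partition
  function on that set, evaluated component by component.\<close>

lemma bottleneck_weight_le:
  assumes reg: "regular V E \<Delta>"
    and sparse: "\<And>W. W \<subseteq> V \<Longrightarrow> card W \<le> u \<Longrightarrow> e_in W \<le> card W + J"
    and short: "card {W. W \<subseteq> V \<and> W \<noteq> {} \<and> card W \<le> L \<and> card W \<le> e_in W} \<le> J"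
    and L: "0 < L" "u \<le> L * J"
  shows "sum wt {\<sigma>\<in>confs. card (defects 1 \<sigma>) = u} * lam ^ (\<Delta> * u)
    \<le> lam ^ card E * 2 ^ card V * (real q + real \<Delta> * lam) ^ u * lam ^ (u + 4 * J)"
proof -
  let ?one = "\<lambda>v. if v \<in> V then 1 else undefined :: nat"
  let ?Q = "real q + real \<Delta> * lam"
  have one: "?one \<in> confs" using q_pos unfolding configs_def by auto
  define \<U> where "\<U> = {U. U \<subseteq> V \<and> card U = u}"
  have fin\<U>: "finite \<U>" unfolding \<U>_def using finite_V by simp
  have card\<U>: "card \<U> \<le> 2 ^ card V"
    using card_mono[of "Pow V" \<U>] finite_V unfolding \<U>_def by (auto simp: card_Pow)
  have one_U: "(\<Sum>\<sigma>\<in>{\<sigma>\<in>confs. defects 1 \<sigma> = U}. wt \<sigma> * lam ^ (\<Delta> * u)) \<le> lam ^ card E * (?Q ^ u * lam ^ (u + 4 * J))"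
    if U: "U \<in> \<U>" for U
  proof -
    have UV: "U \<subseteq> V" "card U = u" using U unfolding \<U>_def by auto
    have "(\<Sum>\<sigma>\<in>{\<sigma>\<in>confs. defects 1 \<sigma> = U}. wt \<sigma> * lam ^ (\<Delta> * u))
        = (\<Sum>\<sigma>\<in>{\<sigma>\<in>confs. defects 1 \<sigma> = U}. lam ^ card E * lam ^ e_in U * lam ^ mono_in U \<sigma>)"
      using wt_defects[OF reg] UV by (intro sum.cong) auto
    \<comment> \<open>Off \<open>U\<close> such configurations equal the all-1 one; allowing colour
      1 on \<open>U\<close> as well only enlarges the sum.\<close>
    also have "\<dots> \<le> (\<Sum>\<sigma>\<in>cls U ?one. lam ^ card E * lam ^ e_in U * lam ^ mono_in U \<sigma>)"
      using lam_ge finite_confs confs_ext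
      by (intro sum_mono2) (auto simp: cls_def defects_def)
    also have "\<dots> = lam ^ card E * (lam ^ e_in U * zin U ?one)"
      unfolding zin_def by (simp add: sum_distrib_left mult.assoc)
    also have "\<dots> \<le> lam ^ card E * (?Q ^ u * lam ^ (u + 4 * J))"
    proof (rule mult_left_mono)
      obtain \<P> where P: "finite \<P>" "disjoint \<P>" "\<Union>\<P> = U" "{} \<notin> \<P>" "e_in U = (\<Sum>C\<in>\<P>. e_in C)"
        "\<forall>\<sigma>\<in>confs. zin U \<sigma> * lam ^ card U \<le> ?Q ^ card U * lam ^ (\<Sum>C\<in>\<P>. e_in C + 1)"
        using zin_components[OF UV(1)] by (elim exE conjE)
      \<comment> \<open>Each component occurs with \<open>e_in C\<close> from the weight formula and
        \<open>e_in C + 1\<close> from \<open>zin_components\<close>.\<close>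
      have ex: "(\<Sum>C\<in>\<P>. 2 * e_in C + 1) \<le> 2 * u + 4 * J"
        unfolding UV(2)[symmetric]
      proof (rule component_exponent_le[OF P(1-4) UV(1) _ short L(1)])
        show "e_in W \<le> card W + J" if "W \<subseteq> U" for W
          using that UV finite_V sparse[of W] card_mono[of U W] finite_subset by blast
      qed (use UV L in auto)
      have "(lam ^ e_in U * zin U ?one) * lam ^ u = lam ^ e_in U * (zin U ?one * lam ^ card U)"
        using UV by simp
      also have "\<dots> \<le> lam ^ e_in U * (?Q ^ u * lam ^ (\<Sum>C\<in>\<P>. e_in C + 1))"
        using bspec[OF P(6) one] UV lam_ge by (intro mult_left_mono) auto
      also have "\<dots> = ?Q ^ u * lam ^ (\<Sum>C\<in>\<P>. 2 * e_in C + 1)"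
      proof -
        have "(\<Sum>C\<in>\<P>. 2 * e_in C + 1) = (\<Sum>C\<in>\<P>. e_in C) + (\<Sum>C\<in>\<P>. e_in C + 1)"
          unfolding sum.distrib[symmetric] by (rule sum.cong) auto
        then show ?thesis unfolding P(5) by (simp only: power_add mult_ac)
      qed
      also have "\<dots> \<le> ?Q ^ u * lam ^ (2 * u + 4 * J)"
        using ex lam_ge by (intro mult_left_mono power_increasing) auto
      also have "\<dots> = (?Q ^ u * lam ^ (u + 4 * J)) * lam ^ u"
      proof -
        have "2 * u + 4 * J = (u + 4 * J) + u" by simp
        then show ?thesis by (metis power_add mult.assoc)
      qed
      finally show "lam ^ e_in U * zin U ?one \<le> ?Q ^ u * lam ^ (u + 4 * J)"
        using lam_ge by simp
    qed (use lam_ge in simp)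
    finally show ?thesis .
  qed
  have "sum wt {\<sigma>\<in>confs. card (defects 1 \<sigma>) = u} * lam ^ (\<Delta> * u)
      = (\<Sum>\<sigma>\<in>{\<sigma>\<in>confs. card (defects 1 \<sigma>) = u}. wt \<sigma> * lam ^ (\<Delta> * u))"
    by (rule sum_distrib_right)
  also have "\<dots> = (\<Sum>\<sigma>\<in>(\<Union>U\<in>\<U>. {\<sigma>\<in>confs. defects 1 \<sigma> = U}). wt \<sigma> * lam ^ (\<Delta> * u))"
    by (rule sum.cong) (auto simp: \<U>_def defects_def)
  also have "(\<Sum>\<sigma>\<in>(\<Union>U\<in>\<U>. {\<sigma>\<in>confs. defects 1 \<sigma> = U}). wt \<sigma> * lam ^ (\<Delta> * u))
      = (\<Sum>U\<in>\<U>. \<Sum>\<sigma>\<in>{\<sigma>\<in>confs. defects 1 \<sigma> = U}. wt \<sigma> * lam ^ (\<Delta> * u))"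
    by (rule sum.UNION_disjoint) (use fin\<U> finite_confs in auto)
  also have "\<dots> \<le> (\<Sum>U\<in>\<U>. lam ^ card E * (?Q ^ u * lam ^ (u + 4 * J)))" by (rule sum_mono[OF one_U])
  also have "\<dots> \<le> 2 ^ card V * (lam ^ card E * (?Q ^ u * lam ^ (u + 4 * J)))"
  proof -
    have "real (card \<U>) \<le> 2 ^ card V" using card\<U> by (metis of_nat_le_iff of_nat_numeral of_nat_power)
    then show ?thesis unfolding sum_constant using lam_ge by (intro mult_right_mono) auto
  qed
  finally show ?thesis by (simp add: mult_ac)
qed

end

section \<open>Random regular graphs\<close>

lemma finite_reg_graphs: "finite (reg_graphs n \<Delta>)"
proof -
  have "reg_graphs n \<Delta> \<subseteq> Pow (Pow {1..n})"
    unfolding reg_graphs_def simple_graph_def by auto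
  then show ?thesis by (rule finite_subset) simp
qed

text \<open>Of the \<open>\<Delta> * n\<close> oriented edges, at most \<open>n\<close> lie in
  \<open>F\<close>, at most \<open>4 * \<Delta>\<close> share an end with \<open>{x, y}\<close>, and
  at most \<open>2 * \<Delta>\<^sup>2\<close> would produce an edge already present. With \<Delta>
  at least 3, \<open>n\<close> of them remain.\<close>

lemma switching_valid_count:
  assumes G: "E \<in> reg_graphs n \<Delta>" and xy: "{x, y} \<in> E" and F: "finite F" "2 * card F \<le> n"
    and \<Delta>: "3 \<le> \<Delta>" and n: "4 * \<Delta> + 2 * \<Delta>\<^sup>2 \<le> n"
  shows "n \<le> card {(z, w). {z, w} \<in> E \<and> {z, w} \<notin> F \<and> z \<notin> {x, y} \<and> w \<notin> {x, y} \<and> {x, z} \<notin> E \<and> {y, w} \<notin> E}"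
    (is "n \<le> card ?val")
proof -
  interpret fin_graph "{1..n}" E using G unfolding reg_graphs_def by unfold_locales simp
  have deg: "card (nbrs E v) = \<Delta>" if "v \<in> {1..n}" for v
    using G that unfolding reg_graphs_def regular_def degree_def by auto
  have xyV: "x \<in> {1..n}" "y \<in> {1..n}" using edges_subset xy by auto
  let ?O = "{(z, w). {z, w} \<in> E}"
  have O: "?O = Sigma {1..n} (nbrs E)"
    using edges_subset by (auto simp: mem_nbrs_iff insert_commute)
  have finO: "finite ?O" unfolding O by (intro finite_SigmaI) (auto simp: finite_nbrs)
  have card_sig: "card (Sigma S (nbrs E)) = \<Delta> * card S" if "S \<subseteq> {1..n}" for S
  proof -
    have "finite S" using that finite_subset by blast
    then have "card (Sigma S (nbrs E)) = (\<Sum>v\<in>S. card (nbrs E v))"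
      by (simp add: finite_nbrs)
    also have "\<dots> = (\<Sum>v\<in>S. \<Delta>)" using that deg by (intro sum.cong) auto
    finally show ?thesis by simp
  qed
  have cO: "card ?O = \<Delta> * n" unfolding O using card_sig[of "{1..n}"] by simp
  have fst_le: "card {(z, w). {z, w} \<in> E \<and> z \<in> S} \<le> \<Delta> * card S" if "S \<subseteq> {1..n}" for S
  proof -
    have "{(z, w). {z, w} \<in> E \<and> z \<in> S} = Sigma S (nbrs E)"
      by (auto simp: mem_nbrs_iff insert_commute)
    then show ?thesis using card_sig[OF that] by simp
  qed
  have snd_le: "card {(z, w). {z, w} \<in> E \<and> w \<in> S} \<le> \<Delta> * card S" if "S \<subseteq> {1..n}" for S
  proof -
    have "{(z, w). {z, w} \<in> E \<and> w \<in> S} = prod.swap ` {(z, w). {z, w} \<in> E \<and> z \<in> S}"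
      by (force simp: insert_commute image_iff)
    then show ?thesis using fst_le[OF that] by (simp add: card_image)
  qed
  have two: "card {p, p'} \<le> 2" for p p' :: "nat \<times> nat" by (simp add: card_insert_if)
  have F_le: "card {(z, w). {z, w} \<in> E \<and> {z, w} \<in> F} \<le> 2 * card F"
  proof -
    have "{(z, w). {z, w} \<in> E \<and> {z, w} \<in> F} \<subseteq> (\<Union>f\<in>F. {(z, w). {z, w} \<in> E \<and> {z, w} = f})" by auto
    moreover have fin: "finite {(z, w). {z, w} \<in> E \<and> {z, w} = f}" for f
      by (rule finite_subset[OF _ finO]) auto
    ultimately have "card {(z, w). {z, w} \<in> E \<and> {z, w} \<in> F} \<le> card (\<Union>f\<in>F. {(z, w). {z, w} \<in> E \<and> {z, w} = f})"
      using F(1) by (intro card_mono) auto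
    also have "\<dots> \<le> (\<Sum>f\<in>F. card {(z, w). {z, w} \<in> E \<and> {z, w} = f})" by (rule card_UN_le[OF F(1)])
    also have "\<dots> \<le> (\<Sum>f\<in>F. 2)"
    proof (rule sum_mono)
      fix f
      show "card {(z, w). {z, w} \<in> E \<and> {z, w} = f} \<le> 2"
      proof (cases "f \<in> E")
        case True
        then obtain a b where f: "f = {a, b}" by (rule edgeE)
        have "{(z, w). {z, w} \<in> E \<and> {z, w} = f} \<subseteq> {(a, b), (b, a)}"
          unfolding f by (auto simp: doubleton_eq_iff)
        then have "card {(z, w). {z, w} \<in> E \<and> {z, w} = f} \<le> card {(a, b), (b, a)}" by (intro card_mono) auto
        also have "\<dots> \<le> 2" by (rule two)
        finally show ?thesis .
      next
        case False
        then have empty: "{(z, w). {z, w} \<in> E \<and> {z, w} = f} = {}" by auto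
        show ?thesis unfolding empty by simp
      qed
    qed
    finally show ?thesis by simp
  qed
  let ?B1 = "{(z, w). {z, w} \<in> E \<and> {z, w} \<in> F}"
  let ?B2 = "{(z, w). {z, w} \<in> E \<and> z \<in> {x, y}}" and ?B3 = "{(z, w). {z, w} \<in> E \<and> w \<in> {x, y}}"
  let ?B4 = "{(z, w). {z, w} \<in> E \<and> z \<in> nbrs E x}" and ?B5 = "{(z, w). {z, w} \<in> E \<and> w \<in> nbrs E y}"
  have c2: "card {x, y} \<le> 2" by (simp add: card_insert_if)
  have b2: "card ?B2 \<le> 2 * \<Delta>" "card ?B3 \<le> 2 * \<Delta>"
  proof -
    have S: "{x, y} \<subseteq> {1..n}" using xyV by blast
    have "\<Delta> * card {x, y} \<le> 2 * \<Delta>" using mult_le_mono2[OF c2, of \<Delta>] by (simp only: mult.commute)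
    then show "card ?B2 \<le> 2 * \<Delta>" "card ?B3 \<le> 2 * \<Delta>"
      using order_trans[OF fst_le[OF S]] order_trans[OF snd_le[OF S]] by blast+
  qed
  have b4: "card ?B4 \<le> \<Delta>\<^sup>2" "card ?B5 \<le> \<Delta>\<^sup>2"
    using fst_le[of "nbrs E x"] snd_le[of "nbrs E y"] nbrs_subset deg xyV by (auto simp: power2_eq_square)
  have "?O \<subseteq> ?val \<union> (?B1 \<union> ?B2 \<union> ?B3 \<union> ?B4 \<union> ?B5)"
    by (auto simp: mem_nbrs_iff insert_commute)
  moreover have "finite (?val \<union> (?B1 \<union> ?B2 \<union> ?B3 \<union> ?B4 \<union> ?B5))"
    by (rule finite_subset[OF _ finO]) auto
  ultimately have "card ?O \<le> card (?val \<union> (?B1 \<union> ?B2 \<union> ?B3 \<union> ?B4 \<union> ?B5))" by (intro card_mono)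
  also have "\<dots> \<le> card ?val + (card ?B1 + card ?B2 + card ?B3 + card ?B4 + card ?B5)"
    by (intro order_trans[OF card_Un_le] add_mono order_refl)
  finally have "\<Delta> * n \<le> card ?val + (n + 4 * \<Delta> + 2 * \<Delta>\<^sup>2)"
    using cO F_le F b2 b4 by linarith
  moreover have "3 * n \<le> \<Delta> * n" using \<Delta> by simp
  ultimately show ?thesis using n by linarith
qed

definition switch :: "nat \<Rightarrow> nat \<Rightarrow> nat \<Rightarrow> nat \<Rightarrow> nat set set \<Rightarrow> nat set set" where
  "switch x y z w E = (E - {{x, y}, {z, w}}) \<union> {{x, z}, {y, w}}"

lemma switch_reg_graph:
  assumes G: "E \<in> reg_graphs n \<Delta>" and xy: "{x, y} \<in> E" and zw: "{z, w} \<in> E"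
    and d: "z \<notin> {x, y}" "w \<notin> {x, y}" and new: "{x, z} \<notin> E" "{y, w} \<notin> E"
  shows "switch x y z w E \<in> reg_graphs n \<Delta>"
proof -
  let ?E = "switch x y z w E"
  interpret fin_graph "{1..n}" E using G unfolding reg_graphs_def by unfold_locales simp
  have deg: "card (nbrs E v) = \<Delta>" if "v \<in> {1..n}" for v
    using G that unfolding reg_graphs_def regular_def degree_def by auto
  have V: "x \<in> {1..n}" "y \<in> {1..n}" "z \<in> {1..n}" "w \<in> {1..n}" using edges_subset xy zw by auto
  have ne: "x \<noteq> y" "z \<noteq> w" using not_self_nbr xy zw by (auto simp: mem_nbrs_iff)
  have dist: "x \<noteq> z" "x \<noteq> w" "y \<noteq> z" "y \<noteq> w" using d by auto
  have simp': "simple_graph {1..n} ?E"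
    using simple V dist unfolding simple_graph_def switch_def by blast
  have swap_card: "card (insert b (nbrs E v - {a})) = \<Delta>"
    if "v \<in> {1..n}" "a \<in> nbrs E v" "b \<notin> nbrs E v" for a b v
    using that deg[OF that(1)] finite_nbrs[of v] card_gt_0_iff[of "nbrs E v"] by (auto simp: card_insert_if)
  have nE: "u \<in> nbrs ?E v \<longleftrightarrow> (u \<in> nbrs E v \<and> {u, v} \<noteq> {x, y} \<and> {u, v} \<noteq> {z, w}) \<or> {u, v} = {x, z} \<or> {u, v} = {y, w}" for u v
    unfolding mem_nbrs_iff switch_def by auto
  have mem: "y \<in> nbrs E x" "x \<in> nbrs E y" "w \<in> nbrs E z" "z \<in> nbrs E w"
    "z \<notin> nbrs E x" "w \<notin> nbrs E y" "x \<notin> nbrs E z" "y \<notin> nbrs E w"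
    using xy zw new by (simp_all add: mem_nbrs_iff insert_commute)
  have "card (nbrs ?E v) = \<Delta>" if v: "v \<in> {1..n}" for v
  proof -
    consider "v = x" | "v = y" | "v = z" | "v = w" | "v \<notin> {x, y, z, w}" by blast
    then show ?thesis
    proof cases
      case 1
      have "nbrs ?E v = insert z (nbrs E x - {y})"
        unfolding 1 by (rule set_eqI, simp only: nE) (auto simp: doubleton_eq_iff ne dist ne[symmetric] dist[symmetric])
      then show ?thesis using swap_card[OF V(1) mem(1,5)] by simp
    next
      case 2
      have "nbrs ?E v = insert w (nbrs E y - {x})"
        unfolding 2 by (rule set_eqI, simp only: nE) (auto simp: doubleton_eq_iff ne dist ne[symmetric] dist[symmetric])
      then show ?thesis using swap_card[OF V(2) mem(2,6)] by simp
    next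
      case 3
      have "nbrs ?E v = insert x (nbrs E z - {w})"
        unfolding 3 by (rule set_eqI, simp only: nE) (auto simp: doubleton_eq_iff ne dist ne[symmetric] dist[symmetric])
      then show ?thesis using swap_card[OF V(3) mem(3,7)] by simp
    next
      case 4
      have "nbrs ?E v = insert y (nbrs E w - {z})"
        unfolding 4 by (rule set_eqI, simp only: nE) (auto simp: doubleton_eq_iff ne dist ne[symmetric] dist[symmetric])
      then show ?thesis using swap_card[OF V(4) mem(4,8)] by simp
    next
      case 5
      have "nbrs ?E v = nbrs E v"
        by (rule set_eqI, simp only: nE) (use 5 in \<open>simp add: doubleton_eq_iff\<close>)
      then show ?thesis using deg[OF v] by simp
    qed
  qed
  then show ?thesis using simp' unfolding reg_graphs_def regular_def degree_def by blast
qed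

lemma switch_inverse:
  assumes "{x, y} \<in> E" "{z, w} \<in> E" "{x, z} \<notin> E" "{y, w} \<notin> E"
  shows "(switch x y z w E - {{x, z}, {y, w}}) \<union> {{x, y}, {z, w}} = E"
  using assms unfolding switch_def by blast

text \<open>Double counting of switchings that remove \<open>e\<close> and keep \<open>F\<close>: at
  least \<open>n\<close> leave each graph containing \<open>e\<close>, and at most \<Delta> times
  \<Delta> enter any graph, because \<open>z\<close> and \<open>w\<close> become neighbours of
  \<open>x\<close> and \<open>y\<close>.\<close>

lemma switching_le:
  assumes F: "finite F" "2 * card F \<le> n" "e \<notin> F"
    and \<Delta>: "3 \<le> \<Delta>" and n: "4 * \<Delta> + 2 * \<Delta>\<^sup>2 \<le> n"
  shows "card {E \<in> reg_graphs n \<Delta>. insert e F \<subseteq> E} * n \<le> \<Delta>\<^sup>2 * card {E \<in> reg_graphs n \<Delta>. F \<subseteq> E}"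
    (is "card ?A * n \<le> _ * card ?B")
proof (cases "?A = {}")
  case False
  then obtain E0 where "E0 \<in> ?A" by blast
  then have "simple_graph {1..n} E0" "e \<in> E0" unfolding reg_graphs_def by auto
  then obtain x y where e: "e = {x, y}" "x \<in> {1..n}" "y \<in> {1..n}" unfolding simple_graph_def by blast
  define val where "val E = {(z, w). {z, w} \<in> E \<and> {z, w} \<notin> F \<and> z \<notin> {x, y} \<and> w \<notin> {x, y} \<and> {x, z} \<notin> E \<and> {y, w} \<notin> E}" for E
  \<comment> \<open>Recording \<open>z\<close> and \<open>w\<close> makes the map injective, as the
    switching can then be undone.\<close>
  define f where "f = (\<lambda>(E, z, w). (switch x y z w E, z, w))"
  have finA: "finite ?A" "finite ?B" using finite_reg_graphs[of n \<Delta>] by auto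
  have finval: "finite (val E)" if "E \<in> ?A" for E
  proof (rule finite_subset)
    show "val E \<subseteq> {1..n} \<times> {1..n}"
      using that unfolding val_def reg_graphs_def simple_graph_def by (auto simp: doubleton_eq_iff)
  qed simp
  have inj: "inj_on f (Sigma ?A val)"
  proof (rule inj_onI)
    fix p p' assume p: "p \<in> Sigma ?A val" "p' \<in> Sigma ?A val" "f p = f p'"
    obtain E z w E' z' w' where pp: "p = (E, z, w)" "p' = (E', z', w')" by (metis prod_cases3)
    have eq: "z' = z" "w' = w" "switch x y z w E = switch x y z w E'" using p(3) unfolding pp f_def by auto
    have "E = (switch x y z w E - {{x, z}, {y, w}}) \<union> {{x, y}, {z, w}}"
      using p(1) e unfolding pp val_def by (intro switch_inverse[symmetric]) auto
    moreover have "E' = (switch x y z w E' - {{x, z}, {y, w}}) \<union> {{x, y}, {z, w}}"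
      using p(2) e eq unfolding pp val_def by (intro switch_inverse[symmetric]) auto
    ultimately show "p = p'" unfolding pp using eq by simp
  qed
  have img: "f ` Sigma ?A val \<subseteq> Sigma ?B (\<lambda>E. nbrs E x \<times> nbrs E y)"
  proof
    fix p' assume "p' \<in> f ` Sigma ?A val"
    then obtain E z w where p': "p' = (switch x y z w E, z, w)" and E: "E \<in> ?A" and zw: "(z, w) \<in> val E"
      unfolding f_def by auto
    have "switch x y z w E \<in> reg_graphs n \<Delta>"
      using E zw e unfolding val_def by (intro switch_reg_graph) auto
    moreover have "F \<subseteq> switch x y z w E" using E zw e F(3) unfolding val_def switch_def by auto
    moreover have "z \<in> nbrs (switch x y z w E) x" "w \<in> nbrs (switch x y z w E) y"
      unfolding switch_def mem_nbrs_iff by (auto simp: insert_commute)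
    ultimately show "p' \<in> Sigma ?B (\<lambda>E. nbrs E x \<times> nbrs E y)" unfolding p' by auto
  qed
  have degB: "card (nbrs E x) = \<Delta>" "card (nbrs E y) = \<Delta>" if "E \<in> ?B" for E
    using that e unfolding reg_graphs_def regular_def degree_def by auto
  have finB: "finite (nbrs E x)" "finite (nbrs E y)" if "E \<in> ?B" for E
    using degB[OF that] \<Delta> by (metis card.infinite not_numeral_le_zero)+
  have "card ?A * n = (\<Sum>E\<in>?A. n)" by simp
  also have "\<dots> \<le> (\<Sum>E\<in>?A. card (val E))"
  proof (rule sum_mono)
    fix E assume E: "E \<in> ?A"
    show "n \<le> card (val E)"
      unfolding val_def by (rule switching_valid_count[OF _ _ F(1,2) \<Delta> n]) (use E e in auto)
  qed
  also have "\<dots> = card (Sigma ?A val)" using finA finval by simp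
  also have "\<dots> = card (f ` Sigma ?A val)" by (rule card_image[OF inj, symmetric])
  also have "\<dots> \<le> card (Sigma ?B (\<lambda>E. nbrs E x \<times> nbrs E y))"
    using img finA finB by (intro card_mono finite_SigmaI) auto
  also have "\<dots> = (\<Sum>E\<in>?B. card (nbrs E x \<times> nbrs E y))"
    using finA finB by (intro card_SigmaI) auto
  also have "\<dots> = (\<Sum>E\<in>?B. \<Delta>\<^sup>2)"
    using degB by (intro sum.cong) (auto simp: card_cartesian_product power2_eq_square)
  finally show ?thesis by (simp add: mult.commute)
next
  case True
  show ?thesis unfolding True by simp
qed

lemma card_reg_graphs_superset_le:
  assumes "finite F" "2 * card F \<le> n" and \<Delta>: "3 \<le> \<Delta>" and n: "4 * \<Delta> + 2 * \<Delta>\<^sup>2 \<le> n"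
  shows "card {E \<in> reg_graphs n \<Delta>. F \<subseteq> E} * n ^ card F \<le> \<Delta> ^ (2 * card F) * card (reg_graphs n \<Delta>)"
  using assms(1,2)
proof (induction F rule: finite_induct)
  case (insert e F)
  have "card {E \<in> reg_graphs n \<Delta>. insert e F \<subseteq> E} * n ^ card (insert e F)
      = (card {E \<in> reg_graphs n \<Delta>. insert e F \<subseteq> E} * n) * n ^ card F"
    using insert by simp
  also have "\<dots> \<le> (\<Delta>\<^sup>2 * card {E \<in> reg_graphs n \<Delta>. F \<subseteq> E}) * n ^ card F"
    using insert \<Delta> n by (intro mult_le_mono1 switching_le) auto
  also have "\<dots> = \<Delta>\<^sup>2 * (card {E \<in> reg_graphs n \<Delta>. F \<subseteq> E} * n ^ card F)" by (simp add: mult_ac)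
  also have "\<dots> \<le> \<Delta>\<^sup>2 * (\<Delta> ^ (2 * card F) * card (reg_graphs n \<Delta>))"
    using insert by (intro mult_le_mono2) auto
  also have "\<dots> = \<Delta> ^ (2 * card (insert e F)) * card (reg_graphs n \<Delta>)"
    using insert by (simp add: power2_eq_square mult_ac)
  finally show ?case .
qed simp

section \<open>Existence of regular graphs\<close>

lemma circulant_reg_graph:
  fixes D :: "int set"
  assumes D: "D \<subseteq> {1..<int n}" "\<And>d. d \<in> D \<Longrightarrow> int n - d \<in> D" "card D = \<Delta>"
  shows "{{i, j} | i j. i \<in> {1..n} \<and> j \<in> {1..n} \<and> (int i - int j) mod int n \<in> D} \<in> reg_graphs n \<Delta>"
    (is "?E \<in> _")
proof -
  have zero: "0 \<notin> D" using D(1) by auto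
  have sym: "(int j - int i) mod int n \<in> D" if "(int i - int j) mod int n \<in> D" for i j
  proof -
    have "(int j - int i) mod int n = int n - (int i - int j) mod int n"
      using that zero by (metis minus_diff_eq zmod_zminus1_eq_if)
    then show ?thesis using D(2)[OF that] by simp
  qed
  have nb: "nbrs ?E v = {u\<in>{1..n}. (int u - int v) mod int n \<in> D}" if v: "v \<in> {1..n}" for v
  proof (intro equalityI subsetI)
    fix u assume "u \<in> nbrs ?E v"
    then obtain i j where "{u, v} = {i, j}" "i \<in> {1..n}" "j \<in> {1..n}" "(int i - int j) mod int n \<in> D"
      unfolding mem_nbrs_iff by blast
    then show "u \<in> {u\<in>{1..n}. (int u - int v) mod int n \<in> D}" using sym[of i j] by (auto simp: doubleton_eq_iff)
  next
    fix u assume "u \<in> {u\<in>{1..n}. (int u - int v) mod int n \<in> D}"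
    then show "u \<in> nbrs ?E v" unfolding mem_nbrs_iff using v by blast
  qed
  have simp: "simple_graph {1..n} ?E"
    unfolding simple_graph_def
  proof (intro conjI ballI)
    fix e assume "e \<in> ?E"
    then obtain i j where ij: "e = {i, j}" "i \<in> {1..n}" "j \<in> {1..n}" "(int i - int j) mod int n \<in> D" by blast
    then have "i \<noteq> j" using zero by auto
    then show "\<exists>u v. e = {u, v} \<and> u \<noteq> v \<and> u \<in> {1..n} \<and> v \<in> {1..n}" using ij by blast
  qed simp
  have "degree ?E v = \<Delta>" if v: "v \<in> {1..n}" for v
  proof -
    define f where "f u = (int u - int v) mod int n" for u :: nat
    have inj: "inj_on f {1..n}"
    proof (rule inj_onI)
      fix a b assume ab: "a \<in> {1..n}" "b \<in> {1..n}" "f a = f b"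
      then have "int n dvd (int a - int v) - (int b - int v)"
        unfolding f_def by (simp add: mod_eq_dvd_iff)
      then have "int n dvd int a - int b" by simp
      moreover have "\<bar>int a - int b\<bar> < int n" using ab by auto
      ultimately show "a = b" using dvd_imp_le_int[of "int a - int b" "int n"] by fastforce
    qed
    have "f ` {1..n} \<subseteq> {0..<int n}" using v unfolding f_def by auto
    moreover have "card (f ` {1..n}) = card {0..<int n}" using card_image[OF inj] by simp
    ultimately have surj: "f ` {1..n} = {0..<int n}" by (intro card_subset_eq) auto
    have "bij_betw f {u\<in>{1..n}. f u \<in> D} D"
      unfolding bij_betw_def
    proof
      show "inj_on f {u\<in>{1..n}. f u \<in> D}" by (rule inj_on_subset[OF inj]) auto
      show "f ` {u\<in>{1..n}. f u \<in> D} = D"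
      proof (intro equalityI subsetI)
        fix d assume d: "d \<in> D"
        then have "d \<in> f ` {1..n}" using D(1) surj by auto
        then show "d \<in> f ` {u\<in>{1..n}. f u \<in> D}" using d by auto
      qed auto
    qed
    then have "card {u\<in>{1..n}. f u \<in> D} = card D" by (rule bij_betw_same_card)
    then show ?thesis unfolding degree_def nb[OF v] f_def using D(3) by simp
  qed
  then show ?thesis using simp unfolding reg_graphs_def regular_def by blast
qed

text \<open>Division by zero would make every probability 0 on an empty space, so existence must be
  shown. A circulant graph with differences up to \<Delta>/2 in both directions serves.\<close>

lemma reg_graphs_nonempty:
  assumes "even (n * \<Delta>)" "\<Delta> < n"
  shows "reg_graphs n \<Delta> \<noteq> {}"
proof -
  define h where "h = int (\<Delta> div 2)"
  define D0 where "D0 = {1..h} \<union> {int n - h..int n - 1}"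
  have h: "2 * h < int n" "0 \<le> h" using assms unfolding h_def by auto
  have c0: "card D0 = 2 * (\<Delta> div 2)"
    unfolding D0_def using h by (subst card_Un_disjoint) (auto simp: h_def)
  have s0: "d \<in> D0 \<Longrightarrow> int n - d \<in> D0" for d unfolding D0_def by auto
  have sub0: "D0 \<subseteq> {1..<int n}" using h unfolding D0_def by auto
  show ?thesis
  proof (cases "even \<Delta>")
    case True
    then show ?thesis using circulant_reg_graph[OF sub0 s0, of \<Delta>] c0 by auto
  next
    case False
    then have "even n" using assms by simp
    \<comment> \<open>For odd \<Delta> the antipodal difference \<open>n/2\<close>, its own
      negative, supplies the missing neighbour.\<close>
    then obtain m where m: "n = 2 * m" by blast
    have hm: "h < int m" using assms(2) False m unfolding h_def by (auto elim!: oddE)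
    have "int m \<notin> D0" using hm m unfolding D0_def by auto
    then have c: "card (insert (int m) D0) = \<Delta>" using c0 False by (simp add: D0_def)
    have s: "d \<in> insert (int m) D0 \<Longrightarrow> int n - d \<in> insert (int m) D0" for d using s0 m by auto
    have sub: "insert (int m) D0 \<subseteq> {1..<int n}" using sub0 hm h m by auto
    show ?thesis using circulant_reg_graph[OF sub s c] by auto
  qed
qed

section \<open>Binomial estimates and first moments\<close>

lemma power_self_le_fact: "real s ^ s \<le> 3 ^ s * fact s"
proof -
  \<comment> \<open>A single term of the exponential series at \<open>s\<close>.\<close>
  have "real s ^ s /\<^sub>R fact s \<le> exp (real s)"
    unfolding exp_def
    using sum_le_suminf[OF summable_exp_generic, of "{s}" "real s"] by (simp add: divide_inverse)
  also have "\<dots> = exp 1 ^ s" using exp_of_nat_mult[of s "1::real"] by simp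
  also have "\<dots> \<le> 3 ^ s" using exp_le by (intro power_mono) auto
  finally show ?thesis by (simp add: field_simps)
qed

lemma binomial_mult_power_le: "real (n choose s) * real s ^ s \<le> (3 * real n) ^ s"
proof -
  have "real (n choose s) * real s ^ s \<le> real (n choose s) * (3 ^ s * fact s)"
    by (intro mult_left_mono power_self_le_fact) auto
  also have "\<dots> = 3 ^ s * real ((n choose s) * fact s)" by simp
  also have "\<dots> \<le> 3 ^ s * real (n ^ s)"
    using binomial_fact_pow[of n s] by (intro mult_left_mono) (simp_all only: of_nat_le_iff, simp)
  finally show ?thesis by (simp add: power_mult_distrib)
qed

lemma binomial_le_power: "n choose s \<le> n ^ s"
proof -
  have "n choose s \<le> (n choose s) * fact s" by simp
  also have "\<dots> \<le> n ^ s" by (rule binomial_fact_pow)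
  finally show ?thesis .
qed

text \<open>The bound (3 N / m)^m with N at most s^2; as \<open>s \<le> m\<close>, one factor
  \<open>s\<close> cancels.\<close>

lemma binomial_pairs_le:
  assumes "1 \<le> s" "s \<le> m"
  shows "real ((s choose 2) choose m) \<le> (3 * real s) ^ m"
proof -
  let ?N = "s choose 2"
  have "?N \<le> s\<^sup>2" by (rule binomial_le_power)
  then have N: "real ?N \<le> (real s)\<^sup>2" by (metis of_nat_le_iff of_nat_power)
  have "real (?N choose m) * real s ^ m \<le> real (?N choose m) * real m ^ m"
    using assms by (intro mult_left_mono power_mono) auto
  also have "\<dots> \<le> (3 * real ?N) ^ m" by (rule binomial_mult_power_le)
  also have "\<dots> \<le> (3 * (real s)\<^sup>2) ^ m" using N by (intro power_mono) auto
  also have "\<dots> = (3 * real s) ^ m * real s ^ m"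
    by (simp add: power_mult_distrib power2_eq_square)
  finally show ?thesis using assms by simp
qed

text \<open>Union bound over the sets of \<open>m\<close> pairs inside \<open>W\<close>.\<close>

lemma card_reg_graphs_dense_le:
  assumes W: "W \<subseteq> {1..n}" "card W = s" and m: "2 * m \<le> n" and \<Delta>: "3 \<le> \<Delta>" and n: "4 * \<Delta> + 2 * \<Delta>\<^sup>2 \<le> n"
  shows "real (card {E \<in> reg_graphs n \<Delta>. m \<le> card {e\<in>E. e \<subseteq> W}})
    \<le> real ((s choose 2) choose m) * ((real \<Delta>)\<^sup>2 / real n) ^ m * real (card (reg_graphs n \<Delta>))"
proof -
  have finW: "finite W" using W finite_subset by blast
  define pairs where "pairs = {e. e \<subseteq> W \<and> card e = 2}"
  define \<F> where "\<F> = {F. F \<subseteq> pairs \<and> card F = m}"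
  have fp: "finite pairs" unfolding pairs_def using finW by simp
  have cp: "card pairs = s choose 2" unfolding pairs_def using n_subsets[OF finW, of 2] W by simp
  have cF: "card \<F> = (s choose 2) choose m" unfolding \<F>_def using n_subsets[OF fp, of m] cp by simp
  have fF: "finite \<F>" unfolding \<F>_def using fp by simp
  have n0: "0 < real n" using n \<Delta> by simp
  have "{E \<in> reg_graphs n \<Delta>. m \<le> card {e\<in>E. e \<subseteq> W}} \<subseteq> (\<Union>F\<in>\<F>. {E \<in> reg_graphs n \<Delta>. F \<subseteq> E})"
  proof
    fix E assume E: "E \<in> {E \<in> reg_graphs n \<Delta>. m \<le> card {e\<in>E. e \<subseteq> W}}"
    then obtain F where F: "F \<subseteq> {e\<in>E. e \<subseteq> W}" "card F = m" by (metis (lifting) mem_Collect_eq obtain_subset_with_card_n)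
    have "card e = 2" if "e \<in> E" for e
      using E that unfolding reg_graphs_def simple_graph_def by fastforce
    then have "F \<in> \<F>" using F unfolding \<F>_def pairs_def by auto
    then show "E \<in> (\<Union>F\<in>\<F>. {E \<in> reg_graphs n \<Delta>. F \<subseteq> E})" using E F by auto
  qed
  then have "card {E \<in> reg_graphs n \<Delta>. m \<le> card {e\<in>E. e \<subseteq> W}} \<le> card (\<Union>F\<in>\<F>. {E \<in> reg_graphs n \<Delta>. F \<subseteq> E})"
    using fF finite_reg_graphs by (intro card_mono) auto
  also have "\<dots> \<le> (\<Sum>F\<in>\<F>. card {E \<in> reg_graphs n \<Delta>. F \<subseteq> E})" by (rule card_UN_le[OF fF])
  finally have "real (card {E \<in> reg_graphs n \<Delta>. m \<le> card {e\<in>E. e \<subseteq> W}})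
      \<le> (\<Sum>F\<in>\<F>. real (card {E \<in> reg_graphs n \<Delta>. F \<subseteq> E}))"
    unfolding of_nat_sum[symmetric] of_nat_le_iff .
  also have "\<dots> \<le> (\<Sum>F\<in>\<F>. ((real \<Delta>)\<^sup>2 / real n) ^ m * real (card (reg_graphs n \<Delta>)))"
  proof (rule sum_mono)
    fix F assume "F \<in> \<F>"
    then have F: "finite F" "card F = m" unfolding \<F>_def using fp finite_subset by auto
    have "card {E \<in> reg_graphs n \<Delta>. F \<subseteq> E} * n ^ m \<le> \<Delta> ^ (2 * m) * card (reg_graphs n \<Delta>)"
      using card_reg_graphs_superset_le[OF F(1) _ \<Delta> n] F m by simp
    then have "real (card {E \<in> reg_graphs n \<Delta>. F \<subseteq> E}) * real n ^ m \<le> real \<Delta> ^ (2 * m) * real (card (reg_graphs n \<Delta>))"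
      by (metis of_nat_le_iff of_nat_mult of_nat_power)
    then show "real (card {E \<in> reg_graphs n \<Delta>. F \<subseteq> E}) \<le> ((real \<Delta>)\<^sup>2 / real n) ^ m * real (card (reg_graphs n \<Delta>))"
      unfolding power_mult[of "real \<Delta>" 2 m] using n0 by (simp add: power_divide field_simps)
  qed
  also have "\<dots> = real ((s choose 2) choose m) * ((real \<Delta>)\<^sup>2 / real n) ^ m * real (card (reg_graphs n \<Delta>))"
    using cF by simp
  finally show ?thesis .
qed

lemma card_subsets_of_card: "card {W. W \<subseteq> {1..n::nat} \<and> card W = s} = n choose s"
  using n_subsets[of "{1..n}" s] by simp

text \<open>\<open>R\<close> is chosen so that at density 1/R each of the \<open>J\<close> excess
  edges brings a factor of at most \<open>1 / (18 * \<Delta>\<^sup>2) ^ L\<close>. Since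
  \<open>L * J \<ge> u\<close>, these beat the entropy \<open>(9 * \<Delta>\<^sup>2) ^ u\<close> by
  \<open>2 ^ u\<close>.\<close>

lemma dense_sets_rare:
  assumes \<Delta>: "3 \<le> \<Delta>" and n: "4 * \<Delta> + 2 * \<Delta>\<^sup>2 \<le> n" and u: "2 * (u + J) \<le> n" "R * u \<le> n"
    and R: "R = 3 * \<Delta>\<^sup>2 * (18 * \<Delta>\<^sup>2) ^ L" and L: "u \<le> L * J"
  shows "real (card {E \<in> reg_graphs n \<Delta>. \<exists>W\<subseteq>{1..n}. card W \<le> u \<and> card W + J < card {e\<in>E. e \<subseteq> W}})
    \<le> real u / 2 ^ u * real (card (reg_graphs n \<Delta>))"
proof -
  let ?N = "real (card (reg_graphs n \<Delta>))"
  define \<W> where "\<W> s = {W. W \<subseteq> {1..n} \<and> card W = s}" for s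
  define X where "X W = {E \<in> reg_graphs n \<Delta>. card W + J \<le> card {e\<in>E. e \<subseteq> W}}" for W
  have fW: "finite (\<W> s)" for s unfolding \<W>_def by simp
  have fX: "finite (X W)" for W unfolding X_def using finite_reg_graphs by simp
  have n0: "0 < real n" using n \<Delta> by simp
  have \<Delta>1: "1 \<le> real \<Delta>" using \<Delta> by simp
  have count: "(\<Sum>W\<in>\<W> s. real (card (X W))) \<le> 1 / 2 ^ u * ?N" if s: "1 \<le> s" "s \<le> u" for s
  proof -
    let ?D = "(real \<Delta>)\<^sup>2"
    have "(\<Sum>W\<in>\<W> s. real (card (X W))) \<le> (\<Sum>W\<in>\<W> s. (3 * real s) ^ (s + J) * (?D / real n) ^ (s + J) * ?N)"
    proof (rule sum_mono)
      fix W assume W: "W \<in> \<W> s"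
      have "real (card (X W)) \<le> real ((s choose 2) choose (s + J)) * (?D / real n) ^ (s + J) * ?N"
        using card_reg_graphs_dense_le[of W n s "s + J" \<Delta>] W s u \<Delta> n unfolding X_def \<W>_def by auto
      also have "\<dots> \<le> (3 * real s) ^ (s + J) * (?D / real n) ^ (s + J) * ?N"
        using binomial_pairs_le[of s "s + J"] s by (intro mult_right_mono) auto
      finally show "real (card (X W)) \<le> (3 * real s) ^ (s + J) * (?D / real n) ^ (s + J) * ?N" .
    qed
    also have "\<dots> = real (n choose s) * ((3 * real s) * (?D / real n)) ^ (s + J) * ?N"
      unfolding \<W>_def sum_constant card_subsets_of_card power_mult_distrib[of "3 * real s" "?D / real n"]
      by (simp only: mult.assoc)
    also have "\<dots> \<le> (3 * real n / real s) ^ s * ((3 * real s) * (?D / real n)) ^ (s + J) * ?N"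
      using binomial_mult_power_le[of n s] s n0
      by (intro mult_right_mono) (auto simp: power_divide field_simps)
    \<comment> \<open>The first \<open>s\<close> edges cancel the choice of \<open>W\<close> up to a
      constant per vertex; only the \<open>J\<close> excess edges gain powers of
      \<open>s / n\<close>.\<close>
    also have "\<dots> = (9 * ?D) ^ s * (3 * ?D * real s / real n) ^ J * ?N"
    proof -
      have "(3 * real n / real s) * ((3 * real s) * (?D / real n)) = 9 * ?D" using s n0 by simp
      then have "(3 * real n / real s) ^ s * ((3 * real s) * (?D / real n)) ^ s = (9 * ?D) ^ s"
        by (metis power_mult_distrib)
      moreover have "(3 * real s) * (?D / real n) = 3 * ?D * real s / real n" by simp
      ultimately show ?thesis unfolding power_add by (simp only: mult.assoc[symmetric])
    qed
    also have "\<dots> \<le> (9 * ?D) ^ u * (1 / (18 * ?D) ^ L) ^ J * ?N"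
    proof (intro mult_right_mono mult_mono)
      show "(9 * ?D) ^ s \<le> (9 * ?D) ^ u" using s one_le_power[OF \<Delta>1, of 2] by (intro power_increasing) auto
      show "(3 * ?D * real s / real n) ^ J \<le> (1 / (18 * ?D) ^ L) ^ J"
      proof (rule power_mono)
        have "real R * real s \<le> real n" using u(2) s mult_le_mono2[of s u R] by (metis le_trans of_nat_le_iff of_nat_mult)
        then have "3 * ?D * (18 * ?D) ^ L * real s \<le> real n" unfolding R by simp
        then show "3 * ?D * real s / real n \<le> 1 / (18 * ?D) ^ L" using n0 \<Delta>1 by (simp add: field_simps)
      qed simp
    qed (use \<Delta>1 in auto)
    also have "\<dots> \<le> 1 / 2 ^ u * ?N"
    proof (rule mult_right_mono)
      have b1: "1 \<le> 18 * ?D" using one_le_power[OF \<Delta>1, of 2] by linarith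
      have gen: "b * (1 / a) \<le> 1 / c" if "c * b \<le> a" "0 < a" "0 < c" for a b c :: real
        using that by (simp add: field_simps)
      have "2 ^ u * (9 * ?D) ^ u = (2 * (9 * ?D)) ^ u" by (rule power_mult_distrib[symmetric])
      also have "\<dots> = (18 * ?D) ^ u" by simp
      also have "\<dots> \<le> (18 * ?D) ^ (L * J)" using L b1 by (rule power_increasing)
      finally have "2 ^ u * (9 * ?D) ^ u \<le> (18 * ?D) ^ (L * J)" .
      moreover have "0 < (18 * ?D) ^ (L * J)" by (rule zero_less_power) (use b1 in linarith)
      ultimately have "(9 * ?D) ^ u * (1 / (18 * ?D) ^ (L * J)) \<le> 1 / 2 ^ u" by (rule gen) simp
      then show "(9 * ?D) ^ u * (1 / (18 * ?D) ^ L) ^ J \<le> 1 / 2 ^ u"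
        unfolding power_one_over power_mult[of "18 * ?D" L J] .
    qed simp
    finally show ?thesis .
  qed
  have "{E \<in> reg_graphs n \<Delta>. \<exists>W\<subseteq>{1..n}. card W \<le> u \<and> card W + J < card {e\<in>E. e \<subseteq> W}}
      \<subseteq> (\<Union>s\<in>{1..u}. \<Union>W\<in>\<W> s. X W)"
  proof
    fix E assume "E \<in> {E \<in> reg_graphs n \<Delta>. \<exists>W\<subseteq>{1..n}. card W \<le> u \<and> card W + J < card {e\<in>E. e \<subseteq> W}}"
    then obtain W where W: "W \<subseteq> {1..n}" "card W \<le> u" "card W + J < card {e\<in>E. e \<subseteq> W}" and E: "E \<in> reg_graphs n \<Delta>"
      by blast
    have "W \<noteq> {}"
    proof
      assume "W = {}"
      moreover have "{e\<in>E. e \<subseteq> {}} = {}" using E unfolding reg_graphs_def simple_graph_def by fastforce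
      ultimately have "card {e\<in>E. e \<subseteq> W} = 0" by (simp only: card.empty)
      then show False using W(3) by linarith
    qed
    then have "1 \<le> card W" using W(1) by (metis One_nat_def Suc_leI card_gt_0_iff finite_atLeastAtMost finite_subset)
    then show "E \<in> (\<Union>s\<in>{1..u}. \<Union>W\<in>\<W> s. X W)"
      using W E unfolding \<W>_def X_def by (intro UN_I[of "card W"] UN_I[of W]) auto
  qed
  then have "card {E \<in> reg_graphs n \<Delta>. \<exists>W\<subseteq>{1..n}. card W \<le> u \<and> card W + J < card {e\<in>E. e \<subseteq> W}}
      \<le> card (\<Union>s\<in>{1..u}. \<Union>W\<in>\<W> s. X W)"
    using fW fX by (intro card_mono) auto
  also have "\<dots> \<le> (\<Sum>s\<in>{1..u}. card (\<Union>W\<in>\<W> s. X W))" by (rule card_UN_le) simp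
  also have "\<dots> \<le> (\<Sum>s\<in>{1..u}. \<Sum>W\<in>\<W> s. card (X W))" by (intro sum_mono card_UN_le fW)
  finally have "real (card {E \<in> reg_graphs n \<Delta>. \<exists>W\<subseteq>{1..n}. card W \<le> u \<and> card W + J < card {e\<in>E. e \<subseteq> W}})
      \<le> real (\<Sum>s\<in>{1..u}. \<Sum>W\<in>\<W> s. card (X W))" by (simp only: of_nat_le_iff)
  also have "\<dots> = (\<Sum>s\<in>{1..u}. \<Sum>W\<in>\<W> s. real (card (X W)))" by simp
  also have "\<dots> \<le> (\<Sum>s\<in>{1..u}. 1 / 2 ^ u * ?N)" by (intro sum_mono count) auto
  also have "\<dots> = real u / 2 ^ u * ?N" by simp
  finally show ?thesis .
qed

text \<open>With as many edges as vertices, the power of \<open>n\<close> from choosing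
  \<open>W\<close> cancels against the edge probabilities. The expected number is bounded
  independently of \<open>n\<close>, and Markov's inequality gives the factor
  \<open>1 / J\<close>.\<close>

lemma short_cycles_rare:
  assumes \<Delta>: "3 \<le> \<Delta>" and n: "4 * \<Delta> + 2 * \<Delta>\<^sup>2 \<le> n" and L: "2 * L \<le> n" and J: "0 < J"
  shows "real (card {E \<in> reg_graphs n \<Delta>. J < card {W. W \<subseteq> {1..n} \<and> W \<noteq> {} \<and> card W \<le> L \<and> card W \<le> card {e\<in>E. e \<subseteq> W}}})
    \<le> real L * (3 * real L * (real \<Delta>)\<^sup>2) ^ L / real J * real (card (reg_graphs n \<Delta>))"
proof -
  let ?N = "real (card (reg_graphs n \<Delta>))" and ?D = "(real \<Delta>)\<^sup>2"
  define \<W> where "\<W> s = {W. W \<subseteq> {1..n} \<and> card W = s}" for s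
  define Y where "Y E = {W. W \<subseteq> {1..n} \<and> W \<noteq> {} \<and> card W \<le> L \<and> card W \<le> card {e\<in>E. e \<subseteq> W}}" for E
  define X where "X W = {E \<in> reg_graphs n \<Delta>. card W \<le> card {e\<in>E. e \<subseteq> W}}" for W
  define \<A> where "\<A> = {W. W \<subseteq> {1..n} \<and> W \<noteq> {} \<and> card W \<le> L}"
  let ?bad = "{E \<in> reg_graphs n \<Delta>. J < card (Y E)}"
  have fW: "finite (\<W> s)" for s unfolding \<W>_def by simp
  have f\<A>: "finite \<A>" unfolding \<A>_def by simp
  have n0: "0 < real n" using n \<Delta> by simp
  have \<Delta>1: "1 \<le> real \<Delta>" using \<Delta> by simp
  have count: "(\<Sum>W\<in>\<W> s. real (card (X W))) \<le> (3 * real L * ?D) ^ L * ?N" if s: "1 \<le> s" "s \<le> L" for s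
  proof -
    have "(\<Sum>W\<in>\<W> s. real (card (X W))) \<le> (\<Sum>W\<in>\<W> s. (3 * real s) ^ s * (?D / real n) ^ s * ?N)"
    proof (rule sum_mono)
      fix W assume W: "W \<in> \<W> s"
      have "real (card (X W)) \<le> real ((s choose 2) choose s) * (?D / real n) ^ s * ?N"
        using card_reg_graphs_dense_le[of W n s s \<Delta>] W s L \<Delta> n unfolding X_def \<W>_def by auto
      also have "\<dots> \<le> (3 * real s) ^ s * (?D / real n) ^ s * ?N"
        using binomial_pairs_le[of s s] s by (intro mult_right_mono) auto
      finally show "real (card (X W)) \<le> (3 * real s) ^ s * (?D / real n) ^ s * ?N" .
    qed
    also have "\<dots> = real (n choose s) * ((3 * real s) ^ s * (?D / real n) ^ s) * ?N"
      using card_subsets_of_card[of n s] unfolding \<W>_def by simp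
    also have "\<dots> \<le> real n ^ s * ((3 * real s) ^ s * (?D / real n) ^ s) * ?N"
    proof (intro mult_right_mono)
      have "n choose s \<le> n ^ s" by (rule binomial_le_power)
      then show "real (n choose s) \<le> real n ^ s" by (metis of_nat_le_iff of_nat_power)
    qed auto
    also have "\<dots> = (3 * real s * ?D) ^ s * ?N"
      using n0 by (simp add: power_mult_distrib power_divide)
    also have "\<dots> \<le> (3 * real L * ?D) ^ L * ?N"
    proof (rule mult_right_mono)
      have "1 \<le> ?D" by (rule one_le_power[OF \<Delta>1])
      moreover have "1 \<le> 3 * real L" using s by linarith
      ultimately have "1 * 1 \<le> 3 * real L * ?D" by (intro mult_mono) auto
      then have "1 \<le> 3 * real L * ?D" by simp
      then have "(3 * real L * ?D) ^ s \<le> (3 * real L * ?D) ^ L" using s by (intro power_increasing)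
      moreover have "(3 * real s * ?D) ^ s \<le> (3 * real L * ?D) ^ s"
        using s by (intro power_mono mult_right_mono) auto
      ultimately show "(3 * real s * ?D) ^ s \<le> (3 * real L * ?D) ^ L" by linarith
    qed simp
    finally show ?thesis .
  qed
  have "real J * real (card ?bad) = real (\<Sum>E\<in>?bad. J)" by simp
  also have "(\<Sum>E\<in>?bad. J) \<le> (\<Sum>E\<in>?bad. card (Y E))" by (intro sum_mono) auto
  also have "(\<Sum>E\<in>?bad. card (Y E)) \<le> (\<Sum>E\<in>reg_graphs n \<Delta>. card (Y E))"
    using finite_reg_graphs by (intro sum_mono2) auto
  also have "(\<Sum>E\<in>reg_graphs n \<Delta>. card (Y E)) = (\<Sum>E\<in>reg_graphs n \<Delta>. \<Sum>W | W \<in> \<A> \<and> card W \<le> card {e\<in>E. e \<subseteq> W}. 1)"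
    unfolding Y_def \<A>_def by (intro sum.cong refl) (simp add: conj_assoc)
  also have "\<dots> = (\<Sum>W\<in>\<A>. \<Sum>E | E \<in> reg_graphs n \<Delta> \<and> card W \<le> card {e\<in>E. e \<subseteq> W}. 1)"
    by (rule sum.swap_restrict[OF finite_reg_graphs f\<A>])
  also have "\<dots> = (\<Sum>W\<in>\<A>. card (X W))" unfolding X_def by simp
  also have "\<A> = (\<Union>s\<in>{1..L}. \<W> s)"
    unfolding \<A>_def \<W>_def by (auto simp: Suc_le_eq card_gt_0_iff dest: finite_subset[OF _ finite_atLeastAtMost])
  also have "(\<Sum>W\<in>(\<Union>s\<in>{1..L}. \<W> s). card (X W)) = (\<Sum>s\<in>{1..L}. \<Sum>W\<in>\<W> s. card (X W))"
    by (rule sum.UNION_disjoint) (use fW in \<open>auto simp: \<W>_def\<close>)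
  finally have "real J * real (card ?bad) \<le> real (\<Sum>s\<in>{1..L}. \<Sum>W\<in>\<W> s. card (X W))" by simp
  also have "\<dots> = (\<Sum>s\<in>{1..L}. \<Sum>W\<in>\<W> s. real (card (X W)))" by simp
  also have "\<dots> \<le> (\<Sum>s\<in>{1..L}. (3 * real L * ?D) ^ L * ?N)" by (intro sum_mono count) auto
  also have "\<dots> = real L * (3 * real L * ?D) ^ L * ?N" by simp
  finally show ?thesis using J unfolding Y_def by (simp add: field_simps)
qed

section \<open>Slow mixing\<close>

text \<open>The second clause stands for a bound on the number of short cycles: a set inducing at least
  as many edges as it has vertices contains a cycle.\<close>

definition good_graph :: "nat \<Rightarrow> nat \<Rightarrow> nat \<Rightarrow> nat \<Rightarrow> nat set set \<Rightarrow> bool" where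
  "good_graph n u J L E \<longleftrightarrow>
     (\<forall>W\<subseteq>{1..n}. card W \<le> u \<longrightarrow> card {e\<in>E. e \<subseteq> W} \<le> card W + J) \<and>
     card {W. W \<subseteq> {1..n} \<and> W \<noteq> {} \<and> card W \<le> L \<and> card W \<le> card {e\<in>E. e \<subseteq> W}} \<le> J"

lemma prob_good_graph_ge:
  assumes \<Delta>: "3 \<le> \<Delta>" and n: "4 * \<Delta> + 2 * \<Delta>\<^sup>2 \<le> n" and u: "2 * (u + J) \<le> n" "R * u \<le> n"
    and R: "R = 3 * \<Delta>\<^sup>2 * (18 * \<Delta>\<^sup>2) ^ L" and L: "u \<le> L * J" "2 * L \<le> n" "0 < J"
    and ev: "even (n * \<Delta>)"
  shows "1 - real u / 2 ^ u - real L * (3 * real L * (real \<Delta>)\<^sup>2) ^ L / real J \<le> prob_reg n \<Delta> (good_graph n u J L)"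
proof -
  let ?G = "reg_graphs n \<Delta>"
  let ?B1 = "{E \<in> ?G. \<exists>W\<subseteq>{1..n}. card W \<le> u \<and> card W + J < card {e\<in>E. e \<subseteq> W}}"
  let ?B2 = "{E \<in> ?G. J < card {W. W \<subseteq> {1..n} \<and> W \<noteq> {} \<and> card W \<le> L \<and> card W \<le> card {e\<in>E. e \<subseteq> W}}}"
  let ?ok = "{E \<in> ?G. good_graph n u J L E}"
  have "\<Delta> < n" using n \<Delta> by simp
  then have "0 < card ?G" using reg_graphs_nonempty[OF ev] finite_reg_graphs card_gt_0_iff by blast
  then have N: "0 < real (card ?G)" by simp
  have "?G \<subseteq> ?ok \<union> (?B1 \<union> ?B2)"
  proof
    fix E assume E: "E \<in> ?G"
    show "E \<in> ?ok \<union> (?B1 \<union> ?B2)"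
    proof (cases "good_graph n u J L E")
      case False
      then have "(\<exists>W\<subseteq>{1..n}. card W \<le> u \<and> card W + J < card {e\<in>E. e \<subseteq> W}) \<or>
          J < card {W. W \<subseteq> {1..n} \<and> W \<noteq> {} \<and> card W \<le> L \<and> card W \<le> card {e\<in>E. e \<subseteq> W}}"
        unfolding good_graph_def not_le[symmetric] by blast
      then show ?thesis using E by blast
    qed (use E in blast)
  qed
  then have "card ?G \<le> card (?ok \<union> (?B1 \<union> ?B2))"
    using finite_reg_graphs[of n \<Delta>] by (intro card_mono) auto
  also have "\<dots> \<le> card ?ok + (card ?B1 + card ?B2)"
    by (intro order_trans[OF card_Un_le] add_mono order_refl)
  finally have "real (card ?G) \<le> real (card ?ok) + (real (card ?B1) + real (card ?B2))" by simp
  also have "\<dots> \<le> real (card ?ok) + (real u / 2 ^ u * real (card ?G)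
      + real L * (3 * real L * (real \<Delta>)\<^sup>2) ^ L / real J * real (card ?G))"
    by (intro add_left_mono add_mono dense_sets_rare[OF \<Delta> n u R L(1)] short_cycles_rare[OF \<Delta> n L(2,3)])
  finally have "(1 - real u / 2 ^ u - real L * (3 * real L * (real \<Delta>)\<^sup>2) ^ L / real J) * real (card ?G) \<le> real (card ?ok)"
    by (simp add: algebra_simps)
  then show ?thesis unfolding prob_reg_def using N by (simp add: pos_le_divide_eq)
qed

text \<open>The hypothesis \<open>small\<close> gains \<open>(1 / 8) ^ (2 * R)\<close> per defect,
  hence \<open>(1 / 8) ^ n\<close> because \<open>n \<le> 2 * R * u\<close>. After the
  \<open>2 ^ n\<close> choices of the defect set \<open>(1 / 4) ^ n\<close> is left, and the factor
  10 is absorbed for \<open>n \<ge> 4\<close>.\<close>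

lemma good_graph_mix_time:
  fixes lam :: real
  assumes E: "E \<in> reg_graphs n \<Delta>" and good: "good_graph n u J L E" and lam: "1 < lam" and q: "2 \<le> q"
    and u: "2 * u < n" "n \<le> 2 * R * u" and L: "0 < L" "u \<le> L * J" and J: "4 * real J \<le> \<theta> * real u"
    and small: "(real q + real \<Delta> * lam) * lam powr (1 + \<theta>) \<le> (1 / 8) ^ (2 * R) * lam ^ \<Delta>"
    and n: "4 \<le> n"
  shows "2 powr real n \<le> real (mix_time {1..n} E lam q)"
proof -
  have V: "{1..n} \<noteq> {}" using n by auto
  interpret potts "{1..n}" E lam q \<Delta>
    using E lam q V by unfold_locales (auto simp: reg_graphs_def regular_def)
  let ?T = "real (mix_time {1..n} E lam q)" and ?Q = "real q + real \<Delta> * lam"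
  let ?S = "sum wt {\<sigma>\<in>confs. card (defects 1 \<sigma>) = u}"
  have reg: "regular {1..n} E \<Delta>" using E unfolding reg_graphs_def by auto
  have Q0: "0 \<le> ?Q" using lam by simp
  have "?S * lam ^ (\<Delta> * u) \<le> lam ^ card E * 2 ^ card {1..n} * ?Q ^ u * lam ^ (u + 4 * J)"
    by (rule bottleneck_weight_le[OF reg _ _ L])
      (use good in \<open>auto simp: good_graph_def e_in_def\<close>)
  then have S: "?S * lam ^ (\<Delta> * u) \<le> lam ^ card E * (2 ^ n * (?Q ^ u * lam ^ (u + 4 * J)))" by (simp add: mult.assoc)
  have "?Q ^ u * lam ^ (u + 4 * J) \<le> (?Q * lam powr (1 + \<theta>)) ^ u"
  proof -
    have "lam ^ (u + 4 * J) = lam powr real (u + 4 * J)" using lam by (subst powr_realpow) auto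
    also have "\<dots> \<le> lam powr ((1 + \<theta>) * real u)" using J lam by (intro powr_mono) (auto simp: algebra_simps)
    also have "\<dots> = (lam powr (1 + \<theta>)) ^ u" using lam by (simp add: powr_powr[symmetric] powr_realpow)
    finally have "lam ^ (u + 4 * J) \<le> (lam powr (1 + \<theta>)) ^ u" .
    from mult_left_mono[OF this, of "?Q ^ u"] show ?thesis using Q0 by (simp add: power_mult_distrib)
  qed
  also have "\<dots> \<le> ((1 / 8) ^ (2 * R) * lam ^ \<Delta>) ^ u"
    using small Q0 by (intro power_mono) auto
  also have "\<dots> = (1 / 8) ^ (2 * R * u) * lam ^ (\<Delta> * u)" by (simp add: power_mult_distrib power_mult)
  also have "\<dots> \<le> (1 / 8) ^ n * lam ^ (\<Delta> * u)"
    using u(2) lam by (intro mult_right_mono power_decreasing) auto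
  finally have Qu: "?Q ^ u * lam ^ (u + 4 * J) \<le> (1 / 8) ^ n * lam ^ (\<Delta> * u)" .
  have "?S * lam ^ (\<Delta> * u) \<le> lam ^ card E * (2 ^ n * ((1 / 8) ^ n * lam ^ (\<Delta> * u)))"
    using lam by (intro order_trans[OF S] mult_left_mono Qu) auto
  also have "\<dots> = (lam ^ card E * (1 / 4) ^ n) * lam ^ (\<Delta> * u)"
    by (simp flip: power_mult_distrib)
  finally have S': "?S \<le> lam ^ card E * (1 / 4) ^ n" using lam by simp
  have "lam ^ card E \<le> 10 * ?T * ?S" by (rule mix_time_ge_of_defects) (use u q in auto)
  also have "\<dots> \<le> 10 * ?T * (lam ^ card E * (1 / 4) ^ n)" using S' by (intro mult_left_mono) auto
  finally have "lam ^ card E * 1 \<le> lam ^ card E * (10 * ?T * (1 / 4) ^ n)" by (simp add: mult_ac)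
  then have "1 \<le> 10 * ?T * (1 / 4) ^ n" using lam by (subst (asm) mult_le_cancel_left_pos) auto
  then have "4 ^ n \<le> 10 * ?T" by (simp add: power_divide field_simps)
  moreover have "10 * 2 ^ n \<le> (4 ^ n :: real)"
  proof -
    have "(10 :: real) \<le> 2 ^ 4" by simp
    also have "\<dots> \<le> 2 ^ n" using n by (intro power_increasing) auto
    finally have "10 * 2 ^ n \<le> (2 ^ n * 2 ^ n :: real)" by (intro mult_right_mono) auto
    then show ?thesis by (simp flip: power_mult_distrib)
  qed
  ultimately have "2 ^ n \<le> ?T" by linarith
  then show ?thesis by (simp add: powr_realpow)
qed

lemma prob_reg_mono:
  assumes "\<And>E. E \<in> reg_graphs n \<Delta> \<Longrightarrow> P E \<Longrightarrow> Q E"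
  shows "prob_reg n \<Delta> P \<le> prob_reg n \<Delta> Q"
proof -
  have "card {E \<in> reg_graphs n \<Delta>. P E} \<le> card {E \<in> reg_graphs n \<Delta>. Q E}"
    using assms finite_reg_graphs by (intro card_mono) auto
  then show ?thesis unfolding prob_reg_def by (intro divide_right_mono) auto
qed

lemma prob_reg_le_1: "prob_reg n \<Delta> P \<le> 1"
proof -
  have "card {E \<in> reg_graphs n \<Delta>. P E} \<le> card (reg_graphs n \<Delta>)"
    using finite_reg_graphs by (intro card_mono) auto
  then show ?thesis unfolding prob_reg_def by (auto simp: divide_le_eq_1)
qed

theorem slow_mixing:
  fixes \<Delta> :: nat and \<eta> :: real
  assumes \<Delta>: "\<Delta> \<ge> 3" and \<eta>: "0 < \<eta>" "\<eta> < 1"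
  shows "\<exists>c2>0. \<forall>(q::nat) lam::real. q \<ge> 2 \<longrightarrow> lam > 1 \<longrightarrow>
    real q < c2 * lam powr (real \<Delta> - 1 - 1 / (real \<Delta> - 1) - \<eta>) \<longrightarrow>
    aas_reg \<Delta> (\<lambda>n E. real (mix_time {1..n} E lam q) \<ge> 2 powr real n)"
proof -
  \<comment> \<open>Makes \<open>8 / L\<close> at most \<eta>/2, so that \<open>4 * J\<close>,
    roughly \<open>4 * u / L\<close>, costs no more than \<open>lam powr (\<eta> / 2)\<close> per
    defect.\<close>
  define L where "L = nat \<lceil>16 / \<eta>\<rceil>"
  define R where "R = 3 * \<Delta>\<^sup>2 * (18 * \<Delta>\<^sup>2) ^ L"
  define s :: real where "s = (1 / 8) ^ (2 * R)"
  \<comment> \<open>The first bound handles the term \<open>q\<close>. The second, together with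
    \<open>q \<ge> 2\<close>, forces \<open>lam\<close> above
    \<open>(2 * \<Delta> / s)\<^sup>2\<close>, which handles the term
    \<open>\<Delta> * lam\<close>.\<close>
  define c2 where "c2 = min (s / 2) (2 / (2 * real \<Delta> / s) ^ (2 * \<Delta>))"
  have L\<eta>: "16 / \<eta> \<le> real L" unfolding L_def by linarith
  have "16 < 16 / \<eta>" using \<eta> by (simp add: field_simps)
  then have "16 < real L" using L\<eta> by linarith
  then have L: "0 < L" by simp
  have L8: "8 / real L \<le> \<eta> / 2"
  proof -
    have "16 \<le> real L * \<eta>" using L\<eta> \<eta> by (simp add: field_simps)
    then show ?thesis using L by (simp add: field_simps)
  qed
  have R: "27 \<le> R"
  proof -
    have a: "3\<^sup>2 \<le> \<Delta>\<^sup>2" using \<Delta> by (intro power_mono) auto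
    then have "1 \<le> (18 * \<Delta>\<^sup>2) ^ L" by (intro one_le_power) simp
    from mult_le_mono[OF mult_le_mono2[OF a, of 3] this] show ?thesis unfolding R_def by simp
  qed
  have s: "0 < s" "s \<le> 1" unfolding s_def by (auto intro: power_le_one)
  have \<Delta>0: "0 < 2 * real \<Delta> / s" using s \<Delta> by simp
  have c2: "0 < c2" unfolding c2_def using s \<Delta>0 by simp
  define M where "M = real L * (3 * real L * (real \<Delta>)\<^sup>2) ^ L"
  have M: "0 \<le> M" unfolding M_def by simp
  show ?thesis
  proof (intro exI[of _ c2] conjI allI impI c2)
    fix q :: nat and lam :: real
    assume q: "q \<ge> 2" and lam: "lam > 1"
      and qs: "real q < c2 * lam powr (real \<Delta> - 1 - 1 / (real \<Delta> - 1) - \<eta>)"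
    have \<Delta>1: "0 \<le> 1 / (real \<Delta> - 1)" using \<Delta> by simp
    have small: "(real q + real \<Delta> * lam) * lam powr (1 + \<eta> / 2) \<le> s * lam ^ \<Delta>"
    proof -
      have l\<Delta>: "lam powr real \<Delta> = lam ^ \<Delta>" using lam by (simp add: powr_realpow)
      have "lam powr (real \<Delta> - 1 - 1 / (real \<Delta> - 1) - \<eta>) \<le> lam powr real \<Delta>"
        by (intro powr_mono) (use lam \<eta> \<Delta>1 in linarith)+
      then have "2 < c2 * lam ^ \<Delta>"
        using qs q c2 l\<Delta> mult_left_mono[of "lam powr (real \<Delta> - 1 - 1 / (real \<Delta> - 1) - \<eta>)" "lam ^ \<Delta>" c2] by linarith
      also have "\<dots> \<le> 2 / (2 * real \<Delta> / s) ^ (2 * \<Delta>) * lam ^ \<Delta>"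
        using lam unfolding c2_def by (intro mult_right_mono) auto
      finally have "((2 * real \<Delta> / s)\<^sup>2) ^ \<Delta> < lam ^ \<Delta>"
      proof -
        have gen: "a < b" if "2 < 2 / a * b" "0 < a" for a b :: real using that by (simp add: field_simps)
        show "2 < 2 / (2 * real \<Delta> / s) ^ (2 * \<Delta>) * lam ^ \<Delta> \<Longrightarrow> ((2 * real \<Delta> / s)\<^sup>2) ^ \<Delta> < lam ^ \<Delta>"
          unfolding power_mult[of _ 2 \<Delta>] by (erule gen) (intro zero_less_power \<Delta>0)
      qed
      then have "(2 * real \<Delta> / s)\<^sup>2 < lam" using lam by (rule_tac power_less_imp_less_base) auto
      then have "2 * real \<Delta> / s \<le> sqrt lam" using \<Delta>0 by (intro real_le_rsqrt) auto
      then have sq: "real \<Delta> \<le> s / 2 * lam powr (1 / 2)"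
        using s lam by (simp add: powr_half_sqrt field_simps)
      have a: "real q * lam powr (1 + \<eta> / 2) \<le> s / 2 * lam ^ \<Delta>"
      proof -
        have "real q * lam powr (1 + \<eta> / 2)
            \<le> c2 * lam powr (real \<Delta> - 1 - 1 / (real \<Delta> - 1) - \<eta>) * lam powr (1 + \<eta> / 2)"
          using qs by (intro mult_right_mono) auto
        also have "\<dots> = c2 * lam powr (real \<Delta> - 1 - 1 / (real \<Delta> - 1) - \<eta> + (1 + \<eta> / 2))"
          by (simp only: powr_add mult.assoc)
        also have "\<dots> \<le> c2 * lam powr real \<Delta>"
          by (intro mult_left_mono powr_mono) (use lam \<eta> \<Delta>1 c2 in linarith)+
        also have "\<dots> \<le> s / 2 * lam ^ \<Delta>"
          unfolding l\<Delta> using lam by (intro mult_right_mono) (auto simp: c2_def)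
        finally show ?thesis .
      qed
      have "real \<Delta> * lam * lam powr (1 + \<eta> / 2) = real \<Delta> * lam powr (1 + (1 + \<eta> / 2))"
        using lam by (simp only: powr_add powr_one mult.assoc)
      also have "\<dots> \<le> (s / 2 * lam powr (1 / 2)) * lam powr (1 + (1 + \<eta> / 2))"
        using sq by (intro mult_right_mono) auto
      also have "\<dots> = s / 2 * lam powr (1 / 2 + (1 + (1 + \<eta> / 2)))"
        by (simp only: powr_add mult.assoc)
      \<comment> \<open>The exponent is 5/2 + \<eta>/2, which is below 3 and so at most
        \<Delta>.\<close>
      also have "\<dots> \<le> s / 2 * lam powr real \<Delta>"
        using lam \<eta> \<Delta> s by (intro mult_left_mono powr_mono) auto
      finally have b: "real \<Delta> * lam * lam powr (1 + \<eta> / 2) \<le> s / 2 * lam ^ \<Delta>" using l\<Delta> by simp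
      show ?thesis using a b by (simp add: distrib_right)
    qed
    let ?P = "\<lambda>n E. real (mix_time {1..n} E lam q) \<ge> 2 powr real n"
    let ?F = "inf sequentially (principal {n. even (n * \<Delta>)})"
    define u where "u n = n div R" for n
    have lower: "1 - real (u n) / 2 ^ u n - M * real L / real (u n) \<le> prob_reg n \<Delta> (?P n)"
      if ev: "even (n * \<Delta>)" and big: "n \<ge> R * L + (4 * \<Delta> + 2 * \<Delta>\<^sup>2) + 4" for n
    proof -
      \<comment> \<open>Rounded up so that \<open>u n \<le> L * J\<close>; the added 1 is harmless
        once \<open>L \<le> u n\<close>.\<close>
      define J where "J = u n div L + 1"
      have uR: "R * u n \<le> n" unfolding u_def by (metis div_times_less_eq_dividend mult.commute)
      have "R * L div R \<le> n div R" using big by (intro div_le_mono) simp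
      then have uL: "L \<le> u n" unfolding u_def using R by simp
      have un: "n \<le> 2 * R * u n"
      proof -
        have "n mod R < R" using R by simp
        moreover have "n = R * u n + n mod R" unfolding u_def by simp
        moreover have "R * 1 \<le> R * u n" using uL L by (intro mult_le_mono2) simp
        ultimately show ?thesis by linarith
      qed
      have LJ: "u n \<le> L * J"
      proof -
        have "u n = L * (u n div L) + u n mod L" by simp
        moreover have "u n mod L < L" using L by simp
        ultimately have "u n \<le> L * (u n div L) + L" by linarith
        then show ?thesis unfolding J_def by simp
      qed
      have "u n div L \<le> u n" by (rule div_le_dividend)
      then have Ju: "J \<le> u n + 1" unfolding J_def by simp
      have "27 * u n \<le> n" using uR R mult_le_mono1[of 27 R "u n"] by linarith
      then have u2: "2 * (u n + J) \<le> n" "2 * u n < n" "2 * L \<le> n" using Ju uL L by auto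
      have J4: "4 * real J \<le> \<eta> / 2 * real (u n)"
      proof -
        have "real (u n div L) \<le> real (u n) / real L" by (rule of_nat_div_le_of_nat)
        moreover have "1 \<le> real (u n) / real L" using uL L by (simp add: field_simps)
        ultimately have "4 * real J \<le> 8 / real L * real (u n)" unfolding J_def by simp
        also have "\<dots> \<le> \<eta> / 2 * real (u n)" using L8 by (intro mult_right_mono) auto
        finally show ?thesis .
      qed
      have "1 - real (u n) / 2 ^ u n - M * real L / real (u n) \<le> 1 - real (u n) / 2 ^ u n - M / real J"
      proof -
        have "real (u n) \<le> real L * real J" using LJ by (metis of_nat_le_iff of_nat_mult)
        then have "M * real (u n) \<le> M * (real L * real J)" using M by (intro mult_left_mono)
        then have "M / real J \<le> M * real L / real (u n)"
          using uL L by (simp add: field_simps J_def)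
        then show ?thesis by simp
      qed
      also have "\<dots> \<le> prob_reg n \<Delta> (good_graph n (u n) J L)"
        unfolding M_def
        by (rule prob_good_graph_ge[OF \<Delta> _ u2(1) uR R_def LJ u2(3) _ ev]) (use big in \<open>auto simp: J_def\<close>)
      also have "\<dots> \<le> prob_reg n \<Delta> (?P n)"
      proof (rule prob_reg_mono)
        fix E assume "E \<in> reg_graphs n \<Delta>" "good_graph n (u n) J L E"
        then show "?P n E"
          by (rule good_graph_mix_time[OF _ _ lam q u2(2) un L LJ J4]) (use small big in \<open>auto simp: s_def\<close>)
      qed
      finally show ?thesis .
    qed
    have ulim: "filterlim u at_top sequentially"
      unfolding filterlim_at_top
    proof
      fix Z
      show "\<forall>\<^sub>F n in sequentially. Z \<le> u n"
      proof (rule eventually_sequentiallyI[of "R * Z"])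
        fix n assume "R * Z \<le> n"
        then have "R * Z div R \<le> n div R" by (rule div_le_mono)
        then show "Z \<le> u n" unfolding u_def using R by simp
      qed
    qed
    have "(\<lambda>k::nat. real k / 2 ^ k) \<longlonglongrightarrow> 0"
      using powser_times_n_limit_0[of "1 / 2 :: real"] by (simp add: power_divide)
    then have "(\<lambda>k::nat. 1 - real k / 2 ^ k - M * real L / real k) \<longlonglongrightarrow> 1 - 0 - 0"
      by (intro tendsto_diff tendsto_const lim_const_over_n)
    from filterlim_compose[OF this ulim]
    have "(\<lambda>n. 1 - real (u n) / 2 ^ u n - M * real L / real (u n)) \<longlonglongrightarrow> 1" by simp
    then have lim: "((\<lambda>n. 1 - real (u n) / 2 ^ u n - M * real L / real (u n)) \<longlongrightarrow> 1) ?F"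
      by (rule tendsto_mono[OF inf_le1])
    show "aas_reg \<Delta> ?P"
      unfolding aas_reg_def
    proof (rule tendsto_sandwich[OF _ _ lim tendsto_const])
      show "\<forall>\<^sub>F n in ?F. 1 - real (u n) / 2 ^ u n - M * real L / real (u n) \<le> prob_reg n \<Delta> (?P n)"
        unfolding eventually_inf_principal
        by (rule eventually_sequentiallyI[of "R * L + (4 * \<Delta> + 2 * \<Delta>\<^sup>2) + 4"]) (use lower in auto)
      show "\<forall>\<^sub>F n in ?F. prob_reg n \<Delta> (?P n) \<le> 1" by (simp add: prob_reg_le_1)
    qed
  qed
qed

theorem theorem2:
  fixes \<Delta> :: nat
  assumes "\<Delta> \<ge> 2"
  shows "\<forall>\<eta>::real. 0 < \<eta> \<and> \<eta> < 1 \<longrightarrow>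
    (\<exists>c1 c2 :: real. c1 > 0 \<and> c2 > 0 \<and>
      (\<forall>(q::nat) (lam::real). q \<ge> 2 \<and> lam > 1 \<longrightarrow>
        ((real q > c1 * lam powr (real \<Delta> - 1 + \<eta>) \<longrightarrow>
            mixes_rapidly_on (\<lambda>V E. simple_graph V E \<and> connected_graph V E \<and> max_degree_eq V E \<Delta>) lam q)
         \<and>
         (\<Delta> \<ge> 3 \<and> real q < c2 * lam powr (real \<Delta> - 1 - 1 / (real \<Delta> - 1) - \<eta>) \<longrightarrow>
            (\<exists>b::real. b > 0 \<and>
               aas_reg \<Delta> (\<lambda>n E. real (mix_time {1..n} E lam q) \<ge> 2 powr (b * real n)))))))"
proof (intro allI impI)
  fix \<eta> :: real assume \<eta>: "0 < \<eta> \<and> \<eta> < 1"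
  obtain c1 where c1: "c1 > 0" "\<And>(q::nat) lam::real. q \<ge> 2 \<Longrightarrow> lam > 1 \<Longrightarrow> real q > c1 * lam powr (real \<Delta> - 1 + \<eta>) \<Longrightarrow>
      mixes_rapidly_on (\<lambda>V E. simple_graph V E \<and> connected_graph V E \<and> max_degree_eq V E \<Delta>) lam q"
    using rapid_mixing[OF assms, of \<eta>] \<eta> by blast
  obtain c2 where c2: "c2 > 0" "\<And>(q::nat) lam::real. \<Delta> \<ge> 3 \<Longrightarrow> q \<ge> 2 \<Longrightarrow> lam > 1 \<Longrightarrow>
      real q < c2 * lam powr (real \<Delta> - 1 - 1 / (real \<Delta> - 1) - \<eta>) \<Longrightarrow>
      aas_reg \<Delta> (\<lambda>n E. real (mix_time {1..n} E lam q) \<ge> 2 powr real n)"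
  proof (cases "\<Delta> \<ge> 3")
    case True
    then show ?thesis using slow_mixing[OF True, of \<eta>] \<eta> that by blast
  next
    case False
    \<comment> \<open>For \<Delta> = 2 the slow mixing claim is vacuous and any positive constant
      will do.\<close>
    then show ?thesis using that[of 1] by simp
  qed
  show "\<exists>c1 c2 :: real. c1 > 0 \<and> c2 > 0 \<and>
      (\<forall>(q::nat) (lam::real). q \<ge> 2 \<and> lam > 1 \<longrightarrow>
        ((real q > c1 * lam powr (real \<Delta> - 1 + \<eta>) \<longrightarrow>
            mixes_rapidly_on (\<lambda>V E. simple_graph V E \<and> connected_graph V E \<and> max_degree_eq V E \<Delta>) lam q)
         \<and>
         (\<Delta> \<ge> 3 \<and> real q < c2 * lam powr (real \<Delta> - 1 - 1 / (real \<Delta> - 1) - \<eta>) \<longrightarrow>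
            (\<exists>b::real. b > 0 \<and>
               aas_reg \<Delta> (\<lambda>n E. real (mix_time {1..n} E lam q) \<ge> 2 powr (b * real n))))))"
    using c1 c2 by (intro exI[of _ c1] exI[of _ c2] conjI allI impI exI[of _ "1::real"]) auto
qed

end
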